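(* Let $k$ be a positive integer, and let $G$ be a graph without components isomorphic to $P_3$. Then $G$ is a disconnected cograph minimal $(\infty,k)$-polar obstruction without isolated vertices if and only if there exist positive integers $k_1,k_2$ and cographs $H_1,H_2$ such that: (1) $G = H_1 + H_2$; (2) $k = k_1 + k_2 - 1$; (3) for each $i \in \{1,2\}$, either $H_i$ is a cograph minimal $(1,k_i-1)$-polar obstruction that is neither a cograph minimal $(1,\infty)$-polar obstruction nor isomorphic to $k_iK_2$, or $k_i \ge 2$ and $H_i \cong (k_i-2)K_2 + (K_1 \oplus 2K_2)$; and (4) for $\{i,j\}=\{1,2\}$, if $H_i \cong (k_i-2)K_2 + (K_1 \oplus 2K_2)$ and $G - H_i$ (which is $H_j$) is a cograph minimal $(1,k_j-1)$-polar obstruction, then $G - H_i$ has exactly one component not isomorphic to $K_2$.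
   Context: All graphs are finite and simple. A cograph is a graph with no induced subgraph isomorphic to $P_4$. $G+H$ denotes disjoint union, $G \oplus H$ the join (disjoint union plus all edges between $G$ and $H$), $nG$ the disjoint union of $n$ copies of $G$ ($0G$ is the empty graph); $K_n$, $P_n$ denote the complete graph and path on $n$ vertices. A component is trivial (an isolated vertex) if it is isomorphic to $K_1$. A cluster is a disjoint union of complete graphs. For $s,k \in \mathbb{Z}_{\ge 0}\cup\{\infty\}$, an $(s,k)$-polar partition of $G$ is a partition $(A,B)$ of $V(G)$ (parts may be empty) such that $G[A]$ is a complete multipartite graph with at most $s$ parts and $G[B]$ is a cluster with at most $k$ components; $\infty$ means unbounded. $G$ is $(s,k)$-polar if it has such a partition. A cograph minimal $(s,k)$-polar obstruction is a cograph that is not $(s,k)$-polar but all of whose proper induced subgraphs are $(s,k)$-polar. *)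

theory Defs
  imports
    "Graph_Theory.Digraph_Component"
    "Graph_Theory.Digraph_Isomorphism"
    "HOL-Library.Disjoint_Sets"
    "HOL-Library.Extended_Nat"
begin

text \<open>
  A finite simple graph is a digraph satisfying the library predicate \<^const>\<open>graph\<close>: finite,
  symmetric, loop-free and without parallel arcs. Each edge is thus a pair of opposite arcs, and
  the strongly connected components are the ordinary components, as (nonempty) induced subgraphs.
\<close>

abbreviation graph_components :: "('a, 'b) pre_digraph \<Rightarrow> ('a, 'b) pre_digraph set" where
  "graph_components G \<equiv> pre_digraph.sccs G"


section \<open>Named graphs and operations\<close>

definition complete_graph :: "nat \<Rightarrow> (nat, nat \<times> nat) pre_digraph" where
  "complete_graph n = with_proj
     \<lparr> pverts = {..<n}, parcs = {(i, j). i < n \<and> j < n \<and> i \<noteq> j} \<rparr>"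

definition path_graph :: "nat \<Rightarrow> (nat, nat \<times> nat) pre_digraph" where
  "path_graph n = with_proj
     \<lparr> pverts = {..<n}, parcs = {(i, j). i < n \<and> j < n \<and> (j = Suc i \<or> i = Suc j)} \<rparr>"

definition disjoint_sum ::
  "('a, 'b) pre_digraph \<Rightarrow> ('c, 'd) pre_digraph \<Rightarrow> ('a + 'c, ('a + 'c) \<times> ('a + 'c)) pre_digraph" where
  "disjoint_sum G H = with_proj
     \<lparr> pverts = Inl ` verts G \<union> Inr ` verts H,
       parcs = map_prod Inl Inl ` arcs_ends G \<union> map_prod Inr Inr ` arcs_ends H \<rparr>"

definition graph_join ::
  "('a, 'b) pre_digraph \<Rightarrow> ('c, 'd) pre_digraph \<Rightarrow> ('a + 'c, ('a + 'c) \<times> ('a + 'c)) pre_digraph" where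
  "graph_join G H = with_proj
     \<lparr> pverts = Inl ` verts G \<union> Inr ` verts H,
       parcs = map_prod Inl Inl ` arcs_ends G \<union> map_prod Inr Inr ` arcs_ends H
         \<union> (Inl ` verts G) \<times> (Inr ` verts H) \<union> (Inr ` verts H) \<times> (Inl ` verts G) \<rparr>"

definition copies ::
  "nat \<Rightarrow> ('a, 'b) pre_digraph \<Rightarrow> (nat \<times> 'a, (nat \<times> 'a) \<times> (nat \<times> 'a)) pre_digraph" where
  "copies n G = with_proj
     \<lparr> pverts = {..<n} \<times> verts G,
       parcs = {((i, u), (j, v)). i < n \<and> i = j \<and> (u, v) \<in> arcs_ends G} \<rparr>"

text \<open>
  The equation \<open>G = H\<^sub>1 + H\<^sub>2\<close> for vertex-disjoint subgraphs of \<open>G\<close>. The library operation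
  \<^const>\<open>union\<close> is only meaningful for \<^const>\<open>compatible\<close> arguments, i.e. those sharing their
  incidence functions.
\<close>

definition is_disjoint_union ::
  "('a, 'b) pre_digraph \<Rightarrow> ('a, 'b) pre_digraph \<Rightarrow> ('a, 'b) pre_digraph \<Rightarrow> bool" where
  "is_disjoint_union G H1 H2 \<longleftrightarrow>
     compatible H1 H2 \<and> verts H1 \<inter> verts H2 = {} \<and> G = union H1 H2"

definition delete_subgraph ::
  "('a, 'b) pre_digraph \<Rightarrow> ('a, 'b) pre_digraph \<Rightarrow> ('a, 'b) pre_digraph" where
  "delete_subgraph G H = G \<restriction> (verts G - verts H)"


section \<open>Cographs and polarity\<close>

definition cograph :: "('a, 'b) pre_digraph \<Rightarrow> bool" where
  "cograph G \<longleftrightarrow> graph G \<and> \<not> (\<exists>H. induced_subgraph H G \<and> digraph_iso H (path_graph 4))"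

definition complete_multipartite_at_most :: "enat \<Rightarrow> ('a, 'b) pre_digraph \<Rightarrow> bool" where
  "complete_multipartite_at_most s G \<longleftrightarrow>
     (\<exists>P. partition_on (verts G) P \<and> enat (card P) \<le> s \<and>
        arcs_ends G = {(u, v). u \<in> verts G \<and> v \<in> verts G \<and> \<not> (\<exists>X \<in> P. u \<in> X \<and> v \<in> X)})"

definition cluster :: "('a, 'b) pre_digraph \<Rightarrow> bool" where
  "cluster G \<longleftrightarrow>
     (\<exists>P. partition_on (verts G) P \<and>
        arcs_ends G = {(u, v). u \<noteq> v \<and> (\<exists>X \<in> P. u \<in> X \<and> v \<in> X)})"

definition polar_partition ::
  "enat \<Rightarrow> enat \<Rightarrow> ('a, 'b) pre_digraph \<Rightarrow> 'a set \<Rightarrow> 'a set \<Rightarrow> bool" where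
  "polar_partition s k G A B \<longleftrightarrow>
     A \<union> B = verts G \<and> A \<inter> B = {} \<and>
     complete_multipartite_at_most s (G \<restriction> A) \<and>
     cluster (G \<restriction> B) \<and> enat (card (graph_components (G \<restriction> B))) \<le> k"

definition polar :: "enat \<Rightarrow> enat \<Rightarrow> ('a, 'b) pre_digraph \<Rightarrow> bool" where
  "polar s k G \<longleftrightarrow> (\<exists>A B. polar_partition s k G A B)"

definition cograph_minimal_polar_obstruction ::
  "enat \<Rightarrow> enat \<Rightarrow> ('a, 'b) pre_digraph \<Rightarrow> bool" where
  "cograph_minimal_polar_obstruction s k G \<longleftrightarrow>
     cograph G \<and> \<not> polar s k G \<and> (\<forall>H. induced_subgraph H G \<and> H \<noteq> G \<longrightarrow> polar s k H)"

text \<open>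
  \<open>G \<cong> (k - 2) K\<^sub>2 + (K\<^sub>1 \<oplus> 2 K\<^sub>2)\<close>, which presupposes \<open>k \<ge> 2\<close>; the conjunct keeps the
  truncated subtraction from giving the expression a meaning for smaller \<open>k\<close>.
\<close>

definition is_bowtie_plus_edges :: "nat \<Rightarrow> ('a, 'b) pre_digraph \<Rightarrow> bool" where
  "is_bowtie_plus_edges k G \<longleftrightarrow>
     k \<ge> 2 \<and>
     digraph_iso G
       (disjoint_sum (copies (k - 2) (complete_graph 2))
          (graph_join (complete_graph 1) (copies 2 (complete_graph 2))))"

end

theory Submission
  imports Defs
begin

text \<open>
  For a vertex set \<open>S\<close> let \<open>f S\<close> be the least \<open>k\<close> such that \<open>S\<close> is \<open>(1, k)\<close>-polar and \<open>g S\<close> the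
  least \<open>k\<close> such that it is \<open>(\<infinity>, k)\<close>-polar (\<open>mpol\<close> and \<open>pol\<close> below). The invariant \<open>f\<close> is additive
  over components. A complete multipartite graph with an edge is connected, so \<open>g = f\<close> as soon as
  two components are not complete, and the obstructions with two such components are governed by \<open>f\<close>.
  A connected cograph is a join, and in a partition of a join into an independent set and a cluster
  either the two parts are the two sides of the join or the cluster is a clique. Hence a connected
  cograph with \<open>2 \<le> f C < \<infinity>\<close> is an independent set joined to a cluster with \<open>f C\<close> cliques.

  This shape gives \<open>g C < f C\<close>, by moving one clique to the other side, which excludes minimal
  obstructions with at most one noncomplete component; it also yields a vertex whose removal lowers
  \<open>f C\<close> by at most one, so a minimal obstruction \<open>G\<close> has \<open>f G = k + 1\<close>. If removing any vertex lowers
  \<open>f\<close>, each summand is a minimal \<open>(1, k\<^sub>i - 1)\<close>-polar obstruction. Otherwise removing the offending vertex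
  must leave at most one noncomplete component, and the shape forces its component to be the
  bowtie \<open>K\<^sub>1 \<oplus> 2K\<^sub>2\<close>.
\<close>

section \<open>Connectedness and clusters in a symmetric relation\<close>

text \<open>The difficulty is that minimality speaks about \<open>pol\<close>, whereas additivity,
  and with it any splitting of the graph, is available for \<open>mpol\<close> only. A deletion
  yields usable information when two components still contain an induced P3 afterwards, for then the
  two invariants agree on what is left. This is where a P3 component would do harm: each of its
  vertex deletions leaves a cluster, while a larger noncomplete component always has a vertex that
  can be spared. The bowtie arises from the same tension. Deleting its centre leaves 2K2, a cluster
  that is no cheaper, so the bound for the remaining graph has to come from \<open>pol\<close>: the
  other summand must save one clique by hosting the multipartite side, and with two noncomplete
  components it could not. That is condition (4). The equation k = k1 + k2 - 1 says that the value k
  + 1 of the whole graph is the sum of the values of the summands, an admissible summand having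
  \<open>mpol\<close> exactly k_i.\<close>

lemma INF_enat_le_iff:
  fixes h :: "'b \<Rightarrow> nat"
  shows "(INF x \<in> A. enat (h x)) \<le> enat k \<longleftrightarrow> (\<exists>x\<in>A. h x \<le> k)"
proof
  assume l: "(INF x \<in> A. enat (h x)) \<le> enat k"
  then have "A \<noteq> {}" by (auto simp: top_enat_def)
  then have "(INF x \<in> A. enat (h x)) \<in> (\<lambda>x. enat (h x)) ` A"
    unfolding Inf_enat_def by (auto intro: LeastI)
  then show "\<exists>x\<in>A. h x \<le> k" using l by auto
next
  assume "\<exists>x\<in>A. h x \<le> k"
  then show "(INF x \<in> A. enat (h x)) \<le> enat k"
    by (meson INF_lower2 enat_ord_simps(1))
qed

text \<open>Against \<infinity> nothing is to be shown, so each comparison of infima below may start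
  from a partition that attains the right-hand side.\<close>

lemma enat_leI_finite:
  fixes x y :: enat
  assumes "\<And>k. y = enat k \<Longrightarrow> x \<le> enat k"
  shows "x \<le> y"
  using assms by (cases y) auto

text \<open>The relation has no carrier: induced subgraphs are vertex sets, so deletion, restriction
  and disjoint union become set operations. The complement is a second instance of the same
  locale.\<close>

locale sgraph =
  fixes E :: "'a \<Rightarrow> 'a \<Rightarrow> bool"
  assumes sym: "E x y \<Longrightarrow> E y x"
    and irrefl: "\<not> E x x"
begin

definition indep :: "'a set \<Rightarrow> bool" where
  "indep S \<longleftrightarrow> (\<forall>x\<in>S. \<forall>y\<in>S. \<not> E x y)"

definition clique :: "'a set \<Rightarrow> bool" where
  "clique S \<longleftrightarrow> (\<forall>x\<in>S. \<forall>y\<in>S. x \<noteq> y \<longrightarrow> E x y)"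

text \<open>The absence of an induced P3: adjacency or equality is transitive on \<open>S\<close>,
  and its classes are the cliques.\<close>

definition clustered :: "'a set \<Rightarrow> bool" where
  "clustered S \<longleftrightarrow> (\<forall>x\<in>S. \<forall>y\<in>S. \<forall>z\<in>S. E x y \<longrightarrow> E y z \<longrightarrow> x \<noteq> z \<longrightarrow> E x z)"

text \<open>Non-adjacency is reflexive and symmetric anyway; once transitive, its classes are the
  parts.\<close>

definition multipartite :: "'a set \<Rightarrow> bool" where
  "multipartite S \<longleftrightarrow> (\<forall>x\<in>S. \<forall>y\<in>S. \<forall>z\<in>S. \<not> E x y \<longrightarrow> \<not> E y z \<longrightarrow> \<not> E x z)"

text \<open>The four vertices of a counterexample are automatically distinct: \<open>a = c\<close>
  or \<open>b = d\<close> would turn an edge of the path into the chord \<open>a d\<close>, and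
  \<open>a = d\<close> would turn \<open>c d\<close> into the chord \<open>a c\<close>.\<close>

definition p4_free :: "'a set \<Rightarrow> bool" where
  "p4_free S \<longleftrightarrow> (\<forall>a\<in>S. \<forall>b\<in>S. \<forall>c\<in>S. \<forall>d\<in>S.
     E a b \<longrightarrow> E b c \<longrightarrow> E c d \<longrightarrow> E a c \<or> E b d \<or> E a d)"

definition sep :: "'a set \<Rightarrow> 'a set \<Rightarrow> bool" where
  "sep S T \<longleftrightarrow> (\<forall>x\<in>S. \<forall>y\<in>T. \<not> E x y)"

definition joined :: "'a set \<Rightarrow> 'a set \<Rightarrow> bool" where
  "joined S T \<longleftrightarrow> (\<forall>x\<in>S. \<forall>y\<in>T. E x y)"

text \<open>Connectedness by cuts rather than walks, because separated sets, joins and multipartite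
  sets all act directly on cuts.\<close>

definition conn :: "'a set \<Rightarrow> bool" where
  "conn K \<longleftrightarrow> K \<noteq> {} \<and> (\<forall>X\<subseteq>K. X \<noteq> {} \<longrightarrow> X \<noteq> K \<longrightarrow> \<not> sep X (K - X))"

text \<open>Maximality follows from separation: such a set contains every connected subset of
  \<open>S\<close> that it meets (\<open>conn_subset_comp\<close>).\<close>

definition comps :: "'a set \<Rightarrow> 'a set set" where
  "comps S = {K. K \<subseteq> S \<and> conn K \<and> sep K (S - K)}"

lemma sep_commute: "sep S T \<longleftrightarrow> sep T S"
  unfolding sep_def using sym by blast

lemma joined_commute: "joined S T \<longleftrightarrow> joined T S"
  unfolding joined_def using sym by blast

lemma sep_mono: "sep S T \<Longrightarrow> S' \<subseteq> S \<Longrightarrow> T' \<subseteq> T \<Longrightarrow> sep S' T'"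
  unfolding sep_def by blast

lemma indep_mono: "indep S \<Longrightarrow> T \<subseteq> S \<Longrightarrow> indep T"
  unfolding indep_def by blast

lemma clique_mono: "clique S \<Longrightarrow> T \<subseteq> S \<Longrightarrow> clique T"
  unfolding clique_def by blast

lemma clustered_mono: "clustered S \<Longrightarrow> T \<subseteq> S \<Longrightarrow> clustered T"
  unfolding clustered_def by blast

lemma multipartite_mono: "multipartite S \<Longrightarrow> T \<subseteq> S \<Longrightarrow> multipartite T"
  unfolding multipartite_def by blast

lemma p4_free_mono: "p4_free S \<Longrightarrow> T \<subseteq> S \<Longrightarrow> p4_free T"
  unfolding p4_free_def by blast

lemma indep_imp_multipartite: "indep S \<Longrightarrow> multipartite S"
  unfolding indep_def multipartite_def by blast

lemma clique_imp_clustered: "clique S \<Longrightarrow> clustered S"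
  unfolding clique_def clustered_def by blast

lemma clique_imp_multipartite: "clique S \<Longrightarrow> multipartite S"
  unfolding clique_def multipartite_def using irrefl by metis

lemma indep_Un: "indep S \<Longrightarrow> indep T \<Longrightarrow> sep S T \<Longrightarrow> indep (S \<union> T)"
  unfolding indep_def sep_def using sym by blast

lemma clustered_Un: "clustered S \<Longrightarrow> clustered T \<Longrightarrow> sep S T \<Longrightarrow> clustered (S \<union> T)"
  unfolding clustered_def sep_def using sym by blast

lemma p4_free_Un: "p4_free S \<Longrightarrow> p4_free T \<Longrightarrow> sep S T \<Longrightarrow> p4_free (S \<union> T)"
proof -
  assume S: "p4_free S" and T: "p4_free T" and s: "sep S T"
  show "p4_free (S \<union> T)"
    unfolding p4_free_def
  proof (intro ballI impI)
    fix a b c d assume v: "a \<in> S \<union> T" "b \<in> S \<union> T" "c \<in> S \<union> T" "d \<in> S \<union> T"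
      and e: "E a b" "E b c" "E c d"
    have e': "\<not> E x y" if "x \<in> S" "y \<in> T" for x y
      using s that unfolding sep_def by blast
    have "{a, b, c, d} \<subseteq> S \<or> {a, b, c, d} \<subseteq> T"
      using v e e' sym[OF e(1)] sym[OF e(2)] sym[OF e(3)] by auto
    then show "E a c \<or> E b d \<or> E a d"
      using S T e unfolding p4_free_def by simp blast
  qed
qed

lemma conn_nonempty: "conn K \<Longrightarrow> K \<noteq> {}"
  unfolding conn_def by blast

lemma connD: "conn K \<Longrightarrow> X \<subseteq> K \<Longrightarrow> X \<noteq> {} \<Longrightarrow> X \<noteq> K \<Longrightarrow> \<not> sep X (K - X)"
  unfolding conn_def by blast

text \<open>Otherwise \<open>K \<inter> T\<close> would be one side of an edgeless cut of
  \<open>K\<close>.\<close>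

lemma conn_subset_closed:
  assumes "conn K" "K \<subseteq> S" "sep T (S - T)" "K \<inter> T \<noteq> {}"
  shows "K \<subseteq> T"
proof (rule ccontr)
  assume "\<not> K \<subseteq> T"
  then have "K \<inter> T \<noteq> K" by blast
  moreover have "sep (K \<inter> T) (K - K \<inter> T)"
    using assms(2,3) by (auto intro: sep_mono)
  ultimately show False
    using assms(1,4) unfolding conn_def by blast
qed

lemma conn_subset_Un:
  assumes "conn K" "K \<subseteq> S \<union> T" "sep S T"
  shows "K \<subseteq> S \<or> K \<subseteq> T"
proof (rule ccontr)
  assume "\<not> ?thesis"
  then have "K \<inter> S \<noteq> {}" "\<not> K \<subseteq> S"
    using assms(2) by auto
  moreover have "sep S (S \<union> T - S)"
    using assms(3) unfolding sep_def by auto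
  ultimately show False
    using conn_subset_closed[OF assms(1,2)] by blast
qed

lemma conn_singleton: "conn {x}"
  unfolding conn_def by auto

lemma conn_clique: "clique K \<Longrightarrow> K \<noteq> {} \<Longrightarrow> conn K"
  unfolding conn_def clique_def sep_def
  by (metis DiffD1 DiffD2 DiffI ex_in_conv subsetD subset_antisym subsetI)

lemma conn_joined:
  assumes "joined X Y" "X \<noteq> {}" "Y \<noteq> {}"
  shows "conn (X \<union> Y)"
  unfolding conn_def
proof (intro conjI allI impI)
  show "X \<union> Y \<noteq> {}" using assms(2) by blast
  fix Z assume Z: "Z \<subseteq> X \<union> Y" "Z \<noteq> {}" "Z \<noteq> X \<union> Y"
  show "\<not> sep Z (X \<union> Y - Z)"
  proof
    assume "sep Z (X \<union> Y - Z)"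
    then have s: "\<And>x y. x \<in> Z \<Longrightarrow> y \<in> X \<union> Y \<Longrightarrow> E x y \<Longrightarrow> y \<in> Z"
      unfolding sep_def by blast
    have j: "\<And>x y. x \<in> X \<Longrightarrow> y \<in> Y \<Longrightarrow> E x y \<and> E y x"
      using assms(1) sym unfolding joined_def by blast
    have "X \<union> Y \<subseteq> Z"
    proof (cases "Z \<inter> X = {}")
      case True
      then obtain y where "y \<in> Z" "y \<in> Y" using Z by blast
      then have "X \<subseteq> Z" using s j by blast
      then show ?thesis using True assms(2) by blast
    next
      case False
      then obtain x where "x \<in> Z" "x \<in> X" by blast
      then have "Y \<subseteq> Z" using s j by blast
      then show ?thesis using s j assms(3) by blast
    qed
    then show False using Z by blast
  qed
qed

lemma conn_indepD:
  assumes "conn K" "indep K" shows "\<exists>x. K = {x}"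
proof -
  obtain x where x: "x \<in> K" using conn_nonempty[OF assms(1)] by blast
  have "sep {x} (K - {x})" using assms(2) x unfolding indep_def sep_def by blast
  then have "{x} = K" using assms(1) x unfolding conn_def by blast
  then show ?thesis by blast
qed

lemma conn_clusteredD:
  assumes "conn K" "clustered K" shows "clique K"
proof -
  have "\<forall>y\<in>K. x = y \<or> E x y" if x: "x \<in> K" for x
  proof -
    let ?N = "{y \<in> K. x = y \<or> E x y}"
    have "sep ?N (K - ?N)"
      using assms(2) x unfolding sep_def clustered_def by blast
    moreover have "?N \<noteq> {}" "?N \<subseteq> K" using x by auto
    ultimately have "?N = K" using assms(1) unfolding conn_def by blast
    then show ?thesis by blast
  qed
  then show ?thesis unfolding clique_def by blast
qed

text \<open>Take \<open>p\<close> and \<open>q\<close> on the two sides of an edgeless cut. Every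
  vertex is nonadjacent to the one on the opposite side, and by transitivity to both, so all
  vertices are nonadjacent to each other.\<close>

lemma multipartite_conn:
  assumes "multipartite A" "\<not> indep A" shows "conn A"
  unfolding conn_def
proof (intro conjI allI impI)
  show "A \<noteq> {}" using assms(2) unfolding indep_def by blast
  fix X assume X: "X \<subseteq> A" "X \<noteq> {}" "X \<noteq> A"
  show "\<not> sep X (A - X)"
  proof
    assume s: "sep X (A - X)"
    obtain p q where pq: "p \<in> X" "q \<in> A - X" using X by blast
    have n: "\<not> E x y" if "x \<in> A" "y \<in> A" for x y
    proof -
      have xq: "\<not> E x q \<or> \<not> E x p" if "x \<in> A" for x
        using s pq that unfolding sep_def by (metis DiffI sym)
      have "\<not> E p q" using s pq unfolding sep_def by blast
      then have "\<not> E x p" if "x \<in> A" for x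
        using xq[OF that] assms(1) that pq X(1) sym unfolding multipartite_def
        by (metis Diff_iff in_mono)
      then show ?thesis
        using that assms(1) pq X(1) sym unfolding multipartite_def by (metis in_mono)
    qed
    then show False using assms(2) unfolding indep_def by blast
  qed
qed

section \<open>Components and their number\<close>

lemma comps_subset: "K \<in> comps S \<Longrightarrow> K \<subseteq> S"
  and comps_conn: "K \<in> comps S \<Longrightarrow> conn K"
  and comps_sep: "K \<in> comps S \<Longrightarrow> sep K (S - K)"
  and comps_nonempty: "K \<in> comps S \<Longrightarrow> K \<noteq> {}"
  unfolding comps_def using conn_nonempty by auto

lemma conn_subset_comp:
  assumes "conn K" "K \<subseteq> S" "L \<in> comps S" "K \<inter> L \<noteq> {}"
  shows "K \<subseteq> L"
  using conn_subset_closed[OF assms(1,2) comps_sep[OF assms(3)] assms(4)] .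

lemma comps_eq:
  assumes "K \<in> comps S" "L \<in> comps S" "K \<inter> L \<noteq> {}"
  shows "K = L"
proof
  show "K \<subseteq> L" using assms conn_subset_comp[OF comps_conn comps_subset] by blast
  show "L \<subseteq> K" using assms conn_subset_comp[OF comps_conn comps_subset, of L] by blast
qed

text \<open>The component is the reachability class of \<open>x\<close>. It has no edgeless cut,
  since membership in a side of such a cut is invariant along walks from \<open>x\<close>.\<close>

lemma comps_exists:
  assumes "x \<in> S"
  obtains K where "K \<in> comps S" "x \<in> K"
proof -
  let ?R = "{(u, v). u \<in> S \<and> v \<in> S \<and> E u v}"
  let ?K = "{y. (x, y) \<in> ?R\<^sup>*}"
  have sub: "?K \<subseteq> S"
  proof
    fix y assume "y \<in> ?K"
    then have "(x, y) \<in> ?R\<^sup>*" by simp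
    then show "y \<in> S" using assms by (induction rule: rtrancl_induct) auto
  qed
  have sep: "sep ?K (S - ?K)"
    using sub unfolding sep_def by (auto intro: rtrancl_into_rtrancl)
  have "conn ?K"
    unfolding conn_def
  proof (intro conjI allI impI)
    show "?K \<noteq> {}" by auto
    fix X assume X: "X \<subseteq> ?K" "X \<noteq> {}" "X \<noteq> ?K"
    show "\<not> sep X (?K - X)"
    proof
      assume s: "sep X (?K - X)"
      then have s': "sep (?K - X) X" using sep_commute by blast
      have "y \<in> X \<longleftrightarrow> x \<in> X" if "(x, y) \<in> ?R\<^sup>*" for y
        using that
      proof (induction rule: rtrancl_induct)
        case (step y z)
        then have "y \<in> ?K" "z \<in> ?K" "E y z"
          by (auto intro: rtrancl_into_rtrancl)
        then show ?case using step.IH s s' unfolding sep_def by blast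
      qed simp
      then show False using X by auto
    qed
  qed
  then have "?K \<in> comps S" using sub sep unfolding comps_def by blast
  then show ?thesis by (rule that) simp
qed

lemma Union_comps: "\<Union> (comps S) = S"
proof
  show "\<Union> (comps S) \<subseteq> S" using comps_subset by blast
  show "S \<subseteq> \<Union> (comps S)" by (blast elim: comps_exists)
qed

lemma finite_comps: "finite S \<Longrightarrow> finite (comps S)"
  by (rule finite_subset[of _ "Pow S"]) (auto dest: comps_subset)

lemma comps_empty [simp]: "comps {} = {}"
  unfolding comps_def using conn_nonempty by auto

lemma comps_conn_eq: "conn K \<Longrightarrow> comps K = {K}"
proof -
  assume c: "conn K"
  then have "K \<in> comps K" unfolding comps_def sep_def by auto
  moreover have "L = K" if "L \<in> comps K" for L
    using that calculation comps_eq comps_subset comps_nonempty by (metis Int_absorb2)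
  ultimately show ?thesis by blast
qed

lemma comps_Un:
  assumes "sep S T"
  shows "comps (S \<union> T) = comps S \<union> comps T"
proof -
  have s: "sep T S" using assms sep_commute by blast
  have "K \<in> comps S \<or> K \<in> comps T" if K: "K \<in> comps (S \<union> T)" for K
    using conn_subset_Un[OF comps_conn[OF K] comps_subset[OF K] assms]
  proof
    assume "K \<subseteq> S"
    moreover have "sep K (S - K)" using comps_sep[OF K] sep_mono by blast
    ultimately show ?thesis using comps_conn[OF K] unfolding comps_def by blast
  next
    assume "K \<subseteq> T"
    moreover have "sep K (T - K)" using comps_sep[OF K] sep_mono by blast
    ultimately show ?thesis using comps_conn[OF K] unfolding comps_def by blast
  qed
  moreover have "K \<in> comps (S \<union> T)" if K: "K \<in> comps S" for K
  proof -
    have "sep K (S \<union> T - K)"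
      using comps_sep[OF K] comps_subset[OF K] assms unfolding sep_def by blast
    then show ?thesis using comps_conn[OF K] comps_subset[OF K] unfolding comps_def by blast
  qed
  moreover have "K \<in> comps (S \<union> T)" if K: "K \<in> comps T" for K
  proof -
    have "sep K (S \<union> T - K)"
      using comps_sep[OF K] comps_subset[OF K] s unfolding sep_def by blast
    then show ?thesis using comps_conn[OF K] comps_subset[OF K] unfolding comps_def by blast
  qed
  ultimately show ?thesis by blast
qed

lemma comps_Un_disjoint:
  assumes "S \<inter> T = {}" shows "comps S \<inter> comps T = {}"
proof (rule ccontr)
  assume "\<not> ?thesis"
  then obtain K where K: "K \<in> comps S" "K \<in> comps T" by blast
  then show False using comps_nonempty[OF K(1)] comps_subset[OF K(1)] comps_subset[OF K(2)] assms by blast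
qed

definition ncomps :: "'a set \<Rightarrow> nat" where
  "ncomps S = card (comps S)"

lemma ncomps_Un:
  assumes "finite S" "finite T" "sep S T" "S \<inter> T = {}"
  shows "ncomps (S \<union> T) = ncomps S + ncomps T"
  unfolding ncomps_def comps_Un[OF assms(3)]
  using assms by (intro card_Un_disjoint finite_comps comps_Un_disjoint)

lemma ncomps_conn: "conn K \<Longrightarrow> ncomps K = 1"
  unfolding ncomps_def by (simp add: comps_conn_eq)

lemma ncomps_empty [simp]: "ncomps {} = 0"
  unfolding ncomps_def by simp

lemma comps_clique:
  assumes "clustered S" "K \<in> comps S" shows "clique K"
  using conn_clusteredD[OF comps_conn[OF assms(2)] clustered_mono[OF assms(1) comps_subset[OF assms(2)]]] .

lemma comps_closed:
  assumes "K \<in> comps S" "x \<in> K" "y \<in> S" "E x y" shows "y \<in> K"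
  using assms comps_sep unfolding sep_def by blast

text \<open>In general a deletion may create components. In a cluster, two components of
  \<open>T\<close> inside the same component of \<open>S\<close> would be adjacent, so distinct ones
  lie in distinct cliques. Both invariants owe their monotonicity to this.\<close>

lemma clustered_mono_ncomps:
  assumes "clustered S" "T \<subseteq> S" "finite S"
  shows "ncomps T \<le> ncomps S"
proof -
  have T: "clustered T" using assms clustered_mono by blast
  have ex: "\<exists>L\<in>comps S. K \<subseteq> L" if K: "K \<in> comps T" for K
  proof -
    obtain x where x: "x \<in> K" using comps_nonempty[OF K] by blast
    then have "x \<in> S" using K assms comps_subset by blast
    then obtain L where "L \<in> comps S" "x \<in> L" by (rule comps_exists)
    then show ?thesis using conn_subset_comp[OF comps_conn[OF K]] comps_subset[OF K] assms(2) x
      by blast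
  qed
  then obtain h where h: "\<And>K. K \<in> comps T \<Longrightarrow> h K \<in> comps S \<and> K \<subseteq> h K" by metis
  have "inj_on h (comps T)"
  proof (rule inj_onI)
    fix K L assume K: "K \<in> comps T" and L: "L \<in> comps T" and e: "h K = h L"
    obtain x y where xy: "x \<in> K" "y \<in> L" using K L comps_nonempty by blast
    have "x = y \<or> E x y"
      using h[OF K] h[OF L] e xy comps_clique[OF assms(1)] unfolding clique_def by blast
    then have "y \<in> K" using comps_closed[OF K] xy L comps_subset by blast
    then show "K = L" using comps_eq K L xy by blast
  qed
  then show ?thesis
    unfolding ncomps_def using h assms(3) finite_comps by (intro card_inj_on_le) auto
qed

text \<open>Components avoiding \<open>v\<close> stay components, and only one contains
  \<open>v\<close>.\<close>

lemma ncomps_remove_le: "finite S \<Longrightarrow> ncomps S \<le> ncomps (S - {v}) + 1"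
proof -
  assume f: "finite S"
  have "{K \<in> comps S. v \<notin> K} \<subseteq> comps (S - {v})"
    unfolding comps_def sep_def by blast
  then have "card {K \<in> comps S. v \<notin> K} \<le> ncomps (S - {v})"
    unfolding ncomps_def using f finite_comps by (intro card_mono) auto
  moreover have "card {K \<in> comps S. v \<in> K} \<le> 1"
    using f finite_comps[OF f] comps_eq[of _ S]
    by (auto simp: card_le_Suc0_iff_eq)
  moreover have "comps S = {K \<in> comps S. v \<notin> K} \<union> {K \<in> comps S. v \<in> K}" by blast
  ultimately show ?thesis
    unfolding ncomps_def by (smt (verit) add_mono card_Un_le order_trans)
qed

lemma clustered_ncomps_le_1:
  assumes "clustered S" "ncomps S \<le> 1" "finite S" shows "clique S"
  unfolding clique_def
proof (intro ballI impI)
  fix x y assume xy: "x \<in> S" "y \<in> S" "x \<noteq> y"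
  obtain K where K: "K \<in> comps S" "x \<in> K" using xy(1) by (rule comps_exists)
  obtain L where L: "L \<in> comps S" "y \<in> L" using xy(2) by (rule comps_exists)
  have "K = L"
    using assms(2) finite_comps[OF assms(3)] K(1) L(1)
    unfolding ncomps_def by (auto simp: card_le_Suc0_iff_eq)
  then show "E x y" using comps_clique[OF assms(1) K(1)] K L xy unfolding clique_def by blast
qed

lemma clique_ncomps_le_1:
  assumes "clique S" shows "ncomps S \<le> 1"
  using assms ncomps_conn conn_clique by (cases "S = {}") auto

section \<open>Monopolarity and polarity numbers\<close>

text \<open>Only the cluster side is recorded, so a partition is restricted to a subset by
  intersecting one set.\<close>

definition mono_part :: "'a set \<Rightarrow> 'a set \<Rightarrow> bool" where
  "mono_part S B \<longleftrightarrow> B \<subseteq> S \<and> indep (S - B) \<and> clustered B"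

definition polar_part :: "'a set \<Rightarrow> 'a set \<Rightarrow> bool" where
  "polar_part S B \<longleftrightarrow> B \<subseteq> S \<and> multipartite (S - B) \<and> clustered B"

text \<open>The infimum of the empty set is \<open>\<infinity>\<close>: \<open>mpol S = \<infinity>\<close> says that no partition exists.\<close>

definition mpol :: "'a set \<Rightarrow> enat" where
  "mpol S = (INF B \<in> Collect (mono_part S). enat (ncomps B))"

definition pol :: "'a set \<Rightarrow> enat" where
  "pol S = (INF B \<in> Collect (polar_part S). enat (ncomps B))"

lemma mpol_le_iff: "mpol S \<le> enat k \<longleftrightarrow> (\<exists>B. mono_part S B \<and> ncomps B \<le> k)"
  unfolding mpol_def INF_enat_le_iff by auto

lemma pol_le_iff: "pol S \<le> enat k \<longleftrightarrow> (\<exists>B. polar_part S B \<and> ncomps B \<le> k)"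
  unfolding pol_def INF_enat_le_iff by auto

lemma mpol_le: "mono_part S B \<Longrightarrow> mpol S \<le> enat (ncomps B)"
  using mpol_le_iff by blast

lemma pol_le: "polar_part S B \<Longrightarrow> pol S \<le> enat (ncomps B)"
  using pol_le_iff by blast

lemma mpol_attained:
  assumes "mpol S = enat n"
  obtains B where "mono_part S B" "ncomps B = n"
proof -
  obtain B where B: "mono_part S B" "ncomps B \<le> n" using assms mpol_le_iff[of S n] by auto
  moreover have "n \<le> ncomps B" using mpol_le[OF B(1)] assms by simp
  ultimately show ?thesis using that by simp
qed

lemma pol_attained:
  assumes "pol S = enat n"
  obtains B where "polar_part S B" "ncomps B = n"
proof -
  obtain B where B: "polar_part S B" "ncomps B \<le> n" using assms pol_le_iff[of S n] by auto
  moreover have "n \<le> ncomps B" using pol_le[OF B(1)] assms by simp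
  ultimately show ?thesis using that by simp
qed

section \<open>Restriction, monotonicity and additivity of the two invariants\<close>

lemma mono_part_restrict:
  assumes "mono_part S B" "T \<subseteq> S" shows "mono_part T (B \<inter> T)"
proof -
  have "indep (T - B \<inter> T)"
    using assms indep_mono[of "S - B" "T - B \<inter> T"] unfolding mono_part_def by blast
  moreover have "clustered (B \<inter> T)"
    using assms clustered_mono unfolding mono_part_def by blast
  ultimately show ?thesis unfolding mono_part_def by blast
qed

lemma polar_part_restrict:
  assumes "polar_part S B" "T \<subseteq> S" shows "polar_part T (B \<inter> T)"
proof -
  have "multipartite (T - B \<inter> T)"
    using assms multipartite_mono[of "S - B" "T - B \<inter> T"] unfolding polar_part_def by blast
  moreover have "clustered (B \<inter> T)"
    using assms clustered_mono unfolding polar_part_def by blast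
  ultimately show ?thesis unfolding polar_part_def by blast
qed

lemma mono_part_polar_part: "mono_part S B \<Longrightarrow> polar_part S B"
  unfolding mono_part_def polar_part_def using indep_imp_multipartite by blast

lemma mpol_mono:
  assumes "T \<subseteq> S" "finite S" shows "mpol T \<le> mpol S"
proof (rule enat_leI_finite)
  fix k assume "mpol S = enat k"
  then obtain B where B: "mono_part S B" "ncomps B = k" by (rule mpol_attained)
  have "ncomps (B \<inter> T) \<le> ncomps B"
    using B(1) assms(2) finite_subset unfolding mono_part_def
    by (intro clustered_mono_ncomps) auto
  then show "mpol T \<le> enat k"
    using mono_part_restrict[OF B(1) assms(1)] B(2) mpol_le_iff by blast
qed

lemma pol_mono:
  assumes "T \<subseteq> S" "finite S" shows "pol T \<le> pol S"
proof (rule enat_leI_finite)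
  fix k assume "pol S = enat k"
  then obtain B where B: "polar_part S B" "ncomps B = k" by (rule pol_attained)
  have "ncomps (B \<inter> T) \<le> ncomps B"
    using B(1) assms(2) finite_subset unfolding polar_part_def
    by (intro clustered_mono_ncomps) auto
  then show "pol T \<le> enat k"
    using polar_part_restrict[OF B(1) assms(1)] B(2) pol_le_iff by blast
qed

lemma pol_le_mpol: "pol S \<le> mpol S"
proof (rule enat_leI_finite)
  fix k assume "mpol S = enat k"
  then obtain B where "mono_part S B" "ncomps B = k" by (rule mpol_attained)
  then show "pol S \<le> enat k" using pol_le mono_part_polar_part by blast
qed

text \<open>Independence and clusteredness both pass to separated unions, and clique counts add.
  Multipartiteness does not pass to them, so \<open>pol\<close> has no such law.\<close>

lemma mpol_Un:
  assumes "finite S" "finite T" "sep S T" "S \<inter> T = {}"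
  shows "mpol (S \<union> T) = mpol S + mpol T"
proof (rule antisym)
  show "mpol (S \<union> T) \<le> mpol S + mpol T"
  proof (rule enat_leI_finite)
    fix k assume k: "mpol S + mpol T = enat k"
    then obtain m n where mn: "mpol S = enat m" "mpol T = enat n" "k = m + n"
      by (cases "mpol S"; cases "mpol T") auto
    obtain B where B: "mono_part S B" "ncomps B = m" using mn(1) by (rule mpol_attained)
    obtain C where C: "mono_part T C" "ncomps C = n" using mn(2) by (rule mpol_attained)
    have s: "sep B C" "sep (S - B) (T - C)"
      using assms(3) B C sep_mono unfolding mono_part_def by blast+
    have "S \<union> T - (B \<union> C) = (S - B) \<union> (T - C)"
      using B C assms(4) unfolding mono_part_def by blast
    then have "mono_part (S \<union> T) (B \<union> C)"
      using B C s unfolding mono_part_def by (auto intro: indep_Un clustered_Un)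
    moreover have "ncomps (B \<union> C) = m + n"
      using ncomps_Un[of B C] B C s assms finite_subset unfolding mono_part_def by blast
    ultimately show "mpol (S \<union> T) \<le> enat k" using mpol_le mn(3) by metis
  qed
  show "mpol S + mpol T \<le> mpol (S \<union> T)"
  proof (rule enat_leI_finite)
    fix k assume "mpol (S \<union> T) = enat k"
    then obtain B where B: "mono_part (S \<union> T) B" "ncomps B = k" by (rule mpol_attained)
    have "B = (B \<inter> S) \<union> (B \<inter> T)" using B(1) unfolding mono_part_def by blast
    moreover have "ncomps ((B \<inter> S) \<union> (B \<inter> T)) = ncomps (B \<inter> S) + ncomps (B \<inter> T)"
      using assms sep_mono[OF assms(3)] by (intro ncomps_Un) auto
    ultimately have "enat k = enat (ncomps (B \<inter> S)) + enat (ncomps (B \<inter> T))"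
      using B(2) by simp
    then show "mpol S + mpol T \<le> enat k"
      using add_mono[OF mpol_le[OF mono_part_restrict[OF B(1), of S]] mpol_le[OF mono_part_restrict[OF B(1), of T]]]
      by simp
  qed
qed

lemma comps_remove_comp:
  assumes "K \<in> comps S" shows "comps S = insert K (comps (S - K))" "K \<notin> comps (S - K)"
proof -
  have "S = K \<union> (S - K)" using comps_subset[OF assms] by blast
  then show "comps S = insert K (comps (S - K))"
    using comps_Un[OF comps_sep[OF assms]] comps_conn_eq[OF comps_conn[OF assms]] by simp
  show "K \<notin> comps (S - K)" using comps_subset[of K "S - K"] comps_nonempty[OF assms] by blast
qed

lemma mpol_remove_comp:
  assumes "K \<in> comps S" "finite S" shows "mpol S = mpol K + mpol (S - K)"
proof -
  have "K \<union> (S - K) = S" using comps_subset[OF assms(1)] by blast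
  then show ?thesis
    using mpol_Un[of K "S - K"] comps_sep[OF assms(1)] assms(2) comps_subset[OF assms(1)]
    by (metis Diff_disjoint finite_Diff finite_subset)
qed

lemma mpol_sum_comps: "finite S \<Longrightarrow> mpol S = (\<Sum>K\<in>comps S. mpol K)"
proof (induction "card S" arbitrary: S rule: less_induct)
  case less
  show ?case
  proof (cases "S = {}")
    case True
    have "mono_part {} {}" unfolding mono_part_def indep_def clustered_def by simp
    then have "mpol {} \<le> enat 0" using mpol_le by fastforce
    then show ?thesis using True by (simp add: zero_enat_def[symmetric])
  next
    case False
    then obtain K where K: "K \<in> comps S" using comps_exists by blast
    have "card (S - K) < card S"
      using less.prems comps_nonempty[OF K] comps_subset[OF K] by (intro psubset_card_mono) auto
    then have "mpol (S - K) = (\<Sum>L\<in>comps (S - K). mpol L)" using less by blast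
    then show ?thesis
      using mpol_remove_comp[OF K less.prems] comps_remove_comp[OF K]
        finite_comps[of "S - K"] less.prems by simp
  qed
qed

lemma ncomps_eq_0: "finite S \<Longrightarrow> ncomps S = 0 \<longleftrightarrow> S = {}"
  unfolding ncomps_def using finite_comps[of S] Union_comps[of S] by auto

lemma mpol_eq_0_iff: "finite S \<Longrightarrow> mpol S = 0 \<longleftrightarrow> indep S"
proof
  assume f: "finite S" and "mpol S = 0"
  then have "mpol S = enat 0" by (simp add: zero_enat_def)
  then obtain B where B: "mono_part S B" "ncomps B = 0" by (rule mpol_attained)
  then have "B = {}" using ncomps_eq_0 f finite_subset unfolding mono_part_def by blast
  then show "indep S" using B unfolding mono_part_def by simp
next
  assume "indep S"
  then have "mono_part S {}" unfolding mono_part_def clustered_def by simp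
  then show "mpol S = 0" using mpol_le[of S "{}"] by (simp add: zero_enat_def[symmetric])
qed

lemma mpol_empty [simp]: "mpol {} = 0"
  using mpol_eq_0_iff[of "{}"] unfolding indep_def by simp

lemma mpol_le_ncomps: "clustered S \<Longrightarrow> mpol S \<le> enat (ncomps S)"
  by (rule mpol_le) (simp add: mono_part_def indep_def)

lemma pol_multipartite: "multipartite S \<Longrightarrow> pol S = 0"
proof -
  assume "multipartite S"
  then have "polar_part S {}" unfolding polar_part_def clustered_def by simp
  then show "pol S = 0" using pol_le[of S "{}"] by (simp add: zero_enat_def[symmetric])
qed

text \<open>Value at most 1 means that \<open>S\<close> is a split graph, the clique being allowed
  to be empty.\<close>

lemma mpol_le_1_iff:
  "finite S \<Longrightarrow> mpol S \<le> 1 \<longleftrightarrow> (\<exists>B\<subseteq>S. clique B \<and> indep (S - B))"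
proof
  assume f: "finite S" and "mpol S \<le> 1"
  then obtain B where B: "mono_part S B" "ncomps B \<le> 1"
    using mpol_le_iff[of S 1] by (auto simp: one_enat_def)
  then have "clique B"
    using clustered_ncomps_le_1 f finite_subset unfolding mono_part_def by blast
  then show "\<exists>B\<subseteq>S. clique B \<and> indep (S - B)" using B unfolding mono_part_def by blast
next
  assume "\<exists>B\<subseteq>S. clique B \<and> indep (S - B)"
  then obtain B where "B \<subseteq> S" "clique B" "indep (S - B)" by blast
  then have "mono_part S B" "ncomps B \<le> 1"
    unfolding mono_part_def using clique_imp_clustered clique_ncomps_le_1 by auto
  then show "mpol S \<le> 1" using mpol_le_iff[of S 1] by (auto simp: one_enat_def)
qed

text \<open>A single vertex is independent and has value 0, which is why isolated vertices have to
  be excluded when cliques are counted.\<close>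

lemma clique_mpol:
  assumes "clique S" "finite S" "card S \<noteq> 1" "S \<noteq> {}" shows "mpol S = 1"
proof -
  have "mpol S \<le> 1"
    using assms mpol_le_1_iff by (metis Diff_cancel subset_refl empty_iff indep_def)
  moreover have "\<not> indep S"
    using conn_indepD[OF conn_clique[OF assms(1,4)]] assms(3) by auto
  ultimately show ?thesis using mpol_eq_0_iff[OF assms(2)]
    by (metis antisym ileI1 not_le one_eSuc zero_le not_gr_zero)
qed

definition no_isolated :: "'a set \<Rightarrow> bool" where
  "no_isolated S \<longleftrightarrow> (\<forall>K\<in>comps S. card K \<noteq> 1)"

lemma mpol_clustered:
  assumes "clustered S" "no_isolated S" "finite S"
  shows "mpol S = enat (ncomps S)"
proof -
  have "mpol K = 1" if K: "K \<in> comps S" for K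
    using clique_mpol[OF comps_clique[OF assms(1) K]] assms comps_subset[OF K] finite_subset K
      comps_nonempty[OF K] unfolding no_isolated_def by blast
  then have "mpol S = (\<Sum>K\<in>comps S. 1)" using mpol_sum_comps[OF assms(3)] by simp
  then show ?thesis unfolding ncomps_def by (simp add: of_nat_eq_enat)
qed

text \<open>All of \<open>T\<close> is put on the cluster side. Equality may fail: two nonadjacent
  vertices form a multipartite set, so their \<open>pol\<close> is 0.\<close>

lemma pol_Un_clustered:
  assumes "finite S" "finite T" "sep S T" "S \<inter> T = {}" "clustered T"
  shows "pol (S \<union> T) \<le> pol S + enat (ncomps T)"
proof (rule enat_leI_finite)
  fix k assume k: "pol S + enat (ncomps T) = enat k"
  then obtain m where m: "pol S = enat m" "k = m + ncomps T" by (cases "pol S") auto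
  obtain B where B: "polar_part S B" "ncomps B = m" using m(1) by (rule pol_attained)
  have s: "sep B T" using assms(3) B sep_mono unfolding polar_part_def by blast
  have "S \<union> T - (B \<union> T) = S - B" using B assms(4) unfolding polar_part_def by blast
  then have "polar_part (S \<union> T) (B \<union> T)"
    using B s assms(5) unfolding polar_part_def by (auto intro: clustered_Un)
  moreover have "ncomps (B \<union> T) = k"
    using ncomps_Un[of B T] B s m assms finite_subset unfolding polar_part_def by blast
  ultimately show "pol (S \<union> T) \<le> enat k" using pol_le by metis
qed

text \<open>A multipartite side with an edge is connected and lies within \<open>S\<close> or within
  \<open>T\<close>; the other set would then be contained in the cluster.\<close>

lemma pol_Un_nonclustered:
  assumes "sep S T" "\<not> clustered S" "\<not> clustered T"
  shows "pol (S \<union> T) = mpol (S \<union> T)"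
proof (rule antisym[OF pol_le_mpol enat_leI_finite])
  fix k assume "pol (S \<union> T) = enat k"
  then obtain B where B: "polar_part (S \<union> T) B" "ncomps B = k" by (rule pol_attained)
  let ?A = "S \<union> T - B"
  have "indep ?A"
  proof (rule ccontr)
    assume "\<not> indep ?A"
    then have "conn ?A" using multipartite_conn B unfolding polar_part_def by blast
    then have "?A \<subseteq> S \<or> ?A \<subseteq> T" using conn_subset_Un assms(1) by blast
    \<comment> \<open>A vertex common to two separated sets has no neighbour in either, so a
      connected side with an edge avoids it.\<close>
    moreover have "S \<inter> T \<inter> ?A = {}"
    proof (rule ccontr)
      assume "S \<inter> T \<inter> ?A \<noteq> {}"
      then obtain x where x: "x \<in> S" "x \<in> T" "x \<in> ?A" by blast
      then have "sep {x} (?A - {x})"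
        using assms(1) sym unfolding sep_def by blast
      then have "?A = {x}" using \<open>conn ?A\<close> x unfolding conn_def by blast
      then show False using \<open>\<not> indep ?A\<close> irrefl unfolding indep_def by simp
    qed
    ultimately have "T \<subseteq> B \<or> S \<subseteq> B" by blast
    then show False using B assms clustered_mono unfolding polar_part_def by blast
  qed
  then have "mono_part (S \<union> T) B" using B unfolding mono_part_def polar_part_def by blast
  then show "mpol (S \<union> T) \<le> enat k" using B mpol_le by blast
qed

section \<open>Connected cographs as joins\<close>

text \<open>The vertex \<open>v\<close> has a neighbour in every component of the rest. If it misses
  a vertex of some component \<open>K\<close>, then \<open>K\<close> has an edge \<open>x w\<close>
  with \<open>v\<close> adjacent to \<open>x\<close> only; with a neighbour \<open>z\<close> of
  \<open>v\<close> in another component, \<open>w x v z\<close> is an induced P4.\<close>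

lemma cut_vertex_joined:
  assumes "conn C" "p4_free C" "v \<in> C" "\<not> conn (C - {v})"
  shows "joined {v} (C - {v})"
proof -
  let ?D = "C - {v}"
  have nbr: "\<exists>z\<in>L. E v z" if L: "L \<in> comps ?D" for L
  proof (rule ccontr)
    assume "\<not> ?thesis"
    then have "sep L (C - L)"
      using comps_sep[OF L] sym unfolding sep_def by blast
    moreover have "L \<subseteq> C" "L \<noteq> C" using comps_subset[OF L] assms(3) by auto
    ultimately show False
      using connD[OF assms(1)] comps_nonempty[OF L] by blast
  qed
  have "E v y" if y: "y \<in> ?D" for y
  proof (rule ccontr)
    assume ny: "\<not> E v y"
    obtain K where K: "K \<in> comps ?D" "y \<in> K" using y by (rule comps_exists)
    let ?X = "{x \<in> K. E v x}"
    have "?X \<noteq> {}" "?X \<noteq> K" using nbr[OF K(1)] K(2) ny by auto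
    then have "\<not> sep ?X (K - ?X)" by (intro connD[OF comps_conn[OF K(1)]]) auto
    then obtain x w where xw: "x \<in> K" "E v x" "w \<in> K" "\<not> E v w" "E x w"
      unfolding sep_def by blast
    have "K \<noteq> ?D" using comps_conn[OF K(1)] assms(4) by auto
    then obtain u where u: "u \<in> ?D" "u \<notin> K" using comps_subset[OF K(1)] by blast
    obtain L where L: "L \<in> comps ?D" "u \<in> L" using u(1) by (rule comps_exists)
    obtain z where z: "z \<in> L" "E v z" using nbr[OF L(1)] by blast
    have "z \<notin> K" using comps_eq[OF K(1) L(1)] z u L by blast
    then have nz: "\<not> E x z" "\<not> E w z"
      using comps_sep[OF K(1)] xw z comps_subset[OF L(1)] unfolding sep_def by blast+
    have "w \<in> C" "x \<in> C" "z \<in> C" using xw z comps_subset[OF K(1)] comps_subset[OF L(1)] by auto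
    then show False
      using assms(2,3) xw z nz sym[OF xw(2)] sym[OF xw(5)] sym[of w v]
      unfolding p4_free_def by blast
  qed
  then show ?thesis unfolding joined_def by blast
qed

lemma complement_sgraph: "sgraph (\<lambda>x y. x \<noteq> y \<and> \<not> E x y)"
  by unfold_locales (auto dest: sym)

text \<open>
  Seinsche's theorem. Removing a vertex leaves a graph that is disconnected or whose complement is;
  the cut vertex lemma applies to the graph or to its complement, \<open>P\<^sub>4\<close> being self-complementary.
\<close>

lemma p4_free_conn_or_complement:
  assumes "finite C" "card C \<ge> 2" "p4_free C" "conn C"
  shows "\<not> sgraph.conn (\<lambda>x y. x \<noteq> y \<and> \<not> E x y) C"
  using assms
proof (induction "card C" arbitrary: C rule: less_induct)
  case less
  interpret co: sgraph "\<lambda>x y. x \<noteq> y \<and> \<not> E x y" by (rule complement_sgraph)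
  have co_p4: "co.p4_free C"
    unfolding co.p4_free_def
  proof (intro ballI impI, rule ccontr)
    fix a b c d assume v: "a \<in> C" "b \<in> C" "c \<in> C" "d \<in> C"
      and e: "a \<noteq> b \<and> \<not> E a b" "b \<noteq> c \<and> \<not> E b c" "c \<noteq> d \<and> \<not> E c d"
        "\<not> ((a \<noteq> c \<and> \<not> E a c) \<or> (b \<noteq> d \<and> \<not> E b d) \<or> (a \<noteq> d \<and> \<not> E a d))"
    have "a \<noteq> c" "b \<noteq> d" "a \<noteq> d" using e sym by auto
    \<comment> \<open>The complement of the path \<open>a b c d\<close> is the path
      \<open>b d a c\<close>.\<close>
    then have "E b d" "E d a" "E a c" "\<not> E b a" "\<not> E d c" "\<not> E b c" using e sym by blast+
    then show False using less.prems(3) v unfolding p4_free_def by blast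
  qed
  obtain v where v: "v \<in> C" using less.prems(4) conn_nonempty by blast
  have ne: "C - {v} \<noteq> {}"
  proof
    assume "C - {v} = {}"
    then have "C = {v}" using v by blast
    then show False using less.prems(2) by simp
  qed
  have from_cut: "\<not> co.conn C" if "\<not> conn (C - {v})"
  proof -
    have "joined {v} (C - {v})" using cut_vertex_joined less.prems(3,4) v that by blast
    then have "co.sep {v} (C - {v})" unfolding joined_def co.sep_def by blast
    then show ?thesis using co.connD[of C "{v}"] v ne by blast
  qed
  have from_cocut: "\<not> co.conn C" if "\<not> co.conn (C - {v})"
  proof
    assume "co.conn C"
    then have "co.joined {v} (C - {v})" using co.cut_vertex_joined co_p4 v that by blast
    then have "sep {v} (C - {v})" unfolding co.joined_def sep_def by blast
    then show False using connD[OF less.prems(4), of "{v}"] v ne by blast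
  qed
  show ?case
  proof (cases "card (C - {v}) \<ge> 2")
    case True
    have "card (C - {v}) < card C" using less.prems(1) v by (rule card_Diff1_less)
    then show ?thesis
      using less.hyps[of "C - {v}"] True less.prems(1,3) p4_free_mono from_cut from_cocut
      by blast
  next
    case False
    then have "card (C - {v}) = 1" using ne less.prems(1) by (metis One_nat_def card_0_eq finite_Diff less_2_cases_iff not_le)
    then obtain y where y: "C - {v} = {y}" by (meson card_1_singletonE)
    then have "\<not> sep {v} {y}" using connD[OF less.prems(4), of "{v}"] v by auto
    then have "co.sep {v} (C - {v})" using y unfolding sep_def co.sep_def by simp
    then show ?thesis using co.connD[of C "{v}"] v ne by blast
  qed
qed

lemma p4_free_conn_join:
  assumes "finite C" "card C \<ge> 2" "p4_free C" "conn C"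
  obtains X Y where "C = X \<union> Y" "joined X Y" "X \<noteq> {}" "Y \<noteq> {}"
proof -
  interpret co: sgraph "\<lambda>x y. x \<noteq> y \<and> \<not> E x y" by (rule complement_sgraph)
  have "\<not> co.conn C" using p4_free_conn_or_complement[OF assms] .
  then obtain X where X: "X \<subseteq> C" "X \<noteq> {}" "X \<noteq> C" "co.sep X (C - X)"
    using conn_nonempty[OF assms(4)] unfolding co.conn_def by auto
  have "joined X (C - X)" using X(4) unfolding co.sep_def joined_def by (metis DiffD2)
  then show ?thesis using that[of X "C - X"] X by blast
qed

text \<open>The independent side cannot meet both \<open>X\<close> and \<open>Y\<close>, so the
  cluster contains one of them. If it also meets the other, it is connected, and a connected cluster
  is a clique.\<close>

lemma mono_part_join:
  assumes "joined X Y" "X \<noteq> {}" "Y \<noteq> {}" "mono_part (X \<union> Y) B"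
  shows "(B = Y \<and> indep X) \<or> (B = X \<and> indep Y) \<or> clique B"
proof -
  let ?A = "X \<union> Y - B"
  have B: "B \<subseteq> X \<union> Y" "indep ?A" "clustered B" using assms(4) unfolding mono_part_def by auto
  have dj: "X \<inter> Y = {}" using assms(1) irrefl unfolding joined_def by blast
  have key: "(B = Q \<and> indep P) \<or> clique B"
    if j: "joined P Q" "P \<noteq> {}" "Q \<noteq> {}" "P \<inter> Q = {}" "B \<subseteq> P \<union> Q" "indep (P \<union> Q - B)" "Q \<subseteq> B" for P Q
  proof (cases "B \<inter> P = {}")
    case True
    then have "B = Q" "P \<union> Q - B = P" using j by blast+
    then show ?thesis using j by simp
  next
    case False
    have "joined (B \<inter> P) Q" using j(1) unfolding joined_def by blast
    then have "conn ((B \<inter> P) \<union> Q)" using conn_joined False j(3) by blast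
    moreover have "(B \<inter> P) \<union> Q = B" using j by blast
    ultimately show ?thesis using conn_clusteredD B(3) by simp
  qed
  have "?A \<inter> X = {} \<or> ?A \<inter> Y = {}"
    using assms(1) B(2) unfolding joined_def indep_def by blast
  then have "X \<subseteq> B \<or> Y \<subseteq> B" by blast
  then show ?thesis
  proof
    assume "X \<subseteq> B"
    then show ?thesis
      using key[of Y X] assms(1-3) dj B joined_commute by (metis Int_commute Un_commute)
  next
    assume "Y \<subseteq> B"
    then show ?thesis using key[of X Y] assms(1-3) dj B by blast
  qed
qed

text \<open>An optimal cluster with at least two cliques is not itself a clique, so in any join
  decomposition it must be one of the two sides.\<close>

lemma conn_mpol_ge_2_join:
  assumes "finite C" "p4_free C" "conn C" "mpol C = enat n" "n \<ge> 2"
  obtains X Y where "C = X \<union> Y" "joined X Y" "X \<noteq> {}" "Y \<noteq> {}"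
    "indep X" "clustered Y" "ncomps Y = n"
proof -
  have "card C \<ge> 2"
  proof (rule ccontr)
    assume "\<not> card C \<ge> 2"
    moreover have "card C \<noteq> 0" using assms(1) conn_nonempty[OF assms(3)] by simp
    ultimately have "card C = 1" by linarith
    then obtain x where "C = {x}" by (meson card_1_singletonE)
    then have "mpol C = 0" using mpol_eq_0_iff assms(1) irrefl unfolding indep_def by simp
    then show False using assms(4,5) by (simp add: zero_enat_def)
  qed
  then obtain X Y where XY: "C = X \<union> Y" "joined X Y" "X \<noteq> {}" "Y \<noteq> {}"
    using p4_free_conn_join assms(1-3) by blast
  obtain B where B: "mono_part C B" "ncomps B = n" using assms(4) by (rule mpol_attained)
  have "\<not> clique B" using clique_ncomps_le_1[of B] B(2) assms(5) by linarith
  then have "(B = Y \<and> indep X) \<or> (B = X \<and> indep Y)"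
    using mono_part_join[OF XY(2-4)] B(1) XY(1) by blast
  then show ?thesis
  proof
    assume "B = Y \<and> indep X"
    then show ?thesis using that[of X Y] XY B unfolding mono_part_def by blast
  next
    assume "B = X \<and> indep Y"
    moreover have "joined Y X" using XY(2) joined_commute by blast
    ultimately show ?thesis using that[of Y X] XY B unfolding mono_part_def by blast
  qed
qed

text \<open>The vertices of the moved clique \<open>K\<close> become singleton parts beside the part
  \<open>X\<close>, as each of them is adjacent to all of \<open>X\<close> and to each
  other.\<close>

lemma conn_pol_less_mpol:
  assumes "finite C" "p4_free C" "conn C" "mpol C = enat n" "n \<ge> 2"
  shows "pol C \<le> enat (n - 1)"
proof -
  obtain X Y where XY: "C = X \<union> Y" "joined X Y" "X \<noteq> {}" "Y \<noteq> {}"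
    "indep X" "clustered Y" "ncomps Y = n"
    using assms by (rule conn_mpol_ge_2_join)
  have dj: "X \<inter> Y = {}" using XY(2) irrefl unfolding joined_def by blast
  obtain K where K: "K \<in> comps Y" using XY(4) comps_exists by blast
  have "C - (Y - K) = X \<union> K" using XY(1) dj comps_subset[OF K] by blast
  moreover have "multipartite (X \<union> K)"
  proof -
    have "clique K" using comps_clique[OF XY(6) K] .
    moreover have "joined X K" using XY(2) comps_subset[OF K] unfolding joined_def by blast
    ultimately show ?thesis
      using XY(5) sym irrefl unfolding multipartite_def clique_def joined_def indep_def by (metis UnE)
  qed
  moreover have "clustered (Y - K)" using XY(6) clustered_mono by blast
  ultimately have "polar_part C (Y - K)" unfolding polar_part_def XY(1) by auto
  moreover have "ncomps (Y - K) = n - 1"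
    using comps_remove_comp[OF K] XY(7) finite_comps[of "Y - K"] assms(1) XY(1)
    unfolding ncomps_def by simp
  ultimately show ?thesis using pol_le by metis
qed

text \<open>Every clique of \<open>S\<close> meets \<open>T\<close>, by domination, and its trace is
  a component of \<open>T\<close>. This bounds clique counts from below after deletions.\<close>

lemma ncomps_dominating:
  assumes "clustered S" "T \<subseteq> S" "finite S" "\<And>x. x \<in> S - T \<Longrightarrow> \<exists>y\<in>T. E x y"
  shows "ncomps S \<le> ncomps T"
proof -
  have meet: "K \<inter> T \<noteq> {}" if K: "K \<in> comps S" for K
  proof -
    obtain x where x: "x \<in> K" using comps_nonempty[OF K] by blast
    show ?thesis
    proof (cases "x \<in> T")
      case False
      then obtain y where "y \<in> T" "E x y" using assms(4) x comps_subset[OF K] by blast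
      then show ?thesis using comps_closed[OF K x] assms(2) by blast
    qed (use x in blast)
  qed
  have "(\<lambda>K. K \<inter> T) ` comps S \<subseteq> comps T"
  proof
    fix L assume "L \<in> (\<lambda>K. K \<inter> T) ` comps S"
    then obtain K where K: "K \<in> comps S" "L = K \<inter> T" by blast
    have "clique L" using comps_clique[OF assms(1) K(1)] K(2) clique_mono by blast
    then have "conn L" using meet[OF K(1)] K(2) conn_clique by blast
    moreover have "sep L (T - L)" using comps_sep[OF K(1)] K(2) assms(2)
      unfolding sep_def by blast
    ultimately show "L \<in> comps T" using K(2) unfolding comps_def by blast
  qed
  moreover have "inj_on (\<lambda>K. K \<inter> T) (comps S)"
  proof (rule inj_onI)
    fix K L assume K: "K \<in> comps S" and L: "L \<in> comps S" and e: "K \<inter> T = L \<inter> T"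
    then have "K \<inter> L \<noteq> {}" using meet[OF K] by blast
    then show "K = L" using comps_eq[OF K L] by blast
  qed
  moreover have "finite (comps T)" using assms(2,3) finite_comps finite_subset by blast
  ultimately show ?thesis
    unfolding ncomps_def by (meson card_inj_on_le)
qed

lemma mpol_remove_vertex_of_comp:
  assumes "K \<in> comps S" "v \<in> K" "finite S"
  shows "mpol (S - {v}) = mpol (K - {v}) + mpol (S - K)"
proof -
  have "S - {v} = (K - {v}) \<union> (S - K)" using comps_subset[OF assms(1)] assms(2) by blast
  moreover have "sep (K - {v}) (S - K)" by (rule sep_mono[OF comps_sep[OF assms(1)]]) auto
  moreover have "finite K" using comps_subset[OF assms(1)] assms(3) finite_subset by blast
  ultimately show ?thesis using mpol_Un[of "K - {v}" "S - K"] assms(3) by auto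
qed

lemma join_indep_clique:
  assumes "joined X Y" "\<not> clique Y" "indep (X \<union> Y - B)" "clique B"
  shows "X \<subseteq> B"
proof (rule ccontr)
  assume "\<not> X \<subseteq> B"
  then have "Y \<subseteq> B" using assms(1,3) unfolding joined_def indep_def by blast
  then show False using assms(2,4) clique_mono by blast
qed

lemma join_not_clustered:
  assumes "joined X Y" "X \<noteq> {}" "\<not> clique Y" shows "\<not> clustered (X \<union> Y)"
proof
  assume c: "clustered (X \<union> Y)"
  have "Y \<noteq> {}" using assms(3) unfolding clique_def by blast
  then have "conn (X \<union> Y)" using conn_joined assms by blast
  then show False using conn_clusteredD c clique_mono assms(3) by blast
qed

lemma clustered_dominated_clique:
  assumes "clustered Y" "v \<in> Y" "\<And>y. y \<in> Y - {v} \<Longrightarrow> E y v"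
  shows "clique (Y - {v})"
  using assms sym unfolding clustered_def clique_def by (meson DiffD1)

lemma not_clusteredE:
  assumes "\<not> clustered C"
  obtains x y z where "x \<in> C" "y \<in> C" "z \<in> C" "E x y" "E y z" "x \<noteq> z" "\<not> E x z"
  using assms unfolding clustered_def by blast

lemma remove_keeps_nonclustered:
  assumes "finite C" "\<not> clustered C" "card C \<noteq> 3"
  obtains v where "v \<in> C" "\<not> clustered (C - {v})"
proof -
  obtain x y z where xyz: "x \<in> C" "y \<in> C" "z \<in> C" "E x y" "E y z" "x \<noteq> z" "\<not> E x z"
    using assms(2) by (rule not_clusteredE)
  have "x \<noteq> y" "y \<noteq> z" using xyz(4,5) irrefl by auto
  then have "card {x, y, z} = 3" using xyz(6) by simp
  then have "{x, y, z} \<noteq> C" using assms(3) by blast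
  then obtain v where v: "v \<in> C" "v \<notin> {x, y, z}" using xyz by blast
  then have "\<not> clustered (C - {v})" using xyz unfolding clustered_def by blast
  then show ?thesis using that v by blast
qed

lemma not_clustered_mpol_ge_1: "finite C \<Longrightarrow> \<not> clustered C \<Longrightarrow> 1 \<le> mpol C"
proof -
  assume "finite C" "\<not> clustered C"
  then have "\<not> indep C" unfolding clustered_def indep_def by blast
  then have "mpol C \<noteq> 0" using mpol_eq_0_iff \<open>finite C\<close> by blast
  then show ?thesis by (simp add: one_eSuc ileI1)
qed

text \<open>Supplies the bound \<open>mpol V \<le> k + 1\<close> for a minimal obstruction. The
  remainder has to keep an induced P3 so that \<open>pol\<close> and \<open>mpol\<close> still
  agree; on three vertices \<open>C\<close> would be a P3 and no deletion could do this.\<close>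

lemma mpol_remove_nearly_critical:
  assumes "finite C" "p4_free C" "conn C" "\<not> clustered C" "card C \<noteq> 3" "mpol C = enat n"
  obtains v where "v \<in> C" "\<not> clustered (C - {v})" "mpol C \<le> mpol (C - {v}) + 1"
proof (cases "n \<le> 2")
  \<comment> \<open>For values up to 2 any deletion that keeps an induced P3 will do, since the
    remainder still has value at least 1.\<close>
  case True
  obtain v where v: "v \<in> C" "\<not> clustered (C - {v})"
    using remove_keeps_nonclustered assms(1,4,5) by blast
  have "1 \<le> mpol (C - {v})" using not_clustered_mpol_ge_1 v(2) assms(1) by blast
  then have "1 + 1 \<le> mpol (C - {v}) + 1" by (intro add_mono) auto
  moreover have "mpol C \<le> 1 + 1" using assms(6) True by (simp add: one_enat_def)
  ultimately show ?thesis using that v order_trans by blast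
next
  case False
  then obtain X Y where XY: "C = X \<union> Y" "joined X Y" "X \<noteq> {}" "Y \<noteq> {}"
    "indep X" "clustered Y" "ncomps Y = n"
    using conn_mpol_ge_2_join[OF assms(1-3,6)] by (metis nle_le)
  have dj: "X \<inter> Y = {}" using XY(2) irrefl unfolding joined_def by blast
  have fin: "finite X" "finite Y" using assms(1) XY(1) by auto
  \<comment> \<open>An isolated vertex of \<open>Y\<close> if there is one, otherwise any vertex of
    \<open>Y\<close>. An isolated vertex can be added back to the independent side; without isolated
    vertices a cheap partition of the remainder would leave \<open>Y\<close> too few
    cliques.\<close>
  obtain v where v: "v \<in> Y" "(\<forall>y\<in>Y. \<not> E v y) \<or> (\<forall>y\<in>Y. \<exists>z\<in>Y. E y z)"
    using XY(4) by (metis ex_in_conv)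
  let ?Y = "Y - {v}"
  have Cv: "C - {v} = X \<union> ?Y" using XY(1) dj v by blast
  have nY: "n \<le> ncomps ?Y + 1" using ncomps_remove_le[OF fin(2)] XY(7) by blast
  have ncl: "\<not> clique ?Y" using clique_ncomps_le_1[of ?Y] nY False by linarith
  then have ne: "?Y \<noteq> {}" unfolding clique_def by blast
  have j: "joined X ?Y" using XY(2) unfolding joined_def by blast
  have "mpol C \<le> mpol (C - {v}) + 1"
  proof (rule enat_leI_finite)
    fix k assume "mpol (C - {v}) + 1 = enat k"
    then obtain m where m: "mpol (C - {v}) = enat m" "k = m + 1"
      by (cases "mpol (C - {v})") (auto simp: one_enat_def)
    obtain B where B: "mono_part (C - {v}) B" "ncomps B = m" using m(1) by (rule mpol_attained)
    have split: False if A: "indep (C - D)" "clique D" "D \<subseteq> C" for D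
    proof -
      have "mpol C \<le> 1" using A mpol_le_1_iff[OF assms(1)] by blast
      then show False using assms(6) False by (simp add: one_enat_def)
    qed
    from mono_part_join[OF j XY(3) ne] B(1) Cv
    consider "B = ?Y" | "B = X" "indep ?Y" | "clique B" by metis
    then have "n \<le> k"
    proof cases
      case 1
      then show ?thesis using nY B(2) m(2) by simp
    next
      case 2
      from v(2) show ?thesis
      proof
        assume "\<forall>y\<in>Y. \<not> E v y"
        then have "indep Y" using 2(2) sym unfolding indep_def by blast
        moreover have "C - X = Y" using XY(1) dj by blast
        ultimately have "mono_part C X"
          using XY(1) B(1) 2(1) unfolding mono_part_def by auto
        then have "n \<le> m" using mpol_le[of C X] 2(1) B(2) assms(6) by simp
        then show ?thesis using m(2) by simp
      next
        assume "\<forall>y\<in>Y. \<exists>z\<in>Y. E y z"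
        then have "E y v" if "y \<in> ?Y" for y
          using that 2(2) unfolding indep_def by (metis DiffD1 DiffI singletonD)
        then show ?thesis using clustered_dominated_clique[OF XY(6) v(1)] ncl by blast
      qed
    next
      case 3
      have iA: "indep (X \<union> ?Y - B)" "B \<subseteq> X \<union> ?Y" using B(1) Cv unfolding mono_part_def by auto
      have XB: "X \<subseteq> B" using join_indep_clique[OF j ncl iA(1) 3] .
      from v(2) show ?thesis
      proof
        assume iso: "\<forall>y\<in>Y. \<not> E v y"
        have "C - B = insert v (?Y - B)" using XY(1) XB iA(2) v(1) dj by blast
        moreover have "indep (insert v (?Y - B))"
          using iA(1) iso sym irrefl unfolding indep_def by blast
        ultimately show ?thesis using split[of B] 3 iA(2) XY(1) by auto
      next
        assume nbr: "\<forall>y\<in>Y. \<exists>z\<in>Y. E y z"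
        \<comment> \<open>The vertices outside \<open>B\<close> are independent, so each remaining
          vertex of \<open>Y\<close> finds its neighbour in \<open>?Z\<close>. Hence
          \<open>Y\<close> has at most two cliques, one met by \<open>B\<close> and one by
          \<open>v\<close>, against \<open>n \<ge> 3\<close>.\<close>
        let ?Z = "insert v (B \<inter> Y)"
        have "\<exists>z\<in>?Z. E y z" if y: "y \<in> Y - ?Z" for y
        proof -
          obtain z where z: "z \<in> Y" "E y z" using nbr y by blast
          then have "z \<in> ?Z" using iA(1) y unfolding indep_def by blast
          then show ?thesis using z by blast
        qed
        then have "ncomps Y \<le> ncomps ?Z"
          using ncomps_dominating[OF XY(6) _ fin(2), of ?Z] v(1) by blast
        also have "\<dots> \<le> ncomps (?Z - {v}) + 1" using fin by (intro ncomps_remove_le) auto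
        also have "ncomps (?Z - {v}) \<le> 1"
          by (rule clique_ncomps_le_1[OF clique_mono[OF 3]]) blast
        finally show ?thesis using XY(7) False by simp
      qed
    qed
    then show "mpol C \<le> enat k" using assms(6) by simp
  qed
  moreover have "\<not> clustered (C - {v})" using join_not_clustered[OF j XY(3) ncl] Cv by simp
  ultimately show ?thesis using that v(1) XY(1) by blast
qed

section \<open>The bowtie as the only noncritical component\<close>

definition bowtie :: "'a set \<Rightarrow> bool" where
  "bowtie C \<longleftrightarrow> (\<exists>c Y. C = insert c Y \<and> joined {c} Y \<and> clustered Y \<and> ncomps Y = 2 \<and>
     (\<forall>K\<in>comps Y. card K = 2))"

lemma no_isolated_nbr:
  assumes "no_isolated Y" "y \<in> Y" shows "\<exists>z\<in>Y. E y z"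
proof (rule ccontr)
  assume n: "\<not> ?thesis"
  then have "sep {y} (Y - {y})" unfolding sep_def by blast
  then have "{y} \<in> comps Y" using conn_singleton assms(2) unfolding comps_def by blast
  then show False using assms(1) unfolding no_isolated_def by force
qed

text \<open>The deletion of \<open>v0\<close> leaves a cluster without lowering the value. This
  makes \<open>v0\<close> the whole independent side of the join; deleting vertices of the other
  side then forces that side to consist of two edges.\<close>

lemma noncritical_bowtie:
  assumes "finite C" "p4_free C" "conn C" "\<not> clustered C" "card C \<noteq> 3" "mpol C = enat n"
    and "v0 \<in> C" "clustered (C - {v0})" "mpol (C - {v0}) = enat n"
    and crit: "\<And>v. v \<in> C \<Longrightarrow> \<not> clustered (C - {v}) \<Longrightarrow> mpol (C - {v}) < enat n"
  shows "bowtie C"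
proof -
  \<comment> \<open>A deletion that keeps an induced P3 leaves a value of at least 1, and by
    \<open>crit\<close> it lowers the value.\<close>
  have n2: "n \<ge> 2"
  proof (rule ccontr)
    assume n: "\<not> n \<ge> 2"
    obtain v where v: "v \<in> C" "\<not> clustered (C - {v})"
      using remove_keeps_nonclustered assms(1,4,5) by blast
    have "1 \<le> mpol (C - {v})" using not_clustered_mpol_ge_1 v(2) assms(1) by blast
    then have "1 < enat n" using crit[OF v] by (rule le_less_trans)
    then show False using n by (simp add: one_enat_def)
  qed
  obtain X Y where XY: "C = X \<union> Y" "joined X Y" "X \<noteq> {}" "Y \<noteq> {}"
    "indep X" "clustered Y" "ncomps Y = n"
    using conn_mpol_ge_2_join[OF assms(1-3,6) n2] by metis
  have dj: "X \<inter> Y = {}" using XY(2) irrefl unfolding joined_def by blast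
  have fin: "finite X" "finite Y" using assms(1) XY(1) by auto
  have nclY: "\<not> clique Y" using clique_ncomps_le_1[of Y] XY(7) n2 by linarith
  \<comment> \<open>Otherwise the remainder is still a join, hence a connected cluster, hence a
    clique; with \<open>v0\<close> as the independent side \<open>C\<close> would be split.\<close>
  have "v0 \<notin> Y"
  proof
    assume v0: "v0 \<in> Y"
    have "joined X (Y - {v0})" using XY(2) unfolding joined_def by blast
    moreover have "Y \<noteq> {v0}" using nclY unfolding clique_def by blast
    ultimately have "conn (X \<union> (Y - {v0}))" using conn_joined XY(3) v0 by blast
    moreover have e: "C - {v0} = X \<union> (Y - {v0})" using XY(1) v0 dj by blast
    ultimately have "clique (C - {v0})" using conn_clusteredD assms(8) by simp
    moreover have "indep (C - (C - {v0}))" using irrefl unfolding indep_def by auto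
    ultimately have "mpol C \<le> 1" using mpol_le_1_iff[OF assms(1)] by blast
    then show False using assms(6) n2 by (simp add: one_enat_def)
  qed
  then have v0: "v0 \<in> X" using assms(7) XY(1) by blast
  \<comment> \<open>A further vertex of \<open>X\<close> together with two nonadjacent vertices of
    \<open>Y\<close> would be an induced P3 in \<open>C - {v0}\<close>.\<close>
  have X: "X = {v0}"
  proof (rule ccontr)
    assume "X \<noteq> {v0}"
    then have "X - {v0} \<noteq> {}" using v0 by blast
    moreover have "joined (X - {v0}) Y" using XY(2) unfolding joined_def by blast
    ultimately have "\<not> clustered ((X - {v0}) \<union> Y)" using join_not_clustered nclY by blast
    moreover have "C - {v0} = (X - {v0}) \<union> Y" using XY(1) v0 dj by blast
    ultimately show False using assms(8) by simp
  qed
  have "C - {v0} = Y" using XY(1) X dj by blast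
  then have mY: "mpol Y = enat n" using assms(9) by simp
  \<comment> \<open>An isolated vertex of \<open>Y\<close> could change to the independent side, so
    \<open>Y\<close> would have a value below its number \<open>n\<close> of cliques.\<close>
  have noiso: "no_isolated Y"
    unfolding no_isolated_def
  proof (intro ballI notI)
    fix K assume K: "K \<in> comps Y" and c: "card K = 1"
    then obtain y where "K = {y}" by (meson card_1_singletonE)
    then have "mpol K = 0" using mpol_eq_0_iff irrefl unfolding indep_def by simp
    then have "mpol Y = mpol (Y - K)" using mpol_remove_comp[OF K fin(2)] by simp
    also have "\<dots> \<le> enat (ncomps (Y - K))"
      using mpol_le_ncomps clustered_mono[OF XY(6)] by blast
    also have "ncomps (Y - K) < ncomps Y"
      using comps_remove_comp[OF K] finite_comps[of "Y - K"] fin(2) unfolding ncomps_def by simp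
    finally show False using mY XY(7) by simp
  qed
  note nbr = no_isolated_nbr[OF noiso]
  have cliq: "clique K" if "K \<in> comps Y" for K using comps_clique[OF XY(6) that] .
  \<comment> \<open>Deleting \<open>v\<close> from \<open>K\<close> keeps the number of cliques, so
    a smaller value forces the cluster to be a clique \<open>B\<close>. It must meet every component
    of \<open>Y\<close> other than \<open>K\<close>, hence there is just one; it then misses
    \<open>K\<close>, so \<open>K - {v}\<close> is independent and a single vertex.\<close>
  have two: "card K = 2 \<and> (\<exists>L. comps Y - {K} = {L})" if K: "K \<in> comps Y" for K
  proof -
    obtain v where v: "v \<in> K" using comps_nonempty[OF K] by blast
    have vY: "v \<in> Y" using v comps_subset[OF K] by blast
    let ?Y = "Y - {v}"
    have Cv: "C - {v} = X \<union> ?Y" using XY(1) dj vY by blast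
    have "\<exists>y\<in>?Y. E x y" if "x \<in> Y - ?Y" for x
    proof -
      have "x = v" using that by blast
      then show ?thesis using nbr[OF vY] irrefl by (metis DiffI singletonD)
    qed
    then have nY: "n \<le> ncomps ?Y"
      using ncomps_dominating[OF XY(6) _ fin(2), of ?Y] XY(7) by auto
    have ncl: "\<not> clique ?Y" using clique_ncomps_le_1[of ?Y] nY n2 by linarith
    then have ne: "?Y \<noteq> {}" unfolding clique_def by blast
    have j: "joined X ?Y" using XY(2) unfolding joined_def by blast
    have "mpol (C - {v}) < enat n"
      using crit[of v] vY XY(1) join_not_clustered[OF j XY(3) ncl] Cv by simp
    then obtain m where m: "mpol (C - {v}) = enat m" "m < n"
      by (cases "mpol (C - {v})") auto
    obtain B where B: "mono_part (C - {v}) B" "ncomps B = m" using m(1) by (rule mpol_attained)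
    from mono_part_join[OF j XY(3) ne] B(1) Cv
    consider "B = ?Y" | "B = X" "indep ?Y" | "clique B" by metis
    then have clB: "clique B"
    proof cases
      case 1
      then show ?thesis using nY B(2) m(2) by simp
    next
      case 2
      have "E y v" if "y \<in> ?Y" for y
        using that nbr[of y] 2(2) unfolding indep_def by (metis DiffD1 DiffI singletonD)
      then show ?thesis using clustered_dominated_clique[OF XY(6) vY] ncl by blast
    qed
    have iA: "indep (X \<union> ?Y - B)" using B(1) Cv unfolding mono_part_def by auto
    have card2: "card L \<ge> 2" if L: "L \<in> comps Y" for L
    proof -
      have "card L \<noteq> 1" using noiso L unfolding no_isolated_def by blast
      moreover have "card L \<noteq> 0"
        using comps_nonempty[OF L] comps_subset[OF L] fin(2) finite_subset by (metis card_0_eq)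
      ultimately show ?thesis by linarith
    qed
    have meet: "L \<inter> B \<noteq> {}" if L: "L \<in> comps Y" "L \<noteq> K" for L
    proof
      assume "L \<inter> B = {}"
      moreover have "v \<notin> L" using comps_eq[OF L(1) K] L(2) v by blast
      ultimately have "L \<subseteq> X \<union> ?Y - B" using comps_subset[OF L(1)] by blast
      then have "indep L" using iA indep_mono by blast
      then obtain x where "L = {x}" using conn_indepD comps_conn[OF L(1)] by blast
      then show False using card2[OF L(1)] by simp
    qed
    have same: "L = M" if "L \<in> comps Y" "M \<in> comps Y" "x \<in> L \<inter> B" "y \<in> M \<inter> B" for L M x y
    proof -
      have "x = y \<or> E x y" using clB that unfolding clique_def by blast
      then have "y \<in> L" using comps_closed[OF that(1)] that comps_subset[OF that(2)] by blast
      then show ?thesis using comps_eq[OF that(1,2)] that by blast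
    qed
    have "comps Y \<noteq> {K}" using XY(7) n2 unfolding ncomps_def by auto
    then obtain L where L: "L \<in> comps Y" "L \<noteq> K" using K by blast
    obtain l where l: "l \<in> L \<inter> B" using meet[OF L] by blast
    have "comps Y - {K} = {L}" using same[OF _ L(1) _ l] meet L by blast
    have "K - {v} \<subseteq> X \<union> ?Y - B"
    proof -
      have "x \<notin> B" if "x \<in> K" for x using same[OF K L(1) _ l] that L(2) by blast
      then show ?thesis using comps_subset[OF K] by blast
    qed
    then have "indep (K - {v})" using iA indep_mono by blast
    have "K - {v} \<noteq> {}"
    proof
      assume "K - {v} = {}"
      then have "K = {v}" using v by blast
      then show False using card2[OF K] by simp
    qed
    then have "conn (K - {v})" using conn_clique[OF clique_mono[OF cliq[OF K], of "K - {v}"]] by blast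
    then obtain w where "K - {v} = {w}" using conn_indepD[OF _ \<open>indep (K - {v})\<close>] by blast
    then have "K = {v, w}" "v \<noteq> w" using v by blast+
    then have "card K = 2" by simp
    then show ?thesis using \<open>comps Y - {K} = {L}\<close> by blast
  qed
  have "ncomps Y = 2"
  proof -
    obtain K where K: "K \<in> comps Y" using XY(4) comps_exists by blast
    obtain L where "comps Y - {K} = {L}" using two[OF K] by blast
    then have "comps Y = {K, L}" "K \<noteq> L" using K by blast+
    then show ?thesis unfolding ncomps_def by simp
  qed
  then show ?thesis
    unfolding bowtie_def using XY(1,2,6) X two by (intro exI[of _ v0] exI[of _ Y]) auto
qed

section \<open>Obstructions\<close>

definition mono_obs :: "nat \<Rightarrow> 'a set \<Rightarrow> bool" where
  "mono_obs k S \<longleftrightarrow> \<not> mpol S \<le> enat k \<and> (\<forall>T. T \<subset> S \<longrightarrow> mpol T \<le> enat k)"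

definition polar_obs :: "nat \<Rightarrow> 'a set \<Rightarrow> bool" where
  "polar_obs k S \<longleftrightarrow> \<not> pol S \<le> enat k \<and> (\<forall>T. T \<subset> S \<longrightarrow> pol T \<le> enat k)"

definition matching :: "nat \<Rightarrow> 'a set \<Rightarrow> bool" where
  "matching n M \<longleftrightarrow> clustered M \<and> (\<forall>K\<in>comps M. card K = 2) \<and> ncomps M = n"

definition bowtie_plus :: "nat \<Rightarrow> 'a set \<Rightarrow> bool" where
  "bowtie_plus n S \<longleftrightarrow> n \<ge> 2 \<and>
     (\<exists>C M. S = C \<union> M \<and> C \<inter> M = {} \<and> sep C M \<and> bowtie C \<and> matching (n - 2) M)"

text \<open>
  Condition (3) of the theorem: for a minimal \<open>(1, n - 1)\<close>-polar obstruction, being neither a minimal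
  \<open>(1, \<infinity>)\<close>-polar obstruction nor \<open>nK\<^sub>2\<close> amounts to being monopolar and not a cluster.
\<close>

definition admissible :: "nat \<Rightarrow> 'a set \<Rightarrow> bool" where
  "admissible n S \<longleftrightarrow>
     (mono_obs (n - 1) S \<and> mpol S \<noteq> \<infinity> \<and> \<not> clustered S) \<or> bowtie_plus n S"

lemma matching_no_isolated: "matching n M \<Longrightarrow> no_isolated M"
  unfolding matching_def no_isolated_def by auto

lemma matching_mpol: "matching n M \<Longrightarrow> finite M \<Longrightarrow> mpol M = enat n"
  using mpol_clustered matching_no_isolated unfolding matching_def by blast

lemma bowtieE:
  assumes "bowtie C" "finite C"
  obtains c Y where "C = insert c Y" "c \<notin> Y" "joined {c} Y" "matching 2 Y" "finite Y" "mpol Y = 2"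
proof -
  obtain c Y where cY: "C = insert c Y" "joined {c} Y" "matching 2 Y"
    using assms(1) unfolding bowtie_def matching_def by blast
  moreover have "c \<notin> Y" using cY(2) irrefl unfolding joined_def by blast
  moreover have "finite Y" using cY(1) assms(2) by simp
  moreover have "mpol Y = 2" using matching_mpol[OF cY(3) \<open>finite Y\<close>] by (simp add: numeral_eq_enat)
  ultimately show ?thesis using that by blast
qed

lemma bowtie_facts:
  assumes "bowtie C" "finite C" shows "conn C" "\<not> clustered C" "mpol C = 2"
proof -
  obtain c Y where cY: "C = insert c Y" "c \<notin> Y" "joined {c} Y" "matching 2 Y" "finite Y" "mpol Y = 2"
    using bowtieE[OF assms] by blast
  have ncl: "\<not> clique Y" using cY(4) clique_ncomps_le_1[of Y] unfolding matching_def by linarith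
  then have "Y \<noteq> {}" unfolding clique_def by blast
  then show "conn C" using conn_joined[OF cY(3)] cY(1) by simp
  show "\<not> clustered C" using join_not_clustered[OF cY(3) _ ncl] cY(1) by simp
  have "C - Y = {c}" using cY(1,2) by blast
  then have "mono_part C Y"
    using cY(1,4) irrefl unfolding mono_part_def matching_def indep_def by auto
  then have "mpol C \<le> 2"
    using mpol_le[of C Y] cY(4) unfolding matching_def by (simp add: numeral_eq_enat)
  moreover have "mpol Y \<le> mpol C" using cY(1) assms(2) by (intro mpol_mono) auto
  ultimately show "mpol C = 2" using cY(6) by simp
qed

text \<open>Deleting the centre of the bowtie leaves 2K2, whose value is still 2. Hence the two
  alternatives in \<open>admissible\<close> exclude each other.\<close>

lemma bowtie_plus_not_mono_obs:
  assumes "bowtie_plus n S" "finite S" shows "\<not> mono_obs k S"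
proof
  assume o: "mono_obs k S"
  obtain C M where S: "S = C \<union> M" "C \<inter> M = {}" "sep C M" "bowtie C"
    using assms(1) unfolding bowtie_plus_def by blast
  have fin: "finite C" "finite M" using assms(2) S(1) by auto
  obtain c Y where "C = insert c Y" "c \<notin> Y" "mpol Y = 2" using bowtieE[OF S(4) fin(1)] by metis
  then have c: "c \<in> C" "mpol (C - {c}) = 2" by auto
  have "S - {c} = (C - {c}) \<union> M" using S(1,2) c(1) by blast
  then have "mpol (S - {c}) = 2 + mpol M"
    using mpol_Un[of "C - {c}" M] fin S(2) sep_mono[OF S(3), of "C - {c}" M] c(2) by auto
  also have "\<dots> = mpol S"
    using mpol_Un[of C M] fin S bowtie_facts(3)[OF S(4) fin(1)] by simp
  finally have "mpol (S - {c}) = mpol S" .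
  moreover have "S - {c} \<subset> S" using c(1) S(1) by blast
  ultimately show False using o unfolding mono_obs_def by metis
qed

section \<open>Complete components of a minimal obstruction\<close>

lemma comps_remove_comp_diff:
  assumes "K \<in> comps S" shows "comps (S - K) = comps S - {K}"
  using comps_remove_comp[OF assms] by auto

lemma clustered_by_comps:
  assumes "\<And>K. K \<in> comps S \<Longrightarrow> clustered K" shows "clustered S"
  unfolding clustered_def
proof (intro ballI impI)
  fix x y z assume s: "x \<in> S" "y \<in> S" "z \<in> S" and e: "E x y" "E y z" "x \<noteq> z"
  obtain K where K: "K \<in> comps S" "y \<in> K" using s(2) by (rule comps_exists)
  have "x \<in> K" "z \<in> K" using comps_sep[OF K(1)] K(2) s e sym[OF e(1)] unfolding sep_def by blast+
  then show "E x z" using assms[OF K(1)] K(2) e unfolding clustered_def by blast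
qed

text \<open>Within the complete component \<open>K\<close>, \<open>v\<close> and \<open>w\<close>
  are adjacent and have the same further neighbours, so \<open>v\<close> can follow \<open>w\<close>
  into the cluster without creating a new clique.\<close>

lemma clustered_insert_clique_comp:
  assumes "K \<in> comps V" "clique K" "v \<in> K" "w \<in> K" "w \<noteq> v" "w \<in> B"
    and "B \<subseteq> V - {v}" "clustered B" "finite V"
  shows "clustered (insert v B)" "ncomps (insert v B) \<le> ncomps B"
proof -
  have cl: "y \<in> K" if "x \<in> K" "y \<in> V" "E x y" for x y
    using comps_sep[OF assms(1)] that unfolding sep_def by blast
  have sub: "insert v B \<subseteq> V" using assms(3,7) comps_subset[OF assms(1)] by blast
  show c: "clustered (insert v B)"
    unfolding clustered_def
  proof (intro ballI impI)
    fix x y z assume s: "x \<in> insert v B" "y \<in> insert v B" "z \<in> insert v B"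
      and e: "E x y" "E y z" "x \<noteq> z"
    show "E x z"
    proof (cases "x \<in> K \<or> y \<in> K \<or> z \<in> K")
      case True
      then have "x \<in> K" "z \<in> K" using cl s sub e sym by blast+
      then show ?thesis using assms(2) e(3) unfolding clique_def by blast
    next
      case False
      then have "x \<in> B" "y \<in> B" "z \<in> B" using s assms(3) by blast+
      then show ?thesis using assms(8) e unfolding clustered_def by blast
    qed
  qed
  have "E v w" using assms(2-5) unfolding clique_def by metis
  moreover have "finite (insert v B)" using finite_subset[OF sub assms(9)] .
  ultimately show "ncomps (insert v B) \<le> ncomps B"
    using assms(6) by (intro ncomps_dominating[OF c]) auto
qed

text \<open>If the cluster meets \<open>K\<close>, \<open>v\<close> joins it there. If not, at least
  two vertices of \<open>K\<close> are on the multipartite side, which is then connected, lies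
  within \<open>K\<close>, and can be enlarged to \<open>K\<close>. So complete components of a
  minimal obstruction have at most two vertices.\<close>

lemma pol_remove_from_clique_comp:
  assumes "K \<in> comps V" "clique K" "v \<in> K" "card K \<ge> 3" "finite V"
  shows "pol V \<le> pol (V - {v})"
proof (rule enat_leI_finite)
  fix k assume "pol (V - {v}) = enat k"
  then obtain B where B: "polar_part (V - {v}) B" "ncomps B = k" by (rule pol_attained)
  let ?A = "V - {v} - B"
  have vV: "v \<in> V" using assms(3) comps_subset[OF assms(1)] by blast
  have Bs: "B \<subseteq> V - {v}" "clustered B" "multipartite ?A" using B(1) unfolding polar_part_def by auto
  show "pol V \<le> enat k"
  proof (cases "K \<inter> B = {}")
    case False
    then obtain w where w: "w \<in> K" "w \<in> B" by blast
    note ext = clustered_insert_clique_comp[OF assms(1-3) w(1) _ w(2) Bs(1,2) assms(5)]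
    have "w \<noteq> v" using w(2) Bs(1) by blast
    moreover have "V - insert v B = ?A" by blast
    ultimately have "polar_part V (insert v B)"
      using ext(1) Bs vV unfolding polar_part_def by auto
    then show ?thesis using pol_le_iff[of V k] ext(2) \<open>w \<noteq> v\<close> B(2) by blast
  next
    case True
    then have KA: "K - {v} \<subseteq> ?A" using comps_subset[OF assms(1)] by blast
    have fK: "finite K" using assms(4) by (metis card.infinite not_numeral_le_zero)
    have "\<not> indep ?A"
    proof
      assume i: "indep ?A"
      have "card (K - {v}) \<ge> 2" using assms(3,4) fK by simp
      then have "K - {v} \<noteq> {}" using card.empty by (metis not_numeral_le_zero)
      then have "conn (K - {v})" by (intro conn_clique[OF clique_mono[OF assms(2)]]) auto
      then obtain x where "K - {v} = {x}" using conn_indepD[OF _ indep_mono[OF i KA]] by blast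
      then show False using \<open>card (K - {v}) \<ge> 2\<close> by simp
    qed
    then have "conn ?A" using multipartite_conn Bs(3) by blast
    moreover have "?A \<inter> K \<noteq> {}"
    proof
      assume "?A \<inter> K = {}"
      then have "K \<subseteq> {v}" using KA by blast
      then have "card K \<le> 1" using card_mono[of "{v}" K] by simp
      then show False using assms(4) by simp
    qed
    ultimately have "?A \<subseteq> K" by (intro conn_subset_comp[OF _ _ assms(1)]) auto
    then have "V - B = K" using True comps_subset[OF assms(1)] assms(3) by blast
    then have "polar_part V B"
      using Bs clique_imp_multipartite[OF assms(2)] unfolding polar_part_def by auto
    then show ?thesis using pol_le B(2) by blast
  qed
qed

text \<open>The vertex \<open>w\<close> cannot be in the cluster, where \<open>u\<close> could join
  it. On the multipartite side it is isolated, and such a side with an edge would be connected;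
  hence that side is independent.\<close>

lemma pol_remove_from_edge_comp:
  assumes "K \<in> comps V" "K = {u, w}" "u \<noteq> w" "finite V" "\<not> pol V \<le> enat k" "pol (V - {u}) \<le> enat k"
  shows "mpol (V - {u}) \<le> enat k"
proof -
  obtain B where B: "polar_part (V - {u}) B" "ncomps B \<le> k" using assms(6) pol_le_iff by blast
  let ?A = "V - {u} - B"
  have uV: "u \<in> V" "w \<in> V" using assms(2) comps_subset[OF assms(1)] by auto
  have Bs: "B \<subseteq> V - {u}" "clustered B" "multipartite ?A" using B(1) unfolding polar_part_def by auto
  have cK: "clique K"
  proof -
    have "\<not> sep {u} (K - {u})" using connD[OF comps_conn[OF assms(1)], of "{u}"] assms(2,3) by blast
    then show ?thesis using assms(2,3) sym unfolding sep_def clique_def by auto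
  qed
  have "indep ?A"
  proof (rule ccontr)
    assume ni: "\<not> indep ?A"
    show False
    proof (cases "w \<in> B")
      case True
      note ext = clustered_insert_clique_comp[OF assms(1) cK _ _ _ True Bs(1,2) assms(4)]
      have "V - insert u B = ?A" by blast
      then have "polar_part V (insert u B)"
        using ext(1) Bs uV assms(2,3) unfolding polar_part_def by auto
      then have "pol V \<le> enat k" using pol_le_iff ext(2) assms(2,3) B(2)
        by (metis insertI1 insertI2 order_trans)
      then show False using assms(5) by blast
    next
      case False
      then have "w \<in> ?A" using uV assms(3) by blast
      moreover have "conn ?A" using multipartite_conn[OF Bs(3) ni] .
      ultimately have "?A \<subseteq> K" using assms(2) by (intro conn_subset_comp[OF _ _ assms(1)]) auto
      then have "?A \<subseteq> {w}" using assms(2) by blast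
      then show False using ni irrefl unfolding indep_def by blast
    qed
  qed
  then have "mono_part (V - {u}) B" using Bs unfolding mono_part_def by blast
  then show ?thesis using mpol_le_iff B(2) by blast
qed

text \<open>The graph K1 + (k + 1)K2. An independent side leaves a vertex of each edge to the
  cluster; a side with an edge lies within a single edge and leaves \<open>k\<close> edges and the
  extra vertex. Either way the cluster has \<open>k + 1\<close> components.\<close>

lemma pol_vertex_plus_matching:
  assumes "finite T" "T = insert a M" "a \<notin> M" "sep {a} M" "matching (Suc k) M"
  shows "\<not> pol T \<le> enat k"
proof
  assume "pol T \<le> enat k"
  then obtain B where B: "polar_part T B" "ncomps B \<le> k" using pol_le_iff by blast
  have Bs: "B \<subseteq> T" "clustered B" "multipartite (T - B)" using B(1) unfolding polar_part_def by auto
  have fin: "finite M" using assms(1,2) by simp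
  have mM: "mpol M = enat (Suc k)" using matching_mpol[OF assms(5) fin] .
  show False
  proof (cases "indep (T - B)")
    case True
    then have "mpol T \<le> enat (ncomps B)" using mpol_le Bs unfolding mono_part_def by blast
    moreover have "mpol M \<le> mpol T" using assms(1,2) by (intro mpol_mono) auto
    ultimately have "enat (Suc k) \<le> enat (ncomps B)" using mM by (metis order_trans)
    then show False using B(2) by simp
  next
    case False
    then have c: "conn (T - B)" using multipartite_conn Bs(3) by blast
    have M': "T = {a} \<union> M" using assms(2) by simp
    have "T - B \<subseteq> {a} \<or> T - B \<subseteq> M" using conn_subset_Un[OF c _ assms(4)] M' by blast
    then have AM: "T - B \<subseteq> M" using False irrefl unfolding indep_def by blast
    then have aB: "a \<in> B" using assms(2,3) by blast
    obtain x where x: "x \<in> T - B" using conn_nonempty[OF c] by blast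
    then have "x \<in> M" using AM by blast
    then obtain D where D: "D \<in> comps M" "x \<in> D" by (rule comps_exists)
    have "T - B \<subseteq> D" using conn_subset_comp[OF c AM D(1)] x D(2) by blast
    then have sub: "{a} \<union> (M - D) \<subseteq> B" using aB assms(2) by blast
    have s: "sep {a} (M - D)" using sep_mono[OF assms(4)] by blast
    have "ncomps (M - D) = k"
      using comps_remove_comp[OF D(1)] finite_comps[of "M - D"] fin assms(5)
      unfolding matching_def ncomps_def by simp
    moreover have "ncomps ({a} \<union> (M - D)) = ncomps {a} + ncomps (M - D)"
      using s assms(3) fin by (intro ncomps_Un) auto
    ultimately have "ncomps ({a} \<union> (M - D)) = Suc k" using ncomps_conn[OF conn_singleton] by simp
    moreover have "ncomps ({a} \<union> (M - D)) \<le> ncomps B"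
      using clustered_mono_ncomps[OF Bs(2) sub finite_subset[OF Bs(1) assms(1)]] .
    ultimately show False using B(2) by simp
  qed
qed

lemma matching_Un:
  assumes "matching m M" "matching n N" "sep M N" "M \<inter> N = {}" "finite M" "finite N"
  shows "matching (m + n) (M \<union> N)"
  using assms ncomps_Un[of M N] comps_Un[OF assms(3)] clustered_Un
  unfolding matching_def by auto

lemma edge_matching: "E b c \<Longrightarrow> matching 1 {b, c}"
proof -
  assume e: "E b c"
  have "clique {b, c}" using e sym unfolding clique_def by auto
  moreover have "b \<noteq> c" using e irrefl by auto
  ultimately show ?thesis
    using comps_conn_eq[OF conn_clique] ncomps_conn[OF conn_clique] clique_imp_clustered
    unfolding matching_def by simp
qed

text \<open>Excludes the form C + mK2, where \<open>C\<close> may itself be complete. If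
  \<open>C\<close> has value at least 2, one clique can be saved as in
  \<open>conn_pol_less_mpol\<close>; if it has value 1, a proper subgraph K1 + (k + 1)K2 already
  fails.\<close>

lemma one_nonclique_comp_impossible:
  assumes "finite V" "p4_free V" "polar_obs k V" "C \<in> comps V" "card C \<noteq> 1"
    and "matching m (V - C)" "V \<noteq> C"
  shows False
proof -
  let ?M = "V - C"
  have nk: "\<not> pol V \<le> enat k" and sm: "\<And>T. T \<subset> V \<Longrightarrow> pol T \<le> enat k"
    using assms(3) unfolding polar_obs_def by auto
  have CV: "C \<subseteq> V" "conn C" "sep C ?M"
    using comps_subset[OF assms(4)] comps_conn[OF assms(4)] comps_sep[OF assms(4)] by auto
  have fin: "finite C" "finite ?M" using assms(1) finite_subset[OF CV(1)] by auto
  have VCM: "V = C \<union> ?M" using CV(1) by blast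
  have clM: "clustered ?M" "ncomps ?M = m" using assms(6) unfolding matching_def by auto
  have mM: "mpol ?M = enat m" using matching_mpol[OF assms(6) fin(2)] .
  have mV: "mpol V = mpol C + enat m" using mpol_remove_comp[OF assms(4,1)] mM by simp
  have pV: "pol V \<le> pol C + enat m"
    using pol_Un_clustered[OF fin CV(3) _ clM(1)] VCM clM(2) by auto
  obtain x where "x \<in> ?M" using CV(1) assms(7) by blast
  then obtain K where K: "K \<in> comps ?M" by (rule comps_exists)
  have KV: "K \<in> comps V" "K \<noteq> C"
    using K comps_remove_comp[OF assms(4)] by auto
  have "card K = 2" using assms(6) K unfolding matching_def by blast
  then obtain u w where uw: "K = {u, w}" "u \<noteq> w" by (meson card_2_iff)
  have "u \<in> V" using uw comps_subset[OF KV(1)] by blast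
  then have "pol (V - {u}) \<le> enat k" using sm by blast
  \<comment> \<open>With one end of an edge gone the multipartite side has to be independent;
    putting the edge back costs one clique, so \<open>mpol V\<close> is exactly
    \<open>k + 1\<close>.\<close>
  then have "mpol (V - {u}) \<le> enat k" using pol_remove_from_edge_comp[OF KV(1) uw assms(1) nk] by blast
  then have "mpol (V - K) \<le> enat k"
    using mpol_mono[of "V - K" "V - {u}"] uw(1) assms(1) by (auto intro: order_trans)
  moreover have "mpol K \<le> 1"
    using mpol_le_1_iff[of K] comps_clique[OF clM(1) K] uw(1) unfolding indep_def by auto
  ultimately have "mpol K + mpol (V - K) \<le> 1 + enat k" by (rule add_mono[rotated])
  then have "mpol V \<le> 1 + enat k" using mpol_remove_comp[OF KV(1) assms(1)] by simp
  moreover have "\<not> mpol V \<le> enat k" using nk pol_le_mpol order_trans by blast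
  ultimately have mVk: "mpol V = enat (Suc k)"
    by (cases "mpol V") (auto simp: one_enat_def)
  then obtain n where n: "mpol C = enat n" "n + m = Suc k" using mV by (cases "mpol C") auto
  have nM: "\<not> pol C + enat m \<le> enat k" using pV nk order_trans by blast
  show False
  proof (cases "n \<ge> 2")
    case True
    then have "pol C \<le> enat (n - 1)"
      using conn_pol_less_mpol[OF fin(1) p4_free_mono[OF assms(2) CV(1)] CV(2) n(1)] by blast
    then have "pol C + enat m \<le> enat (n - 1) + enat m" by (intro add_mono) auto
    then show False using nM n(2) True by simp
  next
    case False
    have "n \<noteq> 0"
    proof
      assume "n = 0"
      then have "indep C" using n(1) mpol_eq_0_iff[OF fin(1)] by (simp add: zero_enat_def)
      then show False using conn_indepD[OF CV(2)] assms(5) by auto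
    qed
    then have mk: "m = k" using False n(2) by linarith
    \<comment> \<open>Otherwise \<open>C\<close> would be the multipartite side and the
      \<open>k\<close> edges the cluster. The witnesses \<open>a\<close>, \<open>b\<close>,
      \<open>c\<close> induce K1 + K2, and with the edges outside \<open>C\<close> they give K1 + (k
      + 1)K2.\<close>
    have "\<not> multipartite C" using pol_multipartite[of C] nM mk by auto
    then obtain b a c where abc: "a \<in> C" "b \<in> C" "c \<in> C" "\<not> E b a" "\<not> E a c" "E b c"
      unfolding multipartite_def by blast
    have ne: "a \<noteq> b" "a \<noteq> c" using abc sym by auto
    let ?N = "{b, c} \<union> ?M"
    have s: "sep {b, c} ?M" using sep_mono[OF CV(3), of "{b, c}" ?M] abc by blast
    have "matching (1 + k) ?N"
      using matching_Un[OF edge_matching[OF abc(6)] assms(6)] s abc fin(2) mk by auto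
    moreover have "sep {a} ?N"
      using CV(3) abc sym unfolding sep_def by blast
    moreover have "a \<notin> ?N" using ne abc by blast
    moreover have "finite (insert a ?N)" using fin(2) by simp
    ultimately have "\<not> pol (insert a ?N) \<le> enat k" using pol_vertex_plus_matching by auto
    moreover have "insert a ?N \<subset> V"
    proof -
      \<comment> \<open>The vertex \<open>a\<close> would be isolated in the connected set
        \<open>C\<close>.\<close>
      have "C \<noteq> {a, b, c}"
      proof
        assume C: "C = {a, b, c}"
        then have "sep {a} (C - {a})" using abc sym unfolding sep_def by auto
        then show False using connD[OF CV(2), of "{a}"] C ne by blast
      qed
      then obtain d where "d \<in> C" "d \<notin> {a, b, c}" using abc by blast
      then have "d \<in> V" "d \<notin> insert a ?N" using CV(1) by auto
      then show ?thesis using abc CV(1) by blast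
    qed
    ultimately show False using sm by blast
  qed
qed

section \<open>From an obstruction to two admissible summands\<close>

lemma mono_obs_summand:
  assumes "finite S" "finite T" "sep S T" "S \<inter> T = {}" "mpol S = enat m" "mpol T = enat n" "m \<ge> 1"
    and crit: "\<And>v. v \<in> S \<Longrightarrow> mpol (S \<union> T - {v}) \<le> enat (m + n - 1)"
  shows "mono_obs (m - 1) S"
  unfolding mono_obs_def
proof (intro conjI allI impI)
  show "\<not> mpol S \<le> enat (m - 1)" using assms(5,7) by simp
  fix U assume "U \<subset> S"
  then obtain v where v: "v \<in> S" "U \<subseteq> S - {v}" by blast
  have "S \<union> T - {v} = (S - {v}) \<union> T" using v(1) assms(4) by blast
  moreover have "sep (S - {v}) T" by (rule sep_mono[OF assms(3)]) auto
  moreover have "(S - {v}) \<inter> T = {}" using assms(4) by blast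
  ultimately have "mpol (S - {v}) + enat n \<le> enat (m + n - 1)"
    using mpol_Un[of "S - {v}" T] crit[OF v(1)] assms(1,2,6) by simp
  then have "mpol (S - {v}) \<le> enat (m - 1)" using assms(7) by (cases "mpol (S - {v})") auto
  moreover have "mpol U \<le> mpol (S - {v})" using v(2) assms(1) by (intro mpol_mono) auto
  ultimately show "mpol U \<le> enat (m - 1)" by (rule order_trans[rotated])
qed

lemma pol_eq_mpol_of_two_comps:
  assumes "K \<in> comps V" "L \<in> comps V" "K \<noteq> L" "T \<subseteq> V" "\<not> clustered (K \<inter> T)" "\<not> clustered (L \<inter> T)"
  shows "pol T = mpol T"
proof -
  have "K \<inter> L = {}" using comps_eq[OF assms(1,2)] assms(3) by blast
  then have "L \<inter> T \<subseteq> T - K" by blast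
  then have "\<not> clustered (T - K)" using assms(6) clustered_mono by blast
  moreover have "sep (K \<inter> T) (T - K)" using assms(4) by (intro sep_mono[OF comps_sep[OF assms(1)]]) auto
  moreover have "(K \<inter> T) \<union> (T - K) = T" by blast
  ultimately show ?thesis using pol_Un_nonclustered[of "K \<inter> T" "T - K"] assms(5) by simp
qed

lemma clique_comps_of_polar_obs:
  assumes "finite V" "polar_obs k V" "no_isolated V" "K \<in> comps V" "clustered K"
  shows "card K = 2"
proof -
  have c: "clique K" using conn_clusteredD[OF comps_conn[OF assms(4)] assms(5)] .
  have fK: "finite K" using finite_subset[OF comps_subset[OF assms(4)] assms(1)] .
  obtain v where v: "v \<in> K" using comps_nonempty[OF assms(4)] by blast
  have "card K \<noteq> 0" using v fK by auto
  moreover have "card K \<noteq> 1" using assms(3,4) unfolding no_isolated_def by blast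
  moreover have "\<not> card K \<ge> 3"
  proof
    assume "card K \<ge> 3"
    then have "pol V \<le> pol (V - {v})" using pol_remove_from_clique_comp[OF assms(4) c v _ assms(1)] by blast
    moreover have "pol (V - {v}) \<le> enat k"
      using assms(2) v comps_subset[OF assms(4)] unfolding polar_obs_def by blast
    ultimately show False using assms(2) order_trans unfolding polar_obs_def by blast
  qed
  ultimately show ?thesis by linarith
qed

lemma polar_obs_splits:
  assumes fin: "finite V" and p4: "p4_free V" and obs: "polar_obs k V" and noiso: "no_isolated V"
    and nconn: "\<not> conn V" and noP3: "\<forall>K\<in>comps V. card K = 3 \<longrightarrow> clustered K"
  shows "\<exists>k1 k2 S T. k1 \<ge> 1 \<and> k2 \<ge> 1 \<and> V = S \<union> T \<and> S \<inter> T = {} \<and> sep S T \<and> k = k1 + k2 - 1 \<and>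
    admissible k1 S \<and> admissible k2 T \<and>
    (bowtie_plus k1 S \<and> mono_obs (k2 - 1) T \<longrightarrow> (\<exists>!K. K \<in> comps T \<and> card K \<noteq> 2)) \<and>
    (bowtie_plus k2 T \<and> mono_obs (k1 - 1) S \<longrightarrow> (\<exists>!K. K \<in> comps S \<and> card K \<noteq> 2))"
proof -
  have nk: "\<not> pol V \<le> enat k" and sm: "\<And>T. T \<subset> V \<Longrightarrow> pol T \<le> enat k"
    using obs unfolding polar_obs_def by auto
  have edge: "card K = 2" if "K \<in> comps V" "clustered K" for K
    using clique_comps_of_polar_obs[OF fin obs noiso that] .
  have finK: "finite K" if "K \<in> comps V" for K using finite_subset[OF comps_subset[OF that] fin] .
  have match: "matching (ncomps S) S"
    if "comps S \<subseteq> comps V" "\<And>K. K \<in> comps S \<Longrightarrow> clustered K" for S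
    unfolding matching_def using that edge clustered_by_comps[of S] by blast
  obtain C1 C2 where C12: "C1 \<in> comps V" "C2 \<in> comps V" "C1 \<noteq> C2" "\<not> clustered C1" "\<not> clustered C2"
  proof (rule ccontr)
    assume "\<not> thesis"
    then have one: "K = L" if "K \<in> comps V" "L \<in> comps V" "\<not> clustered K" "\<not> clustered L" for K L
      using that \<open>\<And>C1 C2. \<lbrakk>C1 \<in> comps V; C2 \<in> comps V; C1 \<noteq> C2; \<not> clustered C1; \<not> clustered C2\<rbrakk> \<Longrightarrow> thesis\<close> by blast
    have "V \<noteq> {}"
    proof
      assume "V = {}"
      then have "multipartite V" unfolding multipartite_def by blast
      then show False using nk pol_multipartite by simp
    qed
    then obtain C0 where C0: "C0 \<in> comps V" using comps_exists by blast
    \<comment> \<open>If all components are complete, \<open>C0\<close> takes the exceptional role;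
      otherwise the only noncomplete one does.\<close>
    obtain C where C: "C \<in> comps V" "\<And>K. K \<in> comps V \<Longrightarrow> K \<noteq> C \<Longrightarrow> clustered K"
      using C0 one by metis
    have sub: "comps (V - C) = comps V - {C}" using comps_remove_comp_diff[OF C(1)] .
    then have "matching (ncomps (V - C)) (V - C)" using C(2) by (intro match) auto
    moreover have "card C \<noteq> 1" using noiso C(1) unfolding no_isolated_def by blast
    moreover have "V \<noteq> C" using nconn comps_conn[OF C(1)] by blast
    ultimately show False using one_nonclique_comp_impossible[OF fin p4 obs C(1)] by blast
  qed
  \<comment> \<open>Two components that stay noncomplete make \<open>pol\<close> and
    \<open>mpol\<close> agree on \<open>V - {v}\<close>, so minimality bounds \<open>mpol\<close>
    there.\<close>
  have crit: "mpol (V - {v}) \<le> enat k"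
    if "K \<in> comps V" "L \<in> comps V" "K \<noteq> L" "v \<in> V" "\<not> clustered (K - {v})" "\<not> clustered (L - {v})" for K L v
  proof -
    have "K \<inter> (V - {v}) = K - {v}" "L \<inter> (V - {v}) = L - {v}"
      using comps_subset[OF that(1)] comps_subset[OF that(2)] by auto
    then have "pol (V - {v}) = mpol (V - {v})"
      using pol_eq_mpol_of_two_comps[OF that(1-3), of "V - {v}"] that(5,6) by auto
    moreover have "pol (V - {v}) \<le> enat k" using sm that(4) by blast
    ultimately show ?thesis by simp
  qed
  have notin: "L - {v} = L" if "K \<in> comps V" "L \<in> comps V" "K \<noteq> L" "v \<in> K" for K L v
    using comps_eq[OF that(1,2)] that(3,4) by blast
  have inV: "v \<in> V" if "K \<in> comps V" "v \<in> K" for K v using comps_subset[OF that(1)] that(2) by blast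
  have p3: "card K \<noteq> 3" if "K \<in> comps V" "\<not> clustered K" for K using noP3 that by blast
  \<comment> \<open>The deleted vertex is taken from \<open>C2\<close> and leaves it noncomplete,
    which needs \<open>C2\<close> not to be a P3; \<open>C1\<close> survives whole and inherits the
    bound \<open>k\<close>.\<close>
  have fC1: "mpol C1 \<noteq> \<infinity>"
  proof -
    obtain v where v: "v \<in> C2" "\<not> clustered (C2 - {v})"
      using remove_keeps_nonclustered[OF finK[OF C12(2)] C12(5) p3[OF C12(2,5)]] by blast
    have "C1 - {v} = C1" using notin[OF C12(2,1) _ v(1)] C12(3) by blast
    then have "mpol (V - {v}) \<le> enat k" using crit[OF C12(1-3) inV[OF C12(2) v(1)]] v(2) C12(4) by simp
    moreover have "mpol C1 \<le> mpol (V - {v})"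
      using \<open>C1 - {v} = C1\<close> comps_subset[OF C12(1)] fin by (intro mpol_mono) auto
    ultimately have "mpol C1 \<le> enat k" by (rule order_trans[rotated])
    then show ?thesis by (cases "mpol C1") auto
  qed
  then obtain n1 where n1: "mpol C1 = enat n1" by auto
  \<comment> \<open>A nearly critical vertex of \<open>C1\<close> costs at most one and leaves two
    noncomplete components, so the value is at most \<open>k + 1\<close>; it exceeds
    \<open>k\<close> because \<open>pol\<close> does.\<close>
  have mVk: "mpol V = enat (Suc k)"
  proof -
    have "p4_free C1" using p4_free_mono[OF p4 comps_subset[OF C12(1)]] .
    then obtain v where v: "v \<in> C1" "\<not> clustered (C1 - {v})" "mpol C1 \<le> mpol (C1 - {v}) + 1"
      using mpol_remove_nearly_critical[OF finK[OF C12(1)] _ comps_conn[OF C12(1)] C12(4) p3[OF C12(1,4)] n1]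
      by blast
    have "C2 - {v} = C2" using notin[OF C12(1-3) v(1)] .
    then have a: "mpol (V - {v}) \<le> enat k" using crit[OF C12(1-3) inV[OF C12(1) v(1)]] v(2) C12(5) by simp
    have "mpol V = mpol C1 + mpol (V - C1)" using mpol_remove_comp[OF C12(1) fin] .
    also have "\<dots> \<le> (mpol (C1 - {v}) + 1) + mpol (V - C1)" using v(3) by (rule add_right_mono)
    also have "\<dots> = mpol (V - {v}) + 1"
      using mpol_remove_vertex_of_comp[OF C12(1) v(1) fin] by (simp add: ac_simps)
    also have "\<dots> \<le> enat k + 1" using a by (rule add_right_mono)
    finally have "mpol V \<le> enat (Suc k)" by (simp add: one_enat_def)
    moreover have "\<not> mpol V \<le> enat k" using nk pol_le_mpol order_trans by blast
    ultimately show ?thesis by (cases "mpol V") auto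
  qed
  have mfin: "\<exists>n. mpol S = enat n" if "S \<subseteq> V" for S
    using mpol_mono[OF that fin] mVk by (cases "mpol S") auto
  have part: "\<exists>m n. mpol K = enat m \<and> mpol (V - K) = enat n \<and> m + n = Suc k" if K: "K \<in> comps V" for K
  proof -
    obtain m n where "mpol K = enat m" "mpol (V - K) = enat n"
      using mfin[OF comps_subset[OF K]] mfin[of "V - K"] by blast
    then show ?thesis using mpol_remove_comp[OF K fin] mVk by simp
  qed
  have ge1: "m \<ge> 1" if "mpol S = enat m" "\<not> clustered S" "finite S" for S m
    using not_clustered_mpol_ge_1[OF that(3,2)] that(1) by (simp add: one_enat_def)
  have restncl: "\<not> clustered (V - K)" if "K \<in> comps V" "L \<in> comps V" "K \<noteq> L" "\<not> clustered L" for K L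
  proof -
    have "L \<subseteq> V - K" using comps_eq[OF that(1,2)] that(3) comps_subset[OF that(2)] by blast
    then show ?thesis using clustered_mono that(4) by blast
  qed
  have obsK: "mono_obs (m - 1) K"
    if "K \<in> comps V" "mpol K = enat m" "mpol (V - K) = enat n" "m + n = Suc k" "m \<ge> 1"
      "\<And>v. v \<in> K \<Longrightarrow> mpol (V - {v}) \<le> enat k" for K m n
  proof (rule mono_obs_summand[of K "V - K" m n])
    have "K \<union> (V - K) = V" using comps_subset[OF that(1)] by blast
    then show "mpol (K \<union> (V - K) - {v}) \<le> enat (m + n - 1)" if "v \<in> K" for v
      using \<open>\<And>v. v \<in> K \<Longrightarrow> mpol (V - {v}) \<le> enat k\<close>[OF that] \<open>m + n = Suc k\<close> by simp
  qed (use that fin finK comps_sep in auto)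
  have obsrest: "mono_obs (n - 1) (V - K)"
    if "K \<in> comps V" "mpol K = enat m" "mpol (V - K) = enat n" "m + n = Suc k" "n \<ge> 1"
      "\<And>v. v \<in> V - K \<Longrightarrow> mpol (V - {v}) \<le> enat k" for K m n
  proof (rule mono_obs_summand[of "V - K" K n m])
    have "(V - K) \<union> K = V" using comps_subset[OF that(1)] by blast
    then show "mpol ((V - K) \<union> K - {v}) \<le> enat (n + m - 1)" if "v \<in> V - K" for v
      using \<open>\<And>v. v \<in> V - K \<Longrightarrow> mpol (V - {v}) \<le> enat k\<close>[OF that] \<open>m + n = Suc k\<close>
      by (simp add: add.commute)
    show "sep (V - K) K" using comps_sep[OF that(1)] sep_commute by blast
  qed (use that fin finK in auto)
  \<comment> \<open>A deletion that keeps \<open>mpol\<close> above \<open>k\<close> is out of reach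
    of \<open>crit\<close>: it must turn its component \<open>K\<close> into a cluster, and at most
    one other component may be noncomplete. Every deletion within \<open>K\<close> that
    \<open>crit\<close> does reach lowers the value of \<open>K\<close>.\<close>
  have nc: "bowtie K \<and> \<not> clustered K \<and>
      (\<forall>L\<in>comps V. \<forall>M\<in>comps V. L \<noteq> K \<longrightarrow> M \<noteq> K \<longrightarrow> \<not> clustered L \<longrightarrow> \<not> clustered M \<longrightarrow> L = M)"
    if K: "K \<in> comps V" "v \<in> K" "\<not> mpol (V - {v}) \<le> enat k" for K v
  proof -
    have others: "\<forall>L\<in>comps V. \<forall>M\<in>comps V. L \<noteq> K \<longrightarrow> M \<noteq> K \<longrightarrow> \<not> clustered L \<longrightarrow> \<not> clustered M \<longrightarrow> L = M"
    proof (intro ballI impI, rule ccontr)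
      fix L M assume LM: "L \<in> comps V" "M \<in> comps V" "L \<noteq> K" "M \<noteq> K" "\<not> clustered L" "\<not> clustered M" "L \<noteq> M"
      have "L - {v} = L" "M - {v} = M" using notin[OF K(1) LM(1) _ K(2)] notin[OF K(1) LM(2) _ K(2)] LM by auto
      then show False using crit[OF LM(1,2,7) inV[OF K(1,2)]] LM(5,6) K(3) by simp
    qed
    have nclK: "\<not> clustered K"
    proof
      assume "clustered K"
      then have "C1 \<noteq> K" "C2 \<noteq> K" using C12 by auto
      then show False using others C12 by blast
    qed
    obtain D where D: "D \<in> comps V" "D \<noteq> K" "\<not> clustered D" using C12 by metis
    have other: "\<not> clustered (D - {w})" if "w \<in> K" for w
      using notin[OF K(1) D(1) _ that] D by auto
    have clv: "clustered (K - {v})"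
    proof (rule ccontr)
      assume "\<not> ?thesis"
      then show False using crit[OF K(1) D(1) D(2)[symmetric] inV[OF K(1,2)]] other[OF K(2)] K(3) by blast
    qed
    obtain m n where mn: "mpol K = enat m" "mpol (V - K) = enat n" "m + n = Suc k"
      using part[OF K(1)] by blast
    have "mpol (K - {v}) = enat m"
    proof -
      have "mpol (K - {v}) + enat n = mpol (V - {v})"
        using mpol_remove_vertex_of_comp[OF K(1,2) fin] mn(2) by simp
      then have "\<not> mpol (K - {v}) + enat n \<le> enat k" using K(3) by simp
      moreover have "mpol (K - {v}) \<le> enat m"
        using mpol_mono[of "K - {v}" K] finK[OF K(1)] mn(1) by auto
      ultimately show ?thesis using mn(3) by (cases "mpol (K - {v})") auto
    qed
    moreover have "mpol (K - {w}) < enat m" if w: "w \<in> K" "\<not> clustered (K - {w})" for w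
    proof -
      have "mpol (V - {w}) \<le> enat k"
        using crit[OF K(1) D(1) D(2)[symmetric] inV[OF K(1) w(1)] w(2)] other[OF w(1)] by blast
      then have "mpol (K - {w}) + enat n \<le> enat k"
        using mpol_remove_vertex_of_comp[OF K(1) w(1) fin] mn(2) by simp
      then show ?thesis using mn(3) by (cases "mpol (K - {w})") auto
    qed
    ultimately have "bowtie K"
      using noncritical_bowtie[OF finK[OF K(1)] p4_free_mono[OF p4 comps_subset[OF K(1)]]
          comps_conn[OF K(1)] nclK p3[OF K(1) nclK] mn(1) K(2) clv] by blast
    then show ?thesis using nclK others by blast
  qed
  show ?thesis
  proof (cases "\<forall>v\<in>V. mpol (V - {v}) \<le> enat k")
    case True
    \<comment> \<open>With all deletions critical, any noncomplete component can be split off. Both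
      parts are minimal, hence contain no bowtie summand in the sense of \<open>bowtie_plus\<close>,
      and condition (4) holds vacuously.\<close>
    let ?S = C1 and ?T = "V - C1"
    obtain m n where mn: "mpol ?S = enat m" "mpol ?T = enat n" "m + n = Suc k"
      using part[OF C12(1)] by blast
    have nT: "\<not> clustered ?T" using restncl[OF C12(1-3,5)] .
    have m1: "m \<ge> 1" using ge1[OF mn(1) C12(4) finK[OF C12(1)]] .
    have n1: "n \<ge> 1" using ge1[OF mn(2) nT] fin by blast
    have oS: "mono_obs (m - 1) ?S" using obsK[OF C12(1) mn m1] True inV[OF C12(1)] by blast
    have oT: "mono_obs (n - 1) ?T" using obsrest[OF C12(1) mn n1] True by blast
    have "\<not> bowtie_plus m ?S" "\<not> bowtie_plus n ?T"
      using bowtie_plus_not_mono_obs oS oT finK[OF C12(1)] fin by blast+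
    moreover have "admissible m ?S" "admissible n ?T"
      unfolding admissible_def using oS oT mn C12(4) nT by auto
    moreover have "V = ?S \<union> ?T" using comps_subset[OF C12(1)] by blast
    moreover have "k = m + n - 1" using mn(3) by simp
    ultimately show ?thesis using m1 n1 comps_sep[OF C12(1)]
      by (intro exI[of _ m] exI[of _ n] exI[of _ ?S] exI[of _ ?T] conjI impI; simp)
  next
    case False
    then obtain v where v: "v \<in> V" "\<not> mpol (V - {v}) \<le> enat k" by blast
    obtain K where K: "K \<in> comps V" "v \<in> K" using v(1) by (rule comps_exists)
    have bK: "bowtie K" "\<not> clustered K"
      and uniq: "\<And>L M. L \<in> comps V \<Longrightarrow> M \<in> comps V \<Longrightarrow> L \<noteq> K \<Longrightarrow> M \<noteq> K \<Longrightarrow> \<not> clustered L \<Longrightarrow> \<not> clustered M \<Longrightarrow> L = M"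
      using nc[OF K v(2)] by blast+
    obtain D where D: "D \<in> comps V" "D \<noteq> K" "\<not> clustered D" using C12 by metis
    let ?T = "V - K"
    obtain m n where mn: "mpol K = enat m" "mpol ?T = enat n" "m + n = Suc k"
      using part[OF K(1)] by blast
    have m2: "m = 2" using bowtie_facts(3)[OF bK(1) finK[OF K(1)]] mn(1)
      by (simp add: numeral_eq_enat)
    have nT: "\<not> clustered ?T" using restncl[OF K(1) D(1) D(2)[symmetric] D(3)] .
    have n1: "n \<ge> 1" using ge1[OF mn(2) nT] fin by blast
    \<comment> \<open>The bowtie component by itself is one summand, with \<open>k1 = 2\<close> and
      no further edges.\<close>
    have "matching 0 {}" unfolding matching_def clustered_def by simp
    then have bS: "bowtie_plus 2 K"
      unfolding bowtie_plus_def sep_def using bK(1) by (intro conjI exI[of _ K] exI[of _ "{}"]) auto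
    then have noS: "\<not> mono_obs (2 - 1) K" using bowtie_plus_not_mono_obs finK[OF K(1)] by blast
    have cT: "comps ?T = comps V - {K}" using comps_remove_comp_diff[OF K(1)] .
    have clT: "clustered L" if "L \<in> comps ?T" "L \<noteq> D" for L
      using uniq[of L D] that D cT by blast
    \<comment> \<open>Apart from \<open>D\<close> all components of \<open>?T\<close> are edges.
      Either every deletion in \<open>?T\<close> is critical, or the noncritical vertex lies in
      \<open>D\<close>, which is then a second bowtie.\<close>
    have adT: "admissible n ?T \<and> (mono_obs (n - 1) ?T \<longrightarrow> (\<exists>!L. L \<in> comps ?T \<and> card L \<noteq> 2))"
    proof (cases "\<forall>w\<in>?T. mpol (V - {w}) \<le> enat k")
      case True
      then have "mono_obs (n - 1) ?T" using obsrest[OF K(1) mn n1] by blast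
      then have "admissible n ?T" unfolding admissible_def using mn(2) nT by auto
      moreover have "\<exists>!L. L \<in> comps ?T \<and> card L \<noteq> 2"
      proof (rule ex1I[of _ D])
        have "card D \<noteq> 2"
        proof
          assume "card D = 2"
          then obtain x y where "D = {x, y}" by (meson card_2_iff)
          then show False using D(3) irrefl unfolding clustered_def by auto
        qed
        then show "D \<in> comps ?T \<and> card D \<noteq> 2" using D cT by blast
        show "L = D" if "L \<in> comps ?T \<and> card L \<noteq> 2" for L
          using clT[of L] edge[of L] that cT by blast
      qed
      ultimately show ?thesis by blast
    next
      case False
      then obtain w where w: "w \<in> ?T" "\<not> mpol (V - {w}) \<le> enat k" by blast
      then obtain L where L: "L \<in> comps V" "w \<in> L" using comps_exists by blast
      have LK: "L \<noteq> K" using L(2) w(1) by blast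
      have "bowtie L" "\<not> clustered L" using nc[OF L w(2)] by blast+
      then have "L = D" using uniq[OF L(1) D(1) LK D(2) _ D(3)] by blast
      then have bD: "bowtie D" using \<open>bowtie L\<close> by simp
      have DT: "D \<in> comps ?T" using D cT by blast
      let ?M = "?T - D"
      have cM: "comps ?M = comps ?T - {D}" using comps_remove_comp_diff[OF DT] .
      have M: "matching (ncomps ?M) ?M" using cM cT clT by (intro match) auto
      have "mpol ?T = mpol D + mpol ?M" using mpol_remove_comp[OF DT] fin by blast
      then have "enat n = 2 + enat (ncomps ?M)"
        using mn(2) matching_mpol[OF M] fin bowtie_facts(3)[OF bD finK[OF D(1)]] by simp
      then have nM: "n = 2 + ncomps ?M" by (simp add: numeral_eq_enat)
      have "?T = D \<union> ?M" using comps_subset[OF DT] by blast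
      moreover have "D \<inter> ?M = {}" by blast
      moreover have "sep D ?M" using comps_sep[OF DT] .
      moreover have "matching (n - 2) ?M" using M nM by simp
      ultimately have "bowtie_plus n ?T" unfolding bowtie_plus_def using bD nM
        by (intro conjI exI[of _ D] exI[of _ ?M]) auto
      then show ?thesis using bowtie_plus_not_mono_obs fin unfolding admissible_def by blast
    qed
    have "V = K \<union> ?T" using comps_subset[OF K(1)] by blast
    moreover have "k = 2 + n - 1" using mn(3) m2 by simp
    moreover have "admissible 2 K" using bS unfolding admissible_def by blast
    ultimately show ?thesis using n1 adT noS comps_sep[OF K(1)]
      by (intro exI[of _ 2] exI[of _ n] exI[of _ K] exI[of _ ?T] conjI impI; simp)
  qed
qed

section \<open>From two admissible summands to an obstruction\<close>

lemma mpol_singleton [simp]: "mpol {x} = 0"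
  using mpol_eq_0_iff irrefl unfolding indep_def by simp

lemma mono_obs_no_isolated:
  assumes "mono_obs k S" "finite S" shows "no_isolated S"
  unfolding no_isolated_def
proof (intro ballI notI)
  fix K assume K: "K \<in> comps S" "card K = 1"
  then obtain x where x: "K = {x}" by (meson card_1_singletonE)
  then have "mpol S = mpol (S - K)" using mpol_remove_comp[OF K(1) assms(2)] by simp
  moreover have "S - K \<subset> S" using x comps_subset[OF K(1)] by blast
  ultimately show False using assms(1) unfolding mono_obs_def by metis
qed

text \<open>Some deletion costs at most one, so the value exceeds \<open>k\<close> by exactly one.
  No induced P3 has to survive here, and components of value at most 1 allow any vertex.\<close>

lemma mono_obs_mpol:
  assumes "mono_obs k S" "finite S" "p4_free S" "mpol S \<noteq> \<infinity>"
  shows "mpol S = enat (Suc k)"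
proof -
  have "S \<noteq> {}" using assms(1) unfolding mono_obs_def by auto
  then obtain K where K: "K \<in> comps S" using comps_exists by blast
  have fK: "finite K" using finite_subset[OF comps_subset[OF K] assms(2)] .
  have "\<exists>v\<in>K. mpol K \<le> mpol (K - {v}) + 1"
  proof (cases "mpol K \<le> 1")
    case True
    then show ?thesis using comps_nonempty[OF K] by (metis add_increasing ex_in_conv zero_le)
  next
    case False
    have "\<not> clustered K"
    proof
      assume "clustered K"
      then have "clique K" using conn_clusteredD comps_conn[OF K] by blast
      then show False using mpol_le_1_iff[OF fK] False unfolding indep_def by auto
    qed
    \<comment> \<open>A P3 consists of an edge and one more vertex, so it is split and its value is
      at most 1.\<close>
    moreover have "card K \<noteq> 3"
    proof
      assume c: "card K = 3"
      obtain x y z where xyz: "x \<in> K" "y \<in> K" "z \<in> K" "E x y" "E y z" "x \<noteq> z" "\<not> E x z"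
        using \<open>\<not> clustered K\<close> by (rule not_clusteredE)
      have ne: "x \<noteq> y" "y \<noteq> z" using xyz(4,5) irrefl by auto
      then have "card {x, y, z} = card K" using xyz(6) c by simp
      then have "K = {x, y, z}" using card_subset_eq[OF fK, of "{x, y, z}"] xyz(1-3) by simp
      then have "K - {x, y} = {z}" using ne xyz(6) by auto
      then have "indep (K - {x, y})" using irrefl unfolding indep_def by simp
      moreover have "clique {x, y}" using xyz(4) sym unfolding clique_def by auto
      moreover have "{x, y} \<subseteq> K" using xyz(1,2) by simp
      ultimately show False using mpol_le_1_iff[OF fK] False by metis
    qed
    moreover obtain n where "mpol K = enat n"
      using mpol_mono[OF comps_subset[OF K] assms(2)] assms(4) by (cases "mpol K") auto
    ultimately show ?thesis
      using mpol_remove_nearly_critical[OF fK p4_free_mono[OF assms(3) comps_subset[OF K]] comps_conn[OF K]]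
      by blast
  qed
  then obtain v where v: "v \<in> K" "mpol K \<le> mpol (K - {v}) + 1" by blast
  have "mpol S = mpol K + mpol (S - K)" using mpol_remove_comp[OF K assms(2)] .
  also have "\<dots> \<le> (mpol (K - {v}) + 1) + mpol (S - K)" using v(2) by (rule add_right_mono)
  also have "\<dots> = mpol (S - {v}) + 1"
    using mpol_remove_vertex_of_comp[OF K v(1) assms(2)] by (simp add: ac_simps)
  also have "\<dots> \<le> enat k + 1"
    using assms(1) v(1) comps_subset[OF K] unfolding mono_obs_def by (intro add_right_mono) blast
  finally have "mpol S \<le> enat (Suc k)" by (simp add: one_enat_def)
  moreover have "\<not> mpol S \<le> enat k" using assms(1) unfolding mono_obs_def by blast
  ultimately show ?thesis by (cases "mpol S") auto
qed

text \<open>A clique with at least three vertices keeps value 1 after a deletion, so minimality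
  leaves only edges. The exception \<open>k_i K_2\<close> in condition (3) is therefore the
  exclusion of all clusters.\<close>

lemma mono_obs_clustered_matching:
  assumes "mono_obs k S" "finite S" "p4_free S" "clustered S"
  shows "matching (Suc k) S"
proof -
  have ni: "no_isolated S" using mono_obs_no_isolated[OF assms(1,2)] .
  have mS: "mpol S = enat (ncomps S)" using mpol_clustered[OF assms(4) ni assms(2)] .
  then have "ncomps S = Suc k" using mono_obs_mpol[OF assms(1-3)] by simp
  moreover have "card K = 2" if K: "K \<in> comps S" for K
  proof (rule ccontr)
    assume c: "card K \<noteq> 2"
    have fK: "finite K" using finite_subset[OF comps_subset[OF K] assms(2)] .
    have "card K \<noteq> 1" using ni K unfolding no_isolated_def by blast
    moreover have "card K \<noteq> 0" using fK comps_nonempty[OF K] by simp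
    ultimately have c3: "card K \<ge> 3" using c by linarith
    obtain v where v: "v \<in> K" using comps_nonempty[OF K] by blast
    have cl: "clique K" using comps_clique[OF assms(4) K] .
    have cv: "card (K - {v}) \<ge> 2" using c3 v fK by simp
    then have "K - {v} \<noteq> {}" by (metis card.empty not_numeral_le_zero)
    then have "mpol (K - {v}) = 1" using cv fK clique_mono[OF cl] by (intro clique_mpol) auto
    moreover have "mpol K = 1" using \<open>card K \<noteq> 1\<close> comps_nonempty[OF K] by (intro clique_mpol[OF cl fK])
    ultimately have "mpol (S - {v}) = mpol S"
      using mpol_remove_vertex_of_comp[OF K v assms(2)] mpol_remove_comp[OF K assms(2)] by simp
    moreover have "S - {v} \<subset> S" using v comps_subset[OF K] by blast
    ultimately show False using assms(1) unfolding mono_obs_def by metis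
  qed
  ultimately show ?thesis using assms(4) unfolding matching_def by blast
qed

lemma bowtie_plus_facts:
  assumes "bowtie_plus n S" "finite S"
  shows "mpol S = enat n" "\<not> clustered S" "no_isolated S"
proof -
  obtain C M where S: "S = C \<union> M" "C \<inter> M = {}" "sep C M" "bowtie C" "matching (n - 2) M" "n \<ge> 2"
    using assms(1) unfolding bowtie_plus_def by blast
  have fin: "finite C" "finite M" using assms(2) S(1) by auto
  note C = bowtie_facts[OF S(4) fin(1)]
  have "mpol S = 2 + enat (n - 2)"
    using mpol_Un[OF fin S(3,2)] S(1) matching_mpol[OF S(5) fin(2)] C(3) by simp
  then show "mpol S = enat n" using S(6) by (simp add: numeral_eq_enat)
  show "\<not> clustered S" using C(2) S(1) clustered_mono by blast
  have "card C \<noteq> 1"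
  proof
    assume "card C = 1"
    then obtain x where "C = {x}" by (meson card_1_singletonE)
    then show False using C(2) unfolding clustered_def by simp
  qed
  then show "no_isolated S"
    using comps_Un[OF S(3)] comps_conn_eq[OF C(1)] S(1) matching_no_isolated[OF S(5)]
    unfolding no_isolated_def by auto
qed

text \<open>Both alternatives have \<open>mpol\<close> exactly \<open>n\<close>. By additivity the
  two summands together have value \<open>k1 + k2\<close>, one more than the bound they
  obstruct.\<close>

lemma admissible_facts:
  assumes "admissible n S" "finite S" "p4_free S" "n \<ge> 1"
  shows "mpol S = enat n" "\<not> clustered S" "no_isolated S"
proof -
  have "mpol S = enat n \<and> \<not> clustered S \<and> no_isolated S"
  proof (cases "bowtie_plus n S")
    case True
    then show ?thesis using bowtie_plus_facts assms(2) by blast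
  next
    case False
    then have "mono_obs (n - 1) S" "mpol S \<noteq> \<infinity>" "\<not> clustered S"
      using assms(1) unfolding admissible_def by auto
    then show ?thesis using mono_obs_mpol mono_obs_no_isolated assms(2-4) by fastforce
  qed
  then show "mpol S = enat n" "\<not> clustered S" "no_isolated S" by auto
qed

lemma pol_Un_matching:
  assumes "finite C" "finite M" "p4_free C" "conn C" "mpol C = enat n" "n \<ge> 2" "sep C M" "C \<inter> M = {}"
    and "matching m M"
  shows "pol (C \<union> M) \<le> enat (n + m - 1)"
proof -
  have "pol (C \<union> M) \<le> pol C + enat m"
    using pol_Un_clustered[OF assms(1,2,7,8)] assms(9) unfolding matching_def by blast
  also have "\<dots> \<le> enat (n - 1) + enat m"
    using conn_pol_less_mpol[OF assms(1,3-6)] by (rule add_right_mono)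
  finally show ?thesis using assms(6) by simp
qed

text \<open>The saving that is required once the other summand has become a cluster. The only
  noncomplete component has value at least 2 and saves one clique by
  \<open>conn_pol_less_mpol\<close>, while the edges beside it go to the cluster. The last
  hypothesis is condition (4).\<close>

lemma admissible_pol_less:
  assumes "admissible n T" "finite T" "p4_free T" "n \<ge> 1"
    and "mono_obs (n - 1) T \<Longrightarrow> \<exists>!K. K \<in> comps T \<and> card K \<noteq> 2"
  shows "pol T \<le> enat (n - 1)"
proof (cases "bowtie_plus n T")
  case True
  then obtain C M where S: "T = C \<union> M" "C \<inter> M = {}" "sep C M" "bowtie C" "matching (n - 2) M" "n \<ge> 2"
    unfolding bowtie_plus_def by blast
  have fin: "finite C" "finite M" using assms(2) S(1) by auto
  note C = bowtie_facts[OF S(4) fin(1)]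
  have "p4_free C" using p4_free_mono[OF assms(3)] S(1) by blast
  then have "pol (C \<union> M) \<le> enat (Suc (n - 2))"
    using pol_Un_matching[OF fin _ C(1) _ _ S(3,2,5), of 2] C(3) by (simp add: numeral_eq_enat)
  moreover have "Suc (n - 2) = n - 1" using S(6) by simp
  ultimately show ?thesis using S(1) by simp
next
  case False
  then have o: "mono_obs (n - 1) T" using assms(1) unfolding admissible_def by auto
  note T = admissible_facts[OF assms(1-4)]
  obtain C where C: "C \<in> comps T" "\<And>K. K \<in> comps T \<Longrightarrow> K \<noteq> C \<Longrightarrow> card K = 2"
    using assms(5)[OF o] by metis
  let ?M = "T - C"
  have cM: "comps ?M = comps T - {C}" using comps_remove_comp_diff[OF C(1)] .
  have c2: "clustered K" if "card K = 2" for K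
  proof -
    obtain x y where "K = {x, y}" using \<open>card K = 2\<close> by (meson card_2_iff)
    then show ?thesis using irrefl unfolding clustered_def by auto
  qed
  have K2: "card K = 2" if "K \<in> comps ?M" for K using that C(2) unfolding cM by blast
  have "clustered ?M"
  proof (rule clustered_by_comps)
    show "clustered K" if "K \<in> comps ?M" for K using c2[OF K2[OF that]] .
  qed
  then have M: "matching (ncomps ?M) ?M" unfolding matching_def using K2 by blast
  have fC: "finite C" "finite ?M" using finite_subset[OF comps_subset[OF C(1)] assms(2)] assms(2) by auto
  have nC: "\<not> clustered C"
  proof
    assume "clustered C"
    then have "clustered K" if "K \<in> comps T" for K using that C(2) c2 by blast
    then show False using clustered_by_comps T(2) by blast
  qed
  have "mpol T = mpol C + enat (ncomps ?M)"
    using mpol_remove_comp[OF C(1) assms(2)] matching_mpol[OF M fC(2)] by simp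
  then obtain m where m: "mpol C = enat m" "m + ncomps ?M = n" using T(1) by (cases "mpol C") auto
  have "m \<ge> 1" using not_clustered_mpol_ge_1[OF fC(1) nC] m(1) by (simp add: one_enat_def)
  \<comment> \<open>With \<open>m = 1\<close>, deleting the end \<open>z\<close> of an induced path
    \<open>x y z\<close> would have to lower the value of \<open>C\<close> to 0, but the edge
    \<open>x y\<close> survives.\<close>
  moreover have "m \<noteq> 1"
  proof
    assume m1: "m = 1"
    obtain x y z where xyz: "x \<in> C" "y \<in> C" "z \<in> C" "E x y" "E y z" "x \<noteq> z" "\<not> E x z"
      using nC by (rule not_clusteredE)
    have "z \<in> T" using xyz(3) comps_subset[OF C(1)] by blast
    then have "mpol (T - {z}) \<le> enat (n - 1)" using o unfolding mono_obs_def by blast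
    then have "mpol (C - {z}) + enat (ncomps ?M) \<le> enat (ncomps ?M)"
      using mpol_remove_vertex_of_comp[OF C(1) xyz(3) assms(2)] matching_mpol[OF M fC(2)] m(2) m1 by auto
    then have "mpol (C - {z}) = 0" by (cases "mpol (C - {z})") (auto simp: zero_enat_def)
    then have "indep (C - {z})" using mpol_eq_0_iff fC(1) by blast
    moreover have "y \<noteq> z" using xyz(5) irrefl by auto
    ultimately show False using xyz(1,2,4,6) unfolding indep_def by blast
  qed
  ultimately have m2: "m \<ge> 2" by linarith
  have "C \<union> ?M = T" using comps_subset[OF C(1)] by blast
  then show ?thesis
    using pol_Un_matching[OF fC p4_free_mono[OF assms(3) comps_subset[OF C(1)]] comps_conn[OF C(1)] m(1) m2
        comps_sep[OF C(1)] _ M] m(2) by auto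
qed

lemma matching_remove:
  assumes "matching n M" "finite M" "v \<in> M" shows "mpol (M - {v}) + 1 = enat n"
proof -
  obtain K where K: "K \<in> comps M" "v \<in> K" using assms(3) by (rule comps_exists)
  have "card K = 2" using K assms(1) unfolding matching_def by blast
  then obtain w where w: "K = {v, w}" "v \<noteq> w" using K(2) by (auto simp: card_2_iff)
  have "clique K" using comps_clique[OF _ K(1)] assms(1) unfolding matching_def by blast
  then have "mpol K = 1" using w \<open>card K = 2\<close> by (intro clique_mpol) auto
  moreover have "K - {v} = {w}" using w by auto
  ultimately show ?thesis
    using mpol_remove_vertex_of_comp[OF K assms(2)] mpol_remove_comp[OF K(1) assms(2)]
      matching_mpol[OF assms(1,2)] by (simp add: add.commute)
qed

text \<open>Deleting a vertex \<open>v\<close> of an edge \<open>{v, w}\<close> leaves the triangle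
  formed by the centre and the other edge, and the single vertex \<open>w\<close>: a split graph. So
  only the deletion of the centre can keep the value.\<close>

lemma bowtie_remove:
  assumes "bowtie C" "finite C" "v \<in> C" "\<not> mpol (C - {v}) \<le> 1"
  shows "matching 2 (C - {v})"
proof -
  obtain c Y where cY: "C = insert c Y" "c \<notin> Y" "joined {c} Y" "matching 2 Y" "finite Y" "mpol Y = 2"
    using bowtieE[OF assms(1,2)] by blast
  have "v = c"
  proof (rule ccontr)
    assume "v \<noteq> c"
    then have "v \<in> Y" using assms(3) cY(1) by blast
    then obtain K where K: "K \<in> comps Y" "v \<in> K" by (rule comps_exists)
    have Y: "clustered Y" "card (comps Y) = 2" "\<And>L. L \<in> comps Y \<Longrightarrow> card L = 2"
      using cY(4) unfolding matching_def ncomps_def by auto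
    obtain L where L: "comps Y = {K, L}" "K \<noteq> L"
      using Y(2) K(1) unfolding card_2_iff by (metis insertE insert_commute singletonD)
    obtain w where w: "K = {v, w}" "v \<noteq> w" using Y(3)[OF K(1)] K(2) by (auto simp: card_2_iff)
    have YKL: "Y = K \<union> L" using Union_comps[of Y] L(1) by auto
    have dj: "K \<inter> L = {}" using comps_eq[OF K(1), of L] L by auto
    have cl: "clique (insert c L)"
      using comps_clique[OF Y(1), of L] L(1) cY(3) YKL sym
      unfolding clique_def joined_def by auto
    have "C - {v} - insert c L = {w}" using cY(1,2) YKL w dj by auto
    then have "indep (C - {v} - insert c L)" using irrefl unfolding indep_def by simp
    moreover have "insert c L \<subseteq> C - {v}" using cY(1) YKL dj w \<open>v \<noteq> c\<close> by blast
    ultimately have "mpol (C - {v}) \<le> 1" using mpol_le_1_iff[of "C - {v}"] cl assms(2) by blast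
    then show False using assms(4) by blast
  qed
  then show ?thesis using cY(1,2,4) by simp
qed

text \<open>A deletion that lowers \<open>mpol S\<close> is settled by additivity. Otherwise
  \<open>v\<close> is the centre of a bowtie, \<open>S - {v}\<close> consists of \<open>k1\<close>
  disjoint edges and goes to the cluster, and \<open>T\<close> saves one clique by
  \<open>admissible_pol_less\<close>.\<close>

lemma pol_remove_from_summand:
  assumes "finite S" "finite T" "p4_free S" "p4_free T" "sep S T" "S \<inter> T = {}"
    and "k1 \<ge> 1" "k2 \<ge> 1" "admissible k1 S" "admissible k2 T"
    and "bowtie_plus k1 S \<Longrightarrow> mono_obs (k2 - 1) T \<Longrightarrow> \<exists>!K. K \<in> comps T \<and> card K \<noteq> 2"
    and "v \<in> S"
  shows "pol (S \<union> T - {v}) \<le> enat (k1 + k2 - 1)"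
proof -
  have e: "S \<union> T - {v} = (S - {v}) \<union> T" using assms(6,12) by blast
  have s: "sep (S - {v}) T" by (rule sep_mono[OF assms(5)]) auto
  have d: "(S - {v}) \<inter> T = {}" using assms(6) by blast
  have mT: "mpol T = enat k2" using admissible_facts[OF assms(10,2,4,8)] by blast
  show ?thesis
  proof (cases "mpol (S - {v}) \<le> enat (k1 - 1)")
    case True
    have "pol (S \<union> T - {v}) \<le> mpol (S - {v}) + mpol T"
      using pol_le_mpol[of "S \<union> T - {v}"] mpol_Un[OF _ assms(2) s d] assms(1) e by simp
    also have "\<dots> \<le> enat (k1 - 1) + enat k2" using True mT by (intro add_mono) auto
    finally show ?thesis using assms(7) by simp
  next
    case False
    then have "\<not> mono_obs (k1 - 1) S" using assms(12) unfolding mono_obs_def by blast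
    then have b: "bowtie_plus k1 S" using assms(9) unfolding admissible_def by blast
    then obtain C M where S: "S = C \<union> M" "C \<inter> M = {}" "sep C M" "bowtie C" "matching (k1 - 2) M" "k1 \<ge> 2"
      unfolding bowtie_plus_def by blast
    have fin: "finite C" "finite M" using assms(1) S(1) by auto
    note C = bowtie_facts[OF S(4) fin(1)]
    have mM: "mpol M = enat (k1 - 2)" using matching_mpol[OF S(5) fin(2)] .
    \<comment> \<open>Deleting an end of a matching edge leaves an isolated vertex in its place and
      lowers the value by one.\<close>
    have vC: "v \<in> C"
    proof (rule ccontr)
      assume "v \<notin> C"
      then have v: "v \<in> M" "S - {v} = C \<union> (M - {v})" using assms(12) S(1) by blast+
      moreover have "sep C (M - {v})" by (rule sep_mono[OF S(3)]) auto
      moreover have "C \<inter> (M - {v}) = {}" using S(2) by blast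
      ultimately have "mpol (S - {v}) + 1 = 2 + (mpol (M - {v}) + 1)"
        using mpol_Un[of C "M - {v}"] fin C(3) by (simp add: ac_simps)
      also have "\<dots> = enat k1" using matching_remove[OF S(5) fin(2) v(1)] S(6) by (simp add: numeral_eq_enat)
      finally have "mpol (S - {v}) + 1 = enat k1" .
      then show False using False by (cases "mpol (S - {v})") (auto simp: one_enat_def)
    qed
    then have Sv: "S - {v} = (C - {v}) \<union> M" using S(1,2) by blast
    have s': "sep (C - {v}) M" by (rule sep_mono[OF S(3)]) auto
    have d': "(C - {v}) \<inter> M = {}" using S(2) by blast
    have "\<not> mpol (C - {v}) \<le> 1"
    proof
      assume "mpol (C - {v}) \<le> 1"
      then have "mpol (C - {v}) + mpol M \<le> 1 + enat (k1 - 2)" using mM by (intro add_mono) auto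
      then have "mpol (S - {v}) \<le> 1 + enat (k1 - 2)"
        using mpol_Un[OF _ fin(2) s' d'] fin(1) Sv by simp
      moreover have "1 + enat (k1 - 2) = enat (k1 - 1)" using S(6) by (simp add: one_enat_def)
      ultimately show False using False by simp
    qed
    then have "matching 2 (C - {v})" using bowtie_remove[OF S(4) fin(1) vC] by blast
    then have "matching (2 + (k1 - 2)) (C - {v} \<union> M)"
      using fin by (intro matching_Un[OF _ S(5) s' d']) auto
    moreover have "2 + (k1 - 2) = k1" using S(6) by simp
    ultimately have mS: "matching k1 (S - {v})" using Sv by metis
    have "sep T (S - {v})" "T \<inter> (S - {v}) = {}" using s sep_commute d by blast+
    then have "pol (T \<union> (S - {v})) \<le> pol T + enat k1"
      using pol_Un_clustered[of T "S - {v}"] mS assms(1,2) unfolding matching_def by auto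
    also have "\<dots> \<le> enat (k2 - 1) + enat k1"
      using admissible_pol_less[OF assms(10,2,4,8) assms(11)[OF b]] by (rule add_right_mono)
    finally have "pol (T \<union> (S - {v})) \<le> enat (k1 + k2 - 1)" using assms(8) by (simp add: add.commute)
    then show ?thesis using e by (simp add: Un_commute)
  qed
qed

text \<open>Neither summand is a cluster, so \<open>pol\<close> of the union equals
  \<open>mpol\<close>, which is \<open>k1 + k2\<close>. By monotonicity single deletions suffice for
  minimality, and the two summands are symmetric.\<close>

lemma admissible_polar_obs:
  assumes "finite S" "finite T" "p4_free S" "p4_free T" "sep S T" "S \<inter> T = {}"
    and "k1 \<ge> 1" "k2 \<ge> 1" "admissible k1 S" "admissible k2 T"
    and "bowtie_plus k1 S \<Longrightarrow> mono_obs (k2 - 1) T \<Longrightarrow> \<exists>!K. K \<in> comps T \<and> card K \<noteq> 2"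
    and "bowtie_plus k2 T \<Longrightarrow> mono_obs (k1 - 1) S \<Longrightarrow> \<exists>!K. K \<in> comps S \<and> card K \<noteq> 2"
  shows "polar_obs (k1 + k2 - 1) (S \<union> T)" "\<not> conn (S \<union> T)" "no_isolated (S \<union> T)"
proof -
  note S = admissible_facts[OF assms(9,1,3,7)] and T = admissible_facts[OF assms(10,2,4,8)]
  have ne: "S \<noteq> {}" "T \<noteq> {}" using S(2) T(2) unfolding clustered_def by auto
  show "\<not> conn (S \<union> T)" using conn_subset_Un[OF _ _ assms(5)] ne assms(6) by blast
  show "no_isolated (S \<union> T)" using S(3) T(3) comps_Un[OF assms(5)] unfolding no_isolated_def by auto
  have "pol (S \<union> T) = enat k1 + enat k2"
    using pol_Un_nonclustered[OF assms(5) S(2) T(2)] mpol_Un[OF assms(1,2,5,6)] S(1) T(1) by simp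
  then have "\<not> pol (S \<union> T) \<le> enat (k1 + k2 - 1)" using assms(7,8) by simp
  moreover have "pol U \<le> enat (k1 + k2 - 1)" if U: "U \<subset> S \<union> T" for U
  proof -
    obtain v where v: "v \<in> S \<union> T" "U \<subseteq> S \<union> T - {v}" using U by blast
    have "pol (S \<union> T - {v}) \<le> enat (k1 + k2 - 1)"
    proof (cases "v \<in> S")
      case True
      then show ?thesis using pol_remove_from_summand[OF assms(1-11)] by blast
    next
      case False
      then have vT: "v \<in> T" using v(1) by blast
      have st: "sep T S" "T \<inter> S = {}" using assms(5,6) sep_commute by blast+
      show ?thesis
        using pol_remove_from_summand[OF assms(2,1,4,3) st assms(8,7,10,9,12) vT]
        by (simp add: Un_commute add.commute)
    qed
    moreover have "pol U \<le> pol (S \<union> T - {v})" using v(2) assms(1,2) by (intro pol_mono) auto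
    ultimately show ?thesis by (rule order_trans[rotated])
  qed
  ultimately show "polar_obs (k1 + k2 - 1) (S \<union> T)" unfolding polar_obs_def by blast
qed

end

section \<open>Isomorphism with the named graphs\<close>

lemma map_prod_sum_image:
  "(Inl u, Inl v) \<in> map_prod Inl Inl ` R \<longleftrightarrow> (u, v) \<in> R"
  "(Inr x, Inr y) \<in> map_prod Inr Inr ` T \<longleftrightarrow> (x, y) \<in> T"
  "(Inr x, q) \<notin> map_prod Inl Inl ` R" "(p, Inr y) \<notin> map_prod Inl Inl ` R"
  "(Inl u, q') \<notin> map_prod Inr Inr ` T" "(p', Inl v) \<notin> map_prod Inr Inr ` T"
  by force+

lemma bij_betw_inj_comp:
  assumes "inj_on f V" "h ` A \<subseteq> V" "inj_on h A"
  shows "bij_betw (\<lambda>u. f (h u)) A (f ` h ` A)"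
  unfolding bij_betw_def
  using comp_inj_on[OF assms(3) inj_on_subset[OF assms(1,2)]] by (simp add: comp_def image_image)

context sgraph begin

text \<open>Isomorphism of \<open>H\<close> with the graph induced on \<open>S\<close>. The map
  starts at \<open>H\<close>, whose vertex type is arbitrary, and arcs are compared through their
  ends only.\<close>

definition realizes :: "('c, 'd) pre_digraph \<Rightarrow> 'a set \<Rightarrow> bool" where
  "realizes H S \<longleftrightarrow> (\<exists>\<psi>. bij_betw \<psi> (verts H) S \<and>
     (\<forall>u\<in>verts H. \<forall>v\<in>verts H. (u, v) \<in> arcs_ends H \<longleftrightarrow> E (\<psi> u) (\<psi> v)))"

lemma realizes_card: "realizes H S \<Longrightarrow> card S = card (verts H)"
  unfolding realizes_def using bij_betw_same_card by metis

text \<open>The truth value \<open>j\<close> is the adjacency across the two sides: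
  \<open>False\<close> gives the disjoint sum and \<open>True\<close> the join.\<close>

lemma realizes_two_sided:
  assumes "verts H = Inl ` verts A \<union> Inr ` verts B"
    and "\<And>u v. (Inl u, Inl v) \<in> arcs_ends H \<longleftrightarrow> (u, v) \<in> arcs_ends A"
    and "\<And>u v. (Inr u, Inr v) \<in> arcs_ends H \<longleftrightarrow> (u, v) \<in> arcs_ends B"
    and "\<And>u v. u \<in> verts A \<Longrightarrow> v \<in> verts B \<Longrightarrow> (Inl u, Inr v) \<in> arcs_ends H \<longleftrightarrow> j"
    and "\<And>u v. u \<in> verts A \<Longrightarrow> v \<in> verts B \<Longrightarrow> (Inr v, Inl u) \<in> arcs_ends H \<longleftrightarrow> j"
  shows "realizes H S \<longleftrightarrow>
     (\<exists>S1 S2. S = S1 \<union> S2 \<and> S1 \<inter> S2 = {} \<and> (\<forall>x\<in>S1. \<forall>y\<in>S2. E x y \<longleftrightarrow> j) \<and> realizes A S1 \<and> realizes B S2)"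
  (is "?L \<longleftrightarrow> ?R")
proof
  assume ?L
  then obtain \<psi> where b: "bij_betw \<psi> (Inl ` verts A \<union> Inr ` verts B) S"
    and e: "\<forall>u\<in>Inl ` verts A \<union> Inr ` verts B. \<forall>v\<in>Inl ` verts A \<union> Inr ` verts B.
      (u, v) \<in> arcs_ends H \<longleftrightarrow> E (\<psi> u) (\<psi> v)"
    unfolding realizes_def assms(1) by blast
  have inj: "inj_on \<psi> (Inl ` verts A \<union> Inr ` verts B)" using b bij_betw_def by blast
  have bA: "bij_betw (\<lambda>u. \<psi> (Inl u)) (verts A) (\<psi> ` Inl ` verts A)"
    by (rule bij_betw_inj_comp[OF inj]) auto
  have bB: "bij_betw (\<lambda>u. \<psi> (Inr u)) (verts B) (\<psi> ` Inr ` verts B)"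
    by (rule bij_betw_inj_comp[OF inj]) auto
  have "realizes A (\<psi> ` Inl ` verts A)"
    unfolding realizes_def using bA e by (intro exI[of _ "\<lambda>u. \<psi> (Inl u)"]) (simp add: assms(2)[symmetric])
  moreover have "realizes B (\<psi> ` Inr ` verts B)"
    unfolding realizes_def using bB e by (intro exI[of _ "\<lambda>u. \<psi> (Inr u)"]) (simp add: assms(3)[symmetric])
  moreover have "\<forall>x\<in>\<psi> ` Inl ` verts A. \<forall>y\<in>\<psi> ` Inr ` verts B. E x y \<longleftrightarrow> j"
  proof (intro ballI)
    fix x y assume "x \<in> \<psi> ` Inl ` verts A" "y \<in> \<psi> ` Inr ` verts B"
    then obtain u v where uv: "u \<in> verts A" "x = \<psi> (Inl u)" "v \<in> verts B" "y = \<psi> (Inr v)" by blast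
    have "(Inl u, Inr v) \<in> arcs_ends H \<longleftrightarrow> E x y" using e uv by blast
    then show "E x y \<longleftrightarrow> j" using assms(4)[OF uv(1,3)] by simp
  qed
  moreover have "\<psi> ` Inl ` verts A \<inter> \<psi> ` Inr ` verts B = {}"
    by (subst inj_on_image_Int[OF inj, symmetric]) auto
  moreover have "S = \<psi> ` Inl ` verts A \<union> \<psi> ` Inr ` verts B"
    using b by (auto simp: bij_betw_def)
  ultimately show ?R by blast
next
  assume ?R
  then obtain S1 S2 where S: "S = S1 \<union> S2" "S1 \<inter> S2 = {}" "\<forall>x\<in>S1. \<forall>y\<in>S2. E x y \<longleftrightarrow> j"
    and r: "realizes A S1" "realizes B S2" by blast
  obtain \<psi>1 where b1: "bij_betw \<psi>1 (verts A) S1"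
    and e1: "\<forall>u\<in>verts A. \<forall>v\<in>verts A. (u, v) \<in> arcs_ends A \<longleftrightarrow> E (\<psi>1 u) (\<psi>1 v)"
    using r(1) unfolding realizes_def by blast
  obtain \<psi>2 where b2: "bij_betw \<psi>2 (verts B) S2"
    and e2: "\<forall>u\<in>verts B. \<forall>v\<in>verts B. (u, v) \<in> arcs_ends B \<longleftrightarrow> E (\<psi>2 u) (\<psi>2 v)"
    using r(2) unfolding realizes_def by blast
  let ?\<psi> = "case_sum \<psi>1 \<psi>2"
  have n: "E (\<psi>1 u) (\<psi>2 v) \<longleftrightarrow> j" "E (\<psi>2 v) (\<psi>1 u) \<longleftrightarrow> j" if "u \<in> verts A" "v \<in> verts B" for u v
  proof -
    have "\<psi>1 u \<in> S1" "\<psi>2 v \<in> S2" using b1 b2 that bij_betwE by blast+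
    then show "E (\<psi>1 u) (\<psi>2 v) \<longleftrightarrow> j" "E (\<psi>2 v) (\<psi>1 u) \<longleftrightarrow> j" using S(3) sym by blast+
  qed
  have "bij_betw ?\<psi> (Inl ` verts A) S1" "bij_betw ?\<psi> (Inr ` verts B) S2"
    using b1 b2 by (auto simp: bij_betw_def inj_on_def image_image)
  then have "bij_betw ?\<psi> (verts H) S"
    unfolding assms(1) using bij_betw_combine S(1,2) by blast
  moreover have "\<forall>u\<in>verts H. \<forall>v\<in>verts H. (u, v) \<in> arcs_ends H \<longleftrightarrow> E (?\<psi> u) (?\<psi> v)"
    unfolding assms(1) using e1 e2 n assms(2-5) by auto
  ultimately show ?L unfolding realizes_def by blast
qed

lemma realizes_disjoint_sum:
  "realizes (disjoint_sum A B) S \<longleftrightarrow>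
     (\<exists>S1 S2. S = S1 \<union> S2 \<and> S1 \<inter> S2 = {} \<and> sep S1 S2 \<and> realizes A S1 \<and> realizes B S2)"
proof -
  have "realizes (disjoint_sum A B) S \<longleftrightarrow> (\<exists>S1 S2. S = S1 \<union> S2 \<and> S1 \<inter> S2 = {} \<and>
      (\<forall>x\<in>S1. \<forall>y\<in>S2. E x y \<longleftrightarrow> False) \<and> realizes A S1 \<and> realizes B S2)"
    by (rule realizes_two_sided) (auto simp: disjoint_sum_def map_prod_sum_image)
  then show ?thesis unfolding sep_def by simp
qed

lemma realizes_graph_join:
  "realizes (graph_join A B) S \<longleftrightarrow>
     (\<exists>S1 S2. S = S1 \<union> S2 \<and> joined S1 S2 \<and> realizes A S1 \<and> realizes B S2)"
proof -
  have "realizes (graph_join A B) S \<longleftrightarrow> (\<exists>S1 S2. S = S1 \<union> S2 \<and> S1 \<inter> S2 = {} \<and>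
      (\<forall>x\<in>S1. \<forall>y\<in>S2. E x y \<longleftrightarrow> True) \<and> realizes A S1 \<and> realizes B S2)"
    by (rule realizes_two_sided) (auto simp: graph_join_def map_prod_sum_image)
  moreover have "S1 \<inter> S2 = {}" if "joined S1 S2" for S1 S2
    using that irrefl unfolding joined_def by blast
  ultimately show ?thesis unfolding joined_def by (metis (no_types, lifting))
qed

lemma verts_complete_graph [simp]: "verts (complete_graph n) = {..<n}"
  and arcs_ends_complete_graph [simp]:
    "arcs_ends (complete_graph n) = {(i, j). i < n \<and> j < n \<and> i \<noteq> j}"
  unfolding complete_graph_def by simp_all

lemma verts_copies [simp]: "verts (copies n H) = {..<n} \<times> verts H"
  and arcs_ends_copies [simp]:
    "arcs_ends (copies n H) = {((i, u), (j, v)). i < n \<and> i = j \<and> (u, v) \<in> arcs_ends H}"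
  unfolding copies_def by simp_all

lemma realizes_complete_graph_1: "realizes (complete_graph 1) S \<longleftrightarrow> (\<exists>x. S = {x})"
proof
  assume "realizes (complete_graph 1) S"
  then show "\<exists>x. S = {x}" using realizes_card[of "complete_graph 1" S] by (simp add: card_1_singleton_iff)
next
  assume "\<exists>x. S = {x}"
  then obtain x where "S = {x}" by blast
  then show "realizes (complete_graph 1) S"
    unfolding realizes_def using irrefl by (intro exI[of _ "\<lambda>_. x"]) (auto simp: bij_betw_def inj_on_def)
qed

lemma realizes_complete_graph_2: "realizes (complete_graph 2) S \<longleftrightarrow> (\<exists>x y. S = {x, y} \<and> E x y)"
proof
  assume "realizes (complete_graph 2) S"
  then obtain \<psi> where b: "bij_betw \<psi> {..<2::nat} S"
    and e: "\<And>u v. u < (2::nat) \<Longrightarrow> v < 2 \<Longrightarrow> u \<noteq> v \<longleftrightarrow> E (\<psi> u) (\<psi> v)"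
    unfolding realizes_def by auto
  have "{..<2::nat} = {0, 1}" by auto
  then have "S = {\<psi> 0, \<psi> 1}" using b by (auto simp: bij_betw_def)
  moreover have "E (\<psi> 0) (\<psi> 1)" using e[of 0 1] by simp
  ultimately show "\<exists>x y. S = {x, y} \<and> E x y" by blast
next
  assume "\<exists>x y. S = {x, y} \<and> E x y"
  then obtain x y where S: "S = {x, y}" "E x y" by blast
  have "x \<noteq> y" using S(2) irrefl by auto
  have "{..<2::nat} = {0, 1}" by auto
  then show "realizes (complete_graph 2) S"
    unfolding realizes_def using S sym[OF S(2)] irrefl \<open>x \<noteq> y\<close>
    by (intro exI[of _ "\<lambda>i. if i = 0 then x else y"]) (auto simp: bij_betw_def)
qed

text \<open>The last copy is split off, so that an induction can match copies with
  components.\<close>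

lemma realizes_copies_Suc:
  "realizes (copies (Suc n) H) S \<longleftrightarrow>
     (\<exists>S1 S2. S = S1 \<union> S2 \<and> S1 \<inter> S2 = {} \<and> sep S1 S2 \<and> realizes (copies n H) S1 \<and> realizes H S2)"
  (is "?L \<longleftrightarrow> ?R")
proof
  assume ?L
  then obtain \<psi> where b: "bij_betw \<psi> ({..<Suc n} \<times> verts H) S"
    and e: "\<And>i u j v. i < Suc n \<Longrightarrow> j < Suc n \<Longrightarrow> u \<in> verts H \<Longrightarrow> v \<in> verts H \<Longrightarrow>
      (i = j \<and> (u, v) \<in> arcs_ends H) \<longleftrightarrow> E (\<psi> (i, u)) (\<psi> (j, v))"
    unfolding realizes_def by auto
  have inj: "inj_on \<psi> ({..<Suc n} \<times> verts H)" using b bij_betw_def by blast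
  let ?S1 = "\<psi> ` ({..<n} \<times> verts H)" and ?S2 = "(\<lambda>u. \<psi> (n, u)) ` verts H"
  have "{..<n} \<times> verts H \<subseteq> {..<Suc n} \<times> verts H" by auto
  then have b1: "bij_betw \<psi> ({..<n} \<times> verts H) ?S1"
    using inj_on_subset[OF inj] by (simp add: bij_betw_def)
  have b2: "bij_betw (\<lambda>u. \<psi> (n, u)) (verts H) ?S2"
    using bij_betw_inj_comp[OF inj, of "Pair n" "verts H"] by (auto simp: image_image inj_on_def)
  have "sep ?S1 ?S2"
    unfolding sep_def
  proof (intro ballI notI)
    fix x y assume "x \<in> ?S1" "y \<in> ?S2" "E x y"
    then obtain i u v where "i < n" "u \<in> verts H" "v \<in> verts H" "E (\<psi> (i, u)) (\<psi> (n, v))" by auto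
    then show False using e[of i n u v] by simp
  qed
  moreover have "?S1 \<inter> ?S2 = {}"
  proof -
    have "\<psi> ` ({..<n} \<times> verts H) \<inter> \<psi> ` Pair n ` verts H = {}"
      by (subst inj_on_image_Int[OF inj, symmetric]) auto
    then show ?thesis by (simp add: image_image)
  qed
  moreover have "S = ?S1 \<union> ?S2"
  proof -
    have "{..<Suc n} \<times> verts H = {..<n} \<times> verts H \<union> Pair n ` verts H" by auto
    then have "\<psi> ` ({..<Suc n} \<times> verts H) = ?S1 \<union> ?S2" by (simp add: image_Un image_image)
    then show ?thesis using b by (simp add: bij_betw_def)
  qed
  moreover have "realizes (copies n H) ?S1"
    unfolding realizes_def using b1 e by (intro exI[of _ \<psi>]) auto
  moreover have "realizes H ?S2"
    unfolding realizes_def using b2 e[of n n] by (intro exI[of _ "\<lambda>u. \<psi> (n, u)"]) auto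
  ultimately show ?R by blast
next
  assume ?R
  then obtain S1 S2 where S: "S = S1 \<union> S2" "S1 \<inter> S2 = {}" "sep S1 S2"
    and r: "realizes (copies n H) S1" "realizes H S2" by blast
  obtain \<psi>1 where b1: "bij_betw \<psi>1 ({..<n} \<times> verts H) S1"
    and e1: "\<And>i u j v. i < n \<Longrightarrow> j < n \<Longrightarrow> u \<in> verts H \<Longrightarrow> v \<in> verts H \<Longrightarrow>
        (i = j \<and> (u, v) \<in> arcs_ends H) \<longleftrightarrow> E (\<psi>1 (i, u)) (\<psi>1 (j, v))"
    using r(1) unfolding realizes_def by auto
  obtain \<psi>2 where b2: "bij_betw \<psi>2 (verts H) S2"
    and e2: "\<forall>u\<in>verts H. \<forall>v\<in>verts H. (u, v) \<in> arcs_ends H \<longleftrightarrow> E (\<psi>2 u) (\<psi>2 v)"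
    using r(2) unfolding realizes_def by blast
  note b = b1 b2 and e = e1 e2
  let ?\<psi> = "\<lambda>p. if fst p < n then \<psi>1 p else \<psi>2 (snd p)"
  have m: "\<psi>1 (i, u) \<in> S1" if "i < n" "u \<in> verts H" for i u using b(1) that bij_betwE by blast
  have m': "\<psi>2 u \<in> S2" if "u \<in> verts H" for u using b(2) that bij_betwE by blast
  have nn: "\<not> E (\<psi>1 (i, u)) (\<psi>2 v)" "\<not> E (\<psi>2 v) (\<psi>1 (i, u))"
    if "i < n" "u \<in> verts H" "v \<in> verts H" for i u v
    using S(3) m[OF that(1,2)] m'[OF that(3)] sym unfolding sep_def by blast+
  have "bij_betw ?\<psi> ({..<n} \<times> verts H) S1"
    using b(1) bij_betw_cong[of "{..<n} \<times> verts H" ?\<psi> \<psi>1] by auto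
  moreover have "bij_betw ?\<psi> ({n} \<times> verts H) S2"
  proof -
    have "inj_on ?\<psi> ({n} \<times> verts H)" using b(2) by (auto simp: bij_betw_def inj_on_def)
    moreover have "?\<psi> ` ({n} \<times> verts H) = \<psi>2 ` verts H" by force
    ultimately show ?thesis using b(2) unfolding bij_betw_def by metis
  qed
  ultimately have "bij_betw ?\<psi> ({..<n} \<times> verts H \<union> {n} \<times> verts H) S"
    using bij_betw_combine S(1,2) by blast
  moreover have "{..<n} \<times> verts H \<union> {n} \<times> verts H = {..<Suc n} \<times> verts H" by auto
  ultimately have "bij_betw ?\<psi> ({..<Suc n} \<times> verts H) S" by simp
  moreover have "(i = j \<and> (u, v) \<in> arcs_ends H) \<longleftrightarrow> E (?\<psi> (i, u)) (?\<psi> (j, v))"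
    if "i < Suc n" "j < Suc n" "u \<in> verts H" "v \<in> verts H" for i j u v
    using e nn that by (cases "i < n"; cases "j < n") (auto simp: less_Suc_eq)
  ultimately show ?L unfolding realizes_def by (intro exI[of _ ?\<psi>]) auto
qed

lemma realizes_copies_0: "realizes (copies 0 H) S \<longleftrightarrow> S = {}"
  unfolding realizes_def by (auto simp: bij_betw_def)

lemma realizes_matching:
  "finite S \<Longrightarrow> realizes (copies n (complete_graph 2)) S \<longleftrightarrow> matching n S"
proof (induction n arbitrary: S)
  case 0
  then show ?case
    using ncomps_eq_0[OF 0] unfolding realizes_copies_0 matching_def clustered_def by auto
next
  case (Suc n)
  show ?case
  proof
    assume "realizes (copies (Suc n) (complete_graph 2)) S"
    then obtain S1 S2 where S: "S = S1 \<union> S2" "S1 \<inter> S2 = {}" "sep S1 S2"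
      "realizes (copies n (complete_graph 2)) S1" "realizes (complete_graph 2) S2"
      unfolding realizes_copies_Suc by blast
    have fin: "finite S1" "finite S2" using Suc.prems S(1) by auto
    have "matching n S1" using Suc.IH fin(1) S(4) by blast
    moreover have "matching 1 S2" using S(5) edge_matching unfolding realizes_complete_graph_2 by blast
    ultimately show "matching (Suc n) S" using matching_Un[OF _ _ S(3,2) fin] S(1) by fastforce
  next
    assume m: "matching (Suc n) S"
    then have "comps S \<noteq> {}" unfolding matching_def ncomps_def by auto
    then obtain K where K: "K \<in> comps S" by blast
    have fin: "finite (S - K)" using Suc.prems by simp
    have "clustered (S - K)" using m clustered_mono unfolding matching_def by blast
    then have "matching n (S - K)"
      using m comps_remove_comp[OF K] finite_comps[OF fin]
      unfolding matching_def ncomps_def by simp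
    then have "realizes (copies n (complete_graph 2)) (S - K)" using Suc.IH fin by blast
    moreover have "realizes (complete_graph 2) K"
    proof -
      have "card K = 2" using m K unfolding matching_def by blast
      then obtain x y where xy: "K = {x, y}" "x \<noteq> y" by (meson card_2_iff)
      moreover have "clique K" using comps_clique[OF _ K] m unfolding matching_def by blast
      ultimately show ?thesis unfolding realizes_complete_graph_2 clique_def by blast
    qed
    moreover have "sep (S - K) K" using comps_sep[OF K] sep_commute by blast
    moreover have "S = (S - K) \<union> K" using comps_subset[OF K] by blast
    ultimately show "realizes (copies (Suc n) (complete_graph 2)) S"
      unfolding realizes_copies_Suc by blast
  qed
qed

lemma realizes_bowtie:
  assumes "finite S"
  shows "realizes (graph_join (complete_graph 1) (copies 2 (complete_graph 2))) S \<longleftrightarrow> bowtie S"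
proof -
  have "realizes (graph_join (complete_graph 1) (copies 2 (complete_graph 2))) S \<longleftrightarrow>
      (\<exists>c Y. S = insert c Y \<and> joined {c} Y \<and> realizes (copies 2 (complete_graph 2)) Y)"
    unfolding realizes_graph_join realizes_complete_graph_1 by blast
  also have "\<dots> \<longleftrightarrow> (\<exists>c Y. S = insert c Y \<and> joined {c} Y \<and> matching 2 Y)"
    using realizes_matching assms by (metis finite_insert)
  finally show ?thesis unfolding bowtie_def matching_def by blast
qed

lemma realizes_bowtie_plus:
  assumes "finite S" "n \<ge> 2"
  shows "realizes (disjoint_sum (copies (n - 2) (complete_graph 2))
      (graph_join (complete_graph 1) (copies 2 (complete_graph 2)))) S \<longleftrightarrow> bowtie_plus n S"
proof -
  have "realizes (disjoint_sum (copies (n - 2) (complete_graph 2))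
      (graph_join (complete_graph 1) (copies 2 (complete_graph 2)))) S \<longleftrightarrow>
     (\<exists>M C. S = M \<union> C \<and> M \<inter> C = {} \<and> sep M C \<and> matching (n - 2) M \<and> bowtie C)"
    unfolding realizes_disjoint_sum using realizes_matching realizes_bowtie assms(1)
    by (metis finite_Un)
  then show ?thesis
    unfolding bowtie_plus_def using assms(2) sep_commute by (metis Int_commute Un_commute)
qed

end

section \<open>Induced subgraphs and isomorphisms of digraphs\<close>

lemma dominates_induce_subgraph:
  "(u, v) \<in> arcs_ends (G \<restriction> S) \<longleftrightarrow> (u, v) \<in> arcs_ends G \<and> u \<in> S \<and> v \<in> S"
  by (auto simp: arcs_ends_conv)

lemma induce_induce_subgraph: "T \<subseteq> S \<Longrightarrow> (G \<restriction> S) \<restriction> T = G \<restriction> T"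
  by (rule pre_digraph.equality) auto

lemma (in wf_digraph) induce_verts: "G \<restriction> verts G = G"
  by (rule pre_digraph.equality) auto

text \<open>An isomorphism of digraphs also maps the arcs and carries new incidence functions.
  Without parallel arcs an arc is determined by its ends, so a bijection of the vertices carries all
  the information.\<close>

lemma digraph_iso_iff:
  assumes "nomulti_digraph G" "nomulti_digraph H"
  shows "digraph_iso G H \<longleftrightarrow> (\<exists>\<psi>. bij_betw \<psi> (verts H) (verts G) \<and>
    (\<forall>u\<in>verts H. \<forall>v\<in>verts H. (u, v) \<in> arcs_ends H \<longleftrightarrow> (\<psi> u, \<psi> v) \<in> arcs_ends G))"
    (is "_ \<longleftrightarrow> (\<exists>\<psi>. ?iso \<psi>)")
proof
  interpret G: nomulti_digraph G by (rule assms(1))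
  assume "digraph_iso G H"
  then obtain f where f: "G.digraph_isomorphism f" "H = app_iso f G"
    unfolding digraph_iso_def by blast
  let ?\<phi> = "iso_verts f"
  have inj: "inj_on ?\<phi> (verts G)" and ends: "\<And>a. a \<in> arcs G \<Longrightarrow>
      ?\<phi> (tail G a) = iso_tail f (iso_arcs f a) \<and> ?\<phi> (head G a) = iso_head f (iso_arcs f a)"
    using f(1) unfolding G.digraph_isomorphism_def by auto
  have vH: "verts H = ?\<phi> ` verts G" using f(2) by simp
  have "arcs_ends H = (\<lambda>a. (?\<phi> (tail G a), ?\<phi> (head G a))) ` arcs G"
    using f(2) ends by (auto simp: arcs_ends_conv)
  then have aH: "(?\<phi> u, ?\<phi> v) \<in> arcs_ends H \<longleftrightarrow> (u, v) \<in> arcs_ends G"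
    if "u \<in> verts G" "v \<in> verts G" for u v
    using that inj_on_eq_iff[OF inj] by (auto simp: arcs_ends_conv image_iff)
  have "bij_betw ?\<phi> (verts G) (verts H)" using inj vH by (simp add: bij_betw_def)
  then have "bij_betw (inv_into (verts G) ?\<phi>) (verts H) (verts G)" by (rule bij_betw_inv_into)
  moreover have "(u, v) \<in> arcs_ends H \<longleftrightarrow>
      (inv_into (verts G) ?\<phi> u, inv_into (verts G) ?\<phi> v) \<in> arcs_ends G"
    if "u \<in> verts H" "v \<in> verts H" for u v
    using that aH inj unfolding vH by auto
  ultimately show "\<exists>\<psi>. ?iso \<psi>" by blast
next
  interpret G: nomulti_digraph G by (rule assms(1))
  interpret H: nomulti_digraph H by (rule assms(2))
  assume "\<exists>\<psi>. ?iso \<psi>"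
  then obtain \<psi> where b: "bij_betw \<psi> (verts H) (verts G)"
    and e: "\<And>u v. u \<in> verts H \<Longrightarrow> v \<in> verts H \<Longrightarrow> (u, v) \<in> arcs_ends H \<longleftrightarrow> (\<psi> u, \<psi> v) \<in> arcs_ends G"
    by blast
  define \<phi> where "\<phi> = inv_into (verts H) \<psi>"
  have b\<phi>: "bij_betw \<phi> (verts G) (verts H)" unfolding \<phi>_def using b by (rule bij_betw_inv_into)
  have \<psi>\<phi>: "\<psi> (\<phi> u) = u" if "u \<in> verts G" for u
    unfolding \<phi>_def using b that by (rule bij_betw_inv_into_right)
  have \<phi>V: "\<phi> u \<in> verts H" if "u \<in> verts G" for u using b\<phi> that bij_betwE by blast
  have e\<phi>: "(u, v) \<in> arcs_ends G \<longleftrightarrow> (\<phi> u, \<phi> v) \<in> arcs_ends H" if "u \<in> verts G" "v \<in> verts G" for u v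
    using e[OF \<phi>V[OF that(1)] \<phi>V[OF that(2)]] \<psi>\<phi> that by simp
  \<comment> \<open>Some arc of \<open>H\<close> with the prescribed ends. Injectivity comes from
    the absence of parallel arcs in \<open>G\<close>, surjectivity from their absence in
    \<open>H\<close>.\<close>
  define h where "h a = (SOME c. c \<in> arcs H \<and> tail H c = \<phi> (tail G a) \<and> head H c = \<phi> (head G a))" for a
  have h: "h a \<in> arcs H \<and> tail H (h a) = \<phi> (tail G a) \<and> head H (h a) = \<phi> (head G a)"
    if "a \<in> arcs G" for a
  proof -
    have "(tail G a, head G a) \<in> arcs_ends G" using that by (auto simp: arcs_ends_conv)
    then have "(\<phi> (tail G a), \<phi> (head G a)) \<in> arcs_ends H" using e\<phi> that by simp
    then have "\<exists>c. c \<in> arcs H \<and> tail H c = \<phi> (tail G a) \<and> head H c = \<phi> (head G a)"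
      by (auto simp: arcs_ends_conv)
    then show ?thesis unfolding h_def by (rule someI_ex)
  qed
  have inj\<phi>: "inj_on \<phi> (verts G)" using b\<phi> by (simp add: bij_betw_def)
  have "inj_on h (arcs G)"
  proof (rule inj_onI)
    fix a c assume ac: "a \<in> arcs G" "c \<in> arcs G" "h a = h c"
    then have "tail G a = tail G c" "head G a = head G c"
      using h[OF ac(1)] h[OF ac(2)] inj_on_eq_iff[OF inj\<phi>] by auto
    then show "a = c" using G.no_multi_arcs[OF ac(1,2)] by (simp add: arc_to_ends_def)
  qed
  moreover have "h ` arcs G = arcs H"
  proof
    show "h ` arcs G \<subseteq> arcs H" using h by blast
    show "arcs H \<subseteq> h ` arcs G"
    proof
      fix c assume c: "c \<in> arcs H"
      then have "(tail H c, head H c) \<in> arcs_ends H" by (auto simp: arcs_ends_conv)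
      then have "(\<psi> (tail H c), \<psi> (head H c)) \<in> arcs_ends G" using e c by simp
      then obtain a where a: "a \<in> arcs G" "tail G a = \<psi> (tail H c)" "head G a = \<psi> (head H c)"
        by (auto simp: arcs_ends_conv)
      have "\<phi> (\<psi> x) = x" if "x \<in> verts H" for x
        unfolding \<phi>_def using b that by (rule bij_betw_inv_into_left)
      then have "arc_to_ends H (h a) = arc_to_ends H c"
        using h[OF a(1)] a(2,3) c by (simp add: arc_to_ends_def)
      then have "h a = c" using H.no_multi_arcs h[OF a(1)] c by blast
      then show "c \<in> h ` arcs G" using a(1) by blast
    qed
  qed
  moreover have "\<phi> ` verts G = verts H" using b\<phi> by (simp add: bij_betw_def)
  ultimately show "digraph_iso G H"
    unfolding digraph_iso_def G.digraph_isomorphism_def app_iso_def using inj\<phi> h G.wf_digraph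
    by (intro exI[of _ "\<lparr>iso_verts = \<phi>, iso_arcs = h, iso_head = head H, iso_tail = tail H\<rparr>"]) auto
qed

lemma nomulti_with_proj:
  assumes "\<And>u v. (u, v) \<in> parcs P \<Longrightarrow> u \<in> pverts P \<and> v \<in> pverts P"
  shows "nomulti_digraph (with_proj P)"
  using assms by unfold_locales (auto simp: arc_to_ends_def)

lemma nomulti_complete_graph: "nomulti_digraph (complete_graph n)"
  unfolding complete_graph_def by (rule nomulti_with_proj) auto

lemma nomulti_path_graph: "nomulti_digraph (path_graph n)"
  unfolding path_graph_def by (rule nomulti_with_proj) auto

lemma nomulti_copies:
  assumes "nomulti_digraph H" shows "nomulti_digraph (copies n H)"
proof -
  interpret H: nomulti_digraph H by (rule assms)
  show ?thesis unfolding copies_def by (rule nomulti_with_proj) (auto dest: H.adj_in_verts)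
qed

lemma nomulti_disjoint_sum:
  assumes "nomulti_digraph A" "nomulti_digraph B" shows "nomulti_digraph (disjoint_sum A B)"
proof -
  interpret A: nomulti_digraph A by (rule assms(1))
  interpret B: nomulti_digraph B by (rule assms(2))
  show ?thesis unfolding disjoint_sum_def
    by (rule nomulti_with_proj) (auto dest: A.adj_in_verts B.adj_in_verts)
qed

lemma nomulti_graph_join:
  assumes "nomulti_digraph A" "nomulti_digraph B" shows "nomulti_digraph (graph_join A B)"
proof -
  interpret A: nomulti_digraph A by (rule assms(1))
  interpret B: nomulti_digraph B by (rule assms(2))
  show ?thesis unfolding graph_join_def
    by (rule nomulti_with_proj) (auto dest: A.adj_in_verts B.adj_in_verts)
qed

context sgraph begin

lemma realizes_path_graph_3:
  assumes "conn K" "\<not> clustered K" "card K = 3" shows "realizes (path_graph 3) K"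
proof -
  obtain x y z where xyz: "x \<in> K" "y \<in> K" "z \<in> K" "E x y" "E y z" "x \<noteq> z" "\<not> E x z"
    using assms(2) by (rule not_clusteredE)
  have ne: "x \<noteq> y" "y \<noteq> z" using xyz(4,5) irrefl by auto
  have fK: "finite K" using assms(3) card.infinite by fastforce
  have "card {x, y, z} = card K" using ne xyz(6) assms(3) by simp
  then have K: "K = {x, y, z}" using card_subset_eq[OF fK, of "{x, y, z}"] xyz(1-3) by simp
  have e': "E y x" "E z y" "\<not> E z x" using xyz(4,5,7) sym by blast+
  let ?\<psi> = "\<lambda>i::nat. if i = 0 then x else if i = 1 then y else z"
  have V: "{..<3::nat} = {0, 1, 2}" by auto
  have "bij_betw ?\<psi> {0, 1, 2} K" using K ne xyz(6) by (auto simp: bij_betw_def)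
  then show ?thesis
    unfolding realizes_def path_graph_def
    using xyz(4,5,7) e' irrefl by (intro exI[of _ ?\<psi>]) (auto simp: V)
qed

lemma realizes_path_graph_4: "(\<exists>T\<subseteq>S. realizes (path_graph 4) T) \<longleftrightarrow> \<not> p4_free S"
proof
  have V: "{..<4::nat} = {0, 1, 2, 3}" by auto
  {
    assume "\<exists>T\<subseteq>S. realizes (path_graph 4) T"
    then obtain T \<psi> where T: "T \<subseteq> S" "bij_betw \<psi> {..<4::nat} T"
      and e: "\<And>i j. i < 4 \<Longrightarrow> j < (4::nat) \<Longrightarrow> (j = Suc i \<or> i = Suc j) \<longleftrightarrow> E (\<psi> i) (\<psi> j)"
      unfolding realizes_def path_graph_def by auto
    have "\<psi> i \<in> S" if "i < 4" for i using T bij_betwE that by blast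
    then have "\<psi> 0 \<in> S" "\<psi> 1 \<in> S" "\<psi> 2 \<in> S" "\<psi> 3 \<in> S" by auto
    moreover have "E (\<psi> 0) (\<psi> 1)" "E (\<psi> 1) (\<psi> 2)" "E (\<psi> 2) (\<psi> 3)"
      "\<not> E (\<psi> 0) (\<psi> 2)" "\<not> E (\<psi> 1) (\<psi> 3)" "\<not> E (\<psi> 0) (\<psi> 3)"
      using e[of 0 1] e[of 1 2] e[of 2 3] e[of 0 2] e[of 1 3] e[of 0 3] by auto
    ultimately show "\<not> p4_free S" unfolding p4_free_def by blast
  }
  assume "\<not> p4_free S"
  then obtain a b c d where v: "a \<in> S" "b \<in> S" "c \<in> S" "d \<in> S"
    and e: "E a b" "E b c" "E c d" "\<not> E a c" "\<not> E b d" "\<not> E a d"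
    unfolding p4_free_def by blast
  have ne: "a \<noteq> b" "b \<noteq> c" "c \<noteq> d" "a \<noteq> c" "b \<noteq> d" "a \<noteq> d" using e sym irrefl by metis+
  have e': "E b a" "E c b" "E d c" "\<not> E c a" "\<not> E d b" "\<not> E d a" using e sym by blast+
  let ?\<psi> = "\<lambda>i::nat. if i = 0 then a else if i = 1 then b else if i = 2 then c else d"
  have "bij_betw ?\<psi> {0, 1, 2, 3} {a, b, c, d}" using ne by (auto simp: bij_betw_def)
  then have "realizes (path_graph 4) {a, b, c, d}"
    unfolding realizes_def path_graph_def
    using e e' irrefl by (intro exI[of _ ?\<psi>]) (auto simp: V)
  then show "\<exists>T\<subseteq>S. realizes (path_graph 4) T" using v by (intro exI[of _ "{a, b, c, d}"]) auto
qed

end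

section \<open>Transfer to digraphs\<close>

sublocale graph \<subseteq> sg: sgraph "dominates G"
  by unfold_locales (auto dest: graph_symmetric adj_not_same)

context graph begin

lemma graph_induce: "S \<subseteq> verts G \<Longrightarrow> graph (G \<restriction> S)"
proof -
  assume "S \<subseteq> verts G"
  then have i: "induced_subgraph (G \<restriction> S) G" by (rule induced_induce)
  interpret D: digraph "G \<restriction> S" using digraphI_induced[OF i] .
  show ?thesis using induced_graph_imp_symmetric[OF sym_arcs i] by (rule D.graphI)
qed

lemma digraph_iso_induce:
  assumes "S \<subseteq> verts G" "nomulti_digraph H"
  shows "digraph_iso (G \<restriction> S) H \<longleftrightarrow> sg.realizes H S"
proof -
  interpret GS: graph "G \<restriction> S" using graph_induce[OF assms(1)] .
  have m: "\<psi> u \<in> S" if "bij_betw \<psi> (verts H) S" "u \<in> verts H" for \<psi> u using that bij_betwE by blast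
  show ?thesis
    unfolding digraph_iso_iff[OF GS.nomulti_digraph assms(2)] sg.realizes_def induce_subgraph_verts
      dominates_induce_subgraph
    using m by (intro ex_cong1 conj_cong ball_cong refl) simp
qed

lemma induced_subgraph_induce_iff:
  assumes "S \<subseteq> verts G"
  shows "induced_subgraph H (G \<restriction> S) \<longleftrightarrow> (\<exists>T\<subseteq>S. H = G \<restriction> T)"
proof -
  interpret GS: graph "G \<restriction> S" using graph_induce[OF assms] .
  show ?thesis
  proof
    assume H: "induced_subgraph H (G \<restriction> S)"
    then have "verts H \<subseteq> S" using subgraph_imp_subverts[OF induced_imp_subgraph[OF H]] by simp
    then show "\<exists>T\<subseteq>S. H = G \<restriction> T"
      using GS.induce_eq_iff_induced[OF H] induce_induce_subgraph by metis
  next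
    assume "\<exists>T\<subseteq>S. H = G \<restriction> T"
    then obtain T where "T \<subseteq> S" "H = G \<restriction> T" by blast
    then show "induced_subgraph H (G \<restriction> S)"
      using GS.induced_induce[of T] induce_induce_subgraph[of T S G] by simp
  qed
qed

lemma cograph_induce_iff:
  assumes "S \<subseteq> verts G" shows "cograph (G \<restriction> S) \<longleftrightarrow> sg.p4_free S"
proof -
  have "(\<exists>H. induced_subgraph H (G \<restriction> S) \<and> digraph_iso H (path_graph 4)) \<longleftrightarrow>
      (\<exists>T\<subseteq>S. digraph_iso (G \<restriction> T) (path_graph 4))"
    unfolding induced_subgraph_induce_iff[OF assms] by blast
  also have "\<dots> \<longleftrightarrow> (\<exists>T\<subseteq>S. sg.realizes (path_graph 4) T)"
    using digraph_iso_induce[OF _ nomulti_path_graph] assms by blast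
  finally show ?thesis
    unfolding cograph_def sg.realizes_path_graph_4 using graph_induce[OF assms] by blast
qed

text \<open>No walk crosses an edgeless cut; conversely the set reachable from a vertex is separated
  from the rest of \<open>K\<close>.\<close>

lemma strongly_connected_induce_iff:
  assumes "K \<subseteq> verts G" shows "strongly_connected (G \<restriction> K) \<longleftrightarrow> sg.conn K"
proof -
  interpret GK: graph "G \<restriction> K" using graph_induce[OF assms] .
  show ?thesis
  proof
    assume sc: "strongly_connected (G \<restriction> K)"
    show "sg.conn K"
      unfolding sg.conn_def
    proof (intro conjI allI impI notI)
      assume "K = {}" then show False using sc unfolding strongly_connected_def by simp
    next
      fix X assume X: "X \<subseteq> K" "X \<noteq> {}" "X \<noteq> K" and s: "sg.sep X (K - X)"
      obtain u v where uv: "u \<in> X" "v \<in> K" "v \<notin> X" using X by blast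
      then have "u \<rightarrow>\<^sup>*\<^bsub>G \<restriction> K\<^esub> v" using sc X(1) unfolding strongly_connected_def by auto
      then have "v \<in> X"
      proof (induction rule: GK.reachable_induct)
        case base then show ?case using uv by simp
      next
        case (step x y)
        then show ?case using s unfolding sg.sep_def dominates_induce_subgraph by blast
      qed
      then show False using uv by blast
    qed
  next
    assume c: "sg.conn K"
    show "strongly_connected (G \<restriction> K)"
    proof (rule strongly_connectedI)
      show "verts (G \<restriction> K) \<noteq> {}" using sg.conn_nonempty[OF c] by simp
      fix u v assume uv: "u \<in> verts (G \<restriction> K)" "v \<in> verts (G \<restriction> K)"
      let ?X = "{w \<in> K. u \<rightarrow>\<^sup>*\<^bsub>G \<restriction> K\<^esub> w}"
      have "sg.sep ?X (K - ?X)"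
        unfolding sg.sep_def using GK.reachable_adj_trans[of u]
        by (auto simp: dominates_induce_subgraph)
      moreover have "?X \<noteq> {}" using uv by auto
      ultimately have "?X = K" using sg.connD[OF c, of ?X] by blast
      then show "u \<rightarrow>\<^sup>*\<^bsub>G \<restriction> K\<^esub> v" using uv by auto
    qed
  qed
qed

text \<open>Strong components are defined by maximality and \<open>comps\<close> by separation. The
  two agree because a connected subset lies within any component that it meets.\<close>

lemma sccs_induce:
  assumes "S \<subseteq> verts G"
  shows "graph_components (G \<restriction> S) = induce_subgraph G ` sg.comps S"
proof (intro subset_antisym subsetI)
  have sc: "strongly_connected (G \<restriction> K) \<longleftrightarrow> sg.conn K" if "K \<subseteq> S" for K
    using strongly_connected_induce_iff that assms by blast
  note ind = induced_subgraph_induce_iff[OF assms]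
  {
    fix H assume "H \<in> graph_components (G \<restriction> S)"
    then have H: "induced_subgraph H (G \<restriction> S)" "strongly_connected H"
      and max: "\<And>H'. induced_subgraph H' (G \<restriction> S) \<Longrightarrow> strongly_connected H' \<Longrightarrow> \<not> verts H \<subset> verts H'"
      unfolding pre_digraph.sccs_def by auto
    obtain K where K: "K \<subseteq> S" "H = G \<restriction> K" using H(1) unfolding ind by blast
    then have c: "sg.conn K" using H(2) sc by blast
    obtain x where x: "x \<in> K" using sg.conn_nonempty[OF c] by blast
    then have "x \<in> S" using K(1) by blast
    then obtain L where L: "L \<in> sg.comps S" "x \<in> L" by (rule sg.comps_exists)
    have "K \<subseteq> L" using sg.conn_subset_comp[OF c K(1) L(1)] x L(2) by blast
    moreover have "induced_subgraph (G \<restriction> L) (G \<restriction> S)" "strongly_connected (G \<restriction> L)"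
      using ind sc sg.comps_subset[OF L(1)] sg.comps_conn[OF L(1)] by blast+
    ultimately have "K = L" using max[of "G \<restriction> L"] K(2) by auto
    then show "H \<in> induce_subgraph G ` sg.comps S" using K(2) L(1) by blast
  }
  fix H assume "H \<in> induce_subgraph G ` sg.comps S"
  then obtain K where K: "K \<in> sg.comps S" "H = G \<restriction> K" by blast
  have "\<not> K \<subset> verts H'" if "induced_subgraph H' (G \<restriction> S)" "strongly_connected H'" for H'
  proof -
    obtain L where "L \<subseteq> S" "H' = G \<restriction> L" using \<open>induced_subgraph H' _\<close> unfolding ind by blast
    then show ?thesis
      using sg.conn_subset_comp[OF _ _ K(1), of L] sc that(2) sg.comps_nonempty[OF K(1)] by auto
  qed
  moreover have "induced_subgraph H (G \<restriction> S)" "strongly_connected H"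
    using K ind sc sg.comps_subset[OF K(1)] sg.comps_conn[OF K(1)] by blast+
  ultimately show "H \<in> graph_components (G \<restriction> S)"
    unfolding pre_digraph.sccs_def using K(2) by auto
qed

lemma inj_induce: "inj_on (induce_subgraph G) A"
  by (rule inj_onI) (metis induce_subgraph_verts)

lemma card_sccs_induce:
  "S \<subseteq> verts G \<Longrightarrow> card (graph_components (G \<restriction> S)) = sg.ncomps S"
  unfolding sccs_induce sg.ncomps_def by (rule card_image[OF inj_induce])

text \<open>\<open>connected\<close> refers to the symmetric closure, which has the same adjacency
  as a digraph that is already symmetric.\<close>

lemma connected_iff: "Digraph_Component.connected G \<longleftrightarrow> sg.conn (verts G)"
  using strongly_connected_induce_iff[of "verts G"] adj_mk_symmetric_eq[OF sym_arcs]
  unfolding connected_def strongly_connected_def reachable_def induce_verts by simp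

section \<open>Polarity and obstructions of induced subgraphs\<close>

lemma cluster_induce_iff: "cluster (G \<restriction> B) \<longleftrightarrow> sg.clustered B"
proof
  assume "cluster (G \<restriction> B)"
  then obtain P where P: "partition_on B P"
    "arcs_ends (G \<restriction> B) = {(u, v). u \<noteq> v \<and> (\<exists>X\<in>P. u \<in> X \<and> v \<in> X)}"
    unfolding cluster_def by auto
  have e: "(u, v) \<in> arcs_ends G \<longleftrightarrow> u \<noteq> v \<and> (\<exists>X\<in>P. u \<in> X \<and> v \<in> X)" if "u \<in> B" "v \<in> B" for u v
    using P(2) that dominates_induce_subgraph[of u v G B] by auto
  have u: "X = Y" if "X \<in> P" "Y \<in> P" "x \<in> X" "x \<in> Y" for X Y x
    using P(1) that unfolding partition_on_def disjoint_def by blast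
  show "sg.clustered B"
    unfolding sg.clustered_def
  proof (intro ballI impI)
    fix x y z assume xyz: "x \<in> B" "y \<in> B" "z \<in> B" "x \<rightarrow> y" "y \<rightarrow> z" "x \<noteq> z"
    obtain X where X: "X \<in> P" "x \<in> X" "y \<in> X" using e xyz by blast
    obtain Y where Y: "Y \<in> P" "y \<in> Y" "z \<in> Y" using e xyz by blast
    have "X = Y" using u[OF X(1) Y(1) X(3) Y(2)] .
    then show "x \<rightarrow> z" using e[OF xyz(1,3)] xyz(6) X Y by blast
  qed
next
  assume c: "sg.clustered B"
  have "partition_on B (sg.comps B)"
  proof (rule partition_onI)
    show "\<Union> (sg.comps B) = B" by (rule sg.Union_comps)
    show "{} \<notin> sg.comps B" using sg.comps_nonempty by blast
    show "disjnt X Y" if "X \<in> sg.comps B" "Y \<in> sg.comps B" "X \<noteq> Y" for X Y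
      using sg.comps_eq[OF that(1,2)] that(3) unfolding disjnt_def by blast
  qed
  moreover have "arcs_ends (G \<restriction> B) = {(u, v). u \<noteq> v \<and> (\<exists>X\<in>sg.comps B. u \<in> X \<and> v \<in> X)}"
  proof -
    have "(u, v) \<in> arcs_ends (G \<restriction> B) \<longleftrightarrow> u \<noteq> v \<and> (\<exists>X\<in>sg.comps B. u \<in> X \<and> v \<in> X)" for u v
    proof
      assume "(u, v) \<in> arcs_ends (G \<restriction> B)"
      then have uv: "u \<rightarrow> v" "u \<in> B" "v \<in> B" unfolding dominates_induce_subgraph by auto
      obtain X where X: "X \<in> sg.comps B" "u \<in> X" using uv(2) by (rule sg.comps_exists)
      have "v \<in> X" using sg.comps_closed[OF X uv(3,1)] .
      moreover have "u \<noteq> v" using uv(1) sg.irrefl by auto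
      ultimately show "u \<noteq> v \<and> (\<exists>X\<in>sg.comps B. u \<in> X \<and> v \<in> X)" using X by blast
    next
      assume "u \<noteq> v \<and> (\<exists>X\<in>sg.comps B. u \<in> X \<and> v \<in> X)"
      then obtain X where X: "X \<in> sg.comps B" "u \<in> X" "v \<in> X" "u \<noteq> v" by blast
      then have "u \<rightarrow> v" using sg.comps_clique[OF c X(1)] unfolding sg.clique_def by blast
      then show "(u, v) \<in> arcs_ends (G \<restriction> B)"
        using sg.comps_subset[OF X(1)] X unfolding dominates_induce_subgraph by blast
    qed
    then show ?thesis by auto
  qed
  ultimately show "cluster (G \<restriction> B)" unfolding cluster_def by auto
qed

lemma multipartite_induce_iff:
  "complete_multipartite_at_most \<infinity> (G \<restriction> A) \<longleftrightarrow> sg.multipartite A"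
proof
  assume "complete_multipartite_at_most \<infinity> (G \<restriction> A)"
  then obtain P where P: "partition_on A P"
    "arcs_ends (G \<restriction> A) = {(u, v). u \<in> A \<and> v \<in> A \<and> \<not> (\<exists>X\<in>P. u \<in> X \<and> v \<in> X)}"
    unfolding complete_multipartite_at_most_def by auto
  have e: "(u, v) \<notin> arcs_ends G \<longleftrightarrow> (\<exists>X\<in>P. u \<in> X \<and> v \<in> X)" if "u \<in> A" "v \<in> A" for u v
    using P(2) that dominates_induce_subgraph[of u v G A] by auto
  have u: "X = Y" if "X \<in> P" "Y \<in> P" "x \<in> X" "x \<in> Y" for X Y x
    using P(1) that unfolding partition_on_def disjoint_def by blast
  show "sg.multipartite A"
    unfolding sg.multipartite_def
  proof (intro ballI impI)
    fix x y z assume xyz: "x \<in> A" "y \<in> A" "z \<in> A" "\<not> x \<rightarrow> y" "\<not> y \<rightarrow> z"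
    obtain X where X: "X \<in> P" "x \<in> X" "y \<in> X" using e xyz by blast
    obtain Y where Y: "Y \<in> P" "y \<in> Y" "z \<in> Y" using e xyz by blast
    have "X = Y" using u[OF X(1) Y(1) X(3) Y(2)] .
    then show "\<not> x \<rightarrow> z" using e[OF xyz(1,3)] X Y by blast
  qed
next
  assume m: "sg.multipartite A"
  \<comment> \<open>The parts are the non-neighbourhoods; transitivity makes those of two
    nonadjacent vertices equal.\<close>
  let ?N = "\<lambda>x. {y \<in> A. \<not> x \<rightarrow> y}"
  have self: "x \<in> ?N x" if "x \<in> A" for x using that sg.irrefl by blast
  have eq: "?N x = ?N y" if "x \<in> A" "y \<in> A" "\<not> x \<rightarrow> y" for x y
    using m that sg.sym unfolding sg.multipartite_def by blast
  have "partition_on A (?N ` A)"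
  proof (rule partition_onI)
    show "\<Union> (?N ` A) = A" using self by blast
    show "{} \<notin> ?N ` A" using self by blast
    show "disjnt X Y" if XY: "X \<in> ?N ` A" "Y \<in> ?N ` A" "X \<noteq> Y" for X Y
    proof (rule ccontr)
      assume "\<not> disjnt X Y"
      then obtain x y z where "X = ?N x" "Y = ?N y" "x \<in> A" "y \<in> A" "z \<in> ?N x" "z \<in> ?N y"
        using XY unfolding disjnt_def by blast
      then show False using eq[of x z] eq[of y z] XY(3) by blast
    qed
  qed
  moreover have "arcs_ends (G \<restriction> A) = {(u, v). u \<in> A \<and> v \<in> A \<and> \<not> (\<exists>X\<in>?N ` A. u \<in> X \<and> v \<in> X)}"
  proof -
    have "(u, v) \<in> arcs_ends (G \<restriction> A) \<longleftrightarrow> u \<in> A \<and> v \<in> A \<and> \<not> (\<exists>x\<in>A. u \<in> ?N x \<and> v \<in> ?N x)" for u v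
      using m sg.sym sg.irrefl unfolding dominates_induce_subgraph sg.multipartite_def by blast
    then show ?thesis by auto
  qed
  ultimately show "complete_multipartite_at_most \<infinity> (G \<restriction> A)"
    unfolding complete_multipartite_at_most_def
    by (intro exI[of _ "?N ` A"] conjI) (simp_all only: induce_subgraph_verts enat_ord_simps)
qed

text \<open>Finiteness rules out infinite partitions, whose \<open>card\<close> is 0 and would
  satisfy the bound.\<close>

lemma indep_induce_iff:
  assumes "finite A" shows "complete_multipartite_at_most 1 (G \<restriction> A) \<longleftrightarrow> sg.indep A"
proof
  assume "complete_multipartite_at_most 1 (G \<restriction> A)"
  then obtain P where P: "partition_on A P" "card P \<le> 1"
    "arcs_ends (G \<restriction> A) = {(u, v). u \<in> A \<and> v \<in> A \<and> \<not> (\<exists>X\<in>P. u \<in> X \<and> v \<in> X)}"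
    unfolding complete_multipartite_at_most_def by (auto simp: one_enat_def)
  have "finite P" using finite_elements[OF assms P(1)] .
  then have one: "X = Y" if "X \<in> P" "Y \<in> P" for X Y
    using P(2) that by (auto simp: card_le_Suc0_iff_eq)
  have "\<exists>X\<in>P. u \<in> X \<and> v \<in> X" if uv: "u \<in> A" "v \<in> A" for u v
  proof -
    obtain X Y where "X \<in> P" "u \<in> X" "Y \<in> P" "v \<in> Y"
      using uv partition_onD1[OF P(1)] by blast
    then show ?thesis using one by blast
  qed
  then have "(u, v) \<notin> arcs_ends (G \<restriction> A)" for u v using P(3) by blast
  then show "sg.indep A" unfolding sg.indep_def dominates_induce_subgraph by blast
next
  assume i: "sg.indep A"
  \<comment> \<open>For empty \<open>A\<close> the partition must be empty, since \<open>{A}\<close>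
    would contain an empty block.\<close>
  let ?P = "if A = {} then {} else {A}"
  have "partition_on A ?P" by (auto simp: partition_on_def disjoint_def)
  moreover have "card ?P \<le> 1" by simp
  moreover have "arcs_ends (G \<restriction> A) = {(u, v). u \<in> A \<and> v \<in> A \<and> \<not> (\<exists>X\<in>?P. u \<in> X \<and> v \<in> X)}"
  proof -
    have "(u, v) \<notin> arcs_ends (G \<restriction> A)" for u v
      using i unfolding dominates_induce_subgraph sg.indep_def by blast
    then show ?thesis by auto
  qed
  ultimately show "complete_multipartite_at_most 1 (G \<restriction> A)"
    unfolding complete_multipartite_at_most_def by (intro exI[of _ ?P]) (auto simp: one_enat_def)
qed

lemma polar_partition_induce:
  assumes "S \<subseteq> verts G"
  shows "polar s k (G \<restriction> S) \<longleftrightarrow> (\<exists>B\<subseteq>S. complete_multipartite_at_most s (G \<restriction> (S - B)) \<and>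
     sg.clustered B \<and> enat (sg.ncomps B) \<le> k)"
proof -
  have "polar s k (G \<restriction> S) \<longleftrightarrow> (\<exists>B\<subseteq>S. polar_partition s k (G \<restriction> S) (S - B) B)"
  proof
    assume "polar s k (G \<restriction> S)"
    then obtain A B where p: "polar_partition s k (G \<restriction> S) A B" unfolding polar_def by blast
    then have "A = S - B" "B \<subseteq> S" unfolding polar_partition_def by auto
    then show "\<exists>B\<subseteq>S. polar_partition s k (G \<restriction> S) (S - B) B" using p by blast
  qed (unfold polar_def, blast)
  also have "\<dots> \<longleftrightarrow> (\<exists>B\<subseteq>S. complete_multipartite_at_most s (G \<restriction> (S - B)) \<and>
     sg.clustered B \<and> enat (sg.ncomps B) \<le> k)"
  proof (intro ex_cong1 conj_cong refl)
    fix B assume B: "B \<subseteq> S"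
    have "(G \<restriction> S) \<restriction> (S - B) = G \<restriction> (S - B)" "(G \<restriction> S) \<restriction> B = G \<restriction> B"
      using B by (auto intro: induce_induce_subgraph)
    then show "polar_partition s k (G \<restriction> S) (S - B) B \<longleftrightarrow> complete_multipartite_at_most s (G \<restriction> (S - B)) \<and>
       sg.clustered B \<and> enat (sg.ncomps B) \<le> k"
      unfolding polar_partition_def using cluster_induce_iff[of B] card_sccs_induce[of B] B assms by auto
  qed
  finally show ?thesis .
qed

lemma polar_induce_iff:
  assumes "S \<subseteq> verts G"
  shows "polar \<infinity> (enat k) (G \<restriction> S) \<longleftrightarrow> sg.pol S \<le> enat k"
    "polar 1 (enat k) (G \<restriction> S) \<longleftrightarrow> sg.mpol S \<le> enat k"
    "polar 1 \<infinity> (G \<restriction> S) \<longleftrightarrow> sg.mpol S \<noteq> \<infinity>"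
proof -
  have fin: "finite (S - B)" for B using finite_subset[OF assms finite_verts] by simp
  show "polar \<infinity> (enat k) (G \<restriction> S) \<longleftrightarrow> sg.pol S \<le> enat k"
    unfolding polar_partition_induce[OF assms] sg.pol_le_iff sg.polar_part_def multipartite_induce_iff
    by auto
  have 1: "polar 1 (enat k) (G \<restriction> S) \<longleftrightarrow> sg.mpol S \<le> enat k" for k
    unfolding polar_partition_induce[OF assms] sg.mpol_le_iff sg.mono_part_def indep_induce_iff[OF fin]
    by auto
  then show "polar 1 (enat k) (G \<restriction> S) \<longleftrightarrow> sg.mpol S \<le> enat k" .
  \<comment> \<open>The number of components of a cluster is a natural number, so an unbounded
    partition is bounded by some \<open>n\<close>.\<close>
  have "polar 1 \<infinity> (G \<restriction> S) \<longleftrightarrow> (\<exists>n. polar 1 (enat n) (G \<restriction> S))"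
    unfolding polar_partition_induce[OF assms] by auto
  also have "\<dots> \<longleftrightarrow> sg.mpol S \<noteq> \<infinity>" unfolding 1 by (cases "sg.mpol S") auto
  finally show "polar 1 \<infinity> (G \<restriction> S) \<longleftrightarrow> sg.mpol S \<noteq> \<infinity>" .
qed

lemma obstruction_induce_iff:
  assumes "S \<subseteq> verts G"
  shows "cograph_minimal_polar_obstruction s k (G \<restriction> S) \<longleftrightarrow>
    sg.p4_free S \<and> \<not> polar s k (G \<restriction> S) \<and> (\<forall>T. T \<subset> S \<longrightarrow> polar s k (G \<restriction> T))"
proof -
  have "(\<forall>H. induced_subgraph H (G \<restriction> S) \<and> H \<noteq> G \<restriction> S \<longrightarrow> polar s k H) \<longleftrightarrow>
      (\<forall>T. T \<subset> S \<longrightarrow> polar s k (G \<restriction> T))"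
    unfolding induced_subgraph_induce_iff[OF assms] using induce_subgraph_verts[of G]
    by (metis psubset_eq)
  then show ?thesis
    unfolding cograph_minimal_polar_obstruction_def cograph_induce_iff[OF assms] by blast
qed

lemma polar_obs_induce_iff:
  assumes "S \<subseteq> verts G"
  shows "cograph_minimal_polar_obstruction \<infinity> (enat k) (G \<restriction> S) \<longleftrightarrow> sg.p4_free S \<and> sg.polar_obs k S"
    "cograph_minimal_polar_obstruction 1 (enat k) (G \<restriction> S) \<longleftrightarrow> sg.p4_free S \<and> sg.mono_obs k S"
    "cograph_minimal_polar_obstruction 1 \<infinity> (G \<restriction> S) \<longleftrightarrow>
       sg.p4_free S \<and> sg.mpol S = \<infinity> \<and> (\<forall>T. T \<subset> S \<longrightarrow> sg.mpol T \<noteq> \<infinity>)"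
proof -
  have sub: "T \<subseteq> verts G" if "T \<subset> S" for T using that assms by blast
  show "cograph_minimal_polar_obstruction \<infinity> (enat k) (G \<restriction> S) \<longleftrightarrow> sg.p4_free S \<and> sg.polar_obs k S"
    unfolding obstruction_induce_iff[OF assms] sg.polar_obs_def
    using polar_induce_iff(1) assms sub by auto
  show "cograph_minimal_polar_obstruction 1 (enat k) (G \<restriction> S) \<longleftrightarrow> sg.p4_free S \<and> sg.mono_obs k S"
    unfolding obstruction_induce_iff[OF assms] sg.mono_obs_def
    using polar_induce_iff(2) assms sub by auto
  show "cograph_minimal_polar_obstruction 1 \<infinity> (G \<restriction> S) \<longleftrightarrow>
       sg.p4_free S \<and> sg.mpol S = \<infinity> \<and> (\<forall>T. T \<subset> S \<longrightarrow> sg.mpol T \<noteq> \<infinity>)"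
    unfolding obstruction_induce_iff[OF assms]
    using polar_induce_iff(3) assms sub by auto
qed

lemma bowtie_plus_induce_iff:
  assumes "S \<subseteq> verts G" shows "is_bowtie_plus_edges n (G \<restriction> S) \<longleftrightarrow> sg.bowtie_plus n S"
proof (cases "n \<ge> 2")
  case True
  have "finite S" using finite_subset[OF assms finite_verts] .
  then show ?thesis
    unfolding is_bowtie_plus_edges_def
    using True sg.realizes_bowtie_plus digraph_iso_induce[OF assms] nomulti_disjoint_sum
      nomulti_graph_join nomulti_copies nomulti_complete_graph by metis
next
  case False
  then show ?thesis unfolding is_bowtie_plus_edges_def sg.bowtie_plus_def by simp
qed

text \<open>Every arc of \<open>G\<close> comes from one summand and has both ends there. Hence the
  summands are the induced subgraphs on their vertex sets, as digraphs with the same arcs and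
  incidence functions, and can be replaced by these sets.\<close>

lemma induce_decomposition:
  assumes "cograph H1" "cograph H2" "is_disjoint_union G H1 H2"
  shows "verts G = verts H1 \<union> verts H2" "verts H1 \<inter> verts H2 = {}" "sg.sep (verts H1) (verts H2)"
    "H1 = G \<restriction> verts H1" "H2 = G \<restriction> verts H2"
proof -
  interpret H1: graph H1 using assms(1) unfolding cograph_def by blast
  interpret H2: graph H2 using assms(2) unfolding cograph_def by blast
  have c: "tail H1 = tail H2" "head H1 = head H2" and d: "verts H1 \<inter> verts H2 = {}" and G: "G = union H1 H2"
    using assms(3) unfolding is_disjoint_union_def compatible_def by auto
  have tG: "verts G = verts H1 \<union> verts H2" "arcs G = arcs H1 \<union> arcs H2" "tail G = tail H1" "head G = head H1"
    unfolding G union_def by simp_all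
  show "verts G = verts H1 \<union> verts H2" "verts H1 \<inter> verts H2 = {}" by fact+
  have in1: "tail H1 e \<in> verts H1" "head H1 e \<in> verts H1" if "e \<in> arcs H1" for e using that by auto
  have in2: "tail H1 e \<in> verts H2" "head H1 e \<in> verts H2" if "e \<in> arcs H2" for e
    using H2.tail_in_verts[OF that] H2.head_in_verts[OF that] c by auto
  show "sg.sep (verts H1) (verts H2)"
    unfolding sg.sep_def
  proof (intro ballI notI)
    fix x y assume xy: "x \<in> verts H1" "y \<in> verts H2" "x \<rightarrow> y"
    then obtain e where e: "e \<in> arcs G" "tail G e = x" "head G e = y" by (blast elim: reachableE)
    then have "e \<in> arcs H1 \<or> e \<in> arcs H2" using tG(2) by blast
    then show False using in1[of e] in2[of e] e xy(1,2) d unfolding tG by blast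
  qed
  have a1: "arcs H1 = {e \<in> arcs G. tail G e \<in> verts H1 \<and> head G e \<in> verts H1}"
    unfolding tG using in1 in2 d by blast
  show "H1 = G \<restriction> verts H1"
  proof (rule pre_digraph.equality)
    show "arcs H1 = arcs (G \<restriction> verts H1)" unfolding induce_subgraph_arcs by (rule a1)
  qed (simp_all add: tG(3,4))
  have a2: "arcs H2 = {e \<in> arcs G. tail G e \<in> verts H2 \<and> head G e \<in> verts H2}"
    unfolding tG using in1 in2 d by blast
  show "H2 = G \<restriction> verts H2"
  proof (rule pre_digraph.equality)
    show "arcs H2 = arcs (G \<restriction> verts H2)" unfolding induce_subgraph_arcs by (rule a2)
  qed (simp_all add: tG(3,4) c)
qed

lemma is_disjoint_union_induce:
  assumes "verts G = S \<union> T" "S \<inter> T = {}" "sg.sep S T"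
  shows "is_disjoint_union G (G \<restriction> S) (G \<restriction> T)"
proof -
  have "(tail G e \<in> S \<and> head G e \<in> S) \<or> (tail G e \<in> T \<and> head G e \<in> T)" if e: "e \<in> arcs G" for e
  proof -
    have "tail G e \<rightarrow> head G e" using e by (auto simp: arcs_ends_conv)
    then have "\<not> (tail G e \<in> S \<and> head G e \<in> T)" "\<not> (tail G e \<in> T \<and> head G e \<in> S)"
      using assms(3) sg.sym unfolding sg.sep_def by blast+
    then show ?thesis using tail_in_verts[OF e] head_in_verts[OF e] assms(1) by blast
  qed
  then have "G = union (G \<restriction> S) (G \<restriction> T)"
    unfolding union_def by (intro pre_digraph.equality) (use assms(1) in auto)
  then show ?thesis unfolding is_disjoint_union_def compatible_def using assms(2) by simp
qed

lemma comps_iso_complete_graph: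
  assumes "S \<subseteq> verts G" "K \<in> sg.comps S"
  shows "digraph_iso (G \<restriction> K) (complete_graph 1) \<longleftrightarrow> card K = 1"
    "digraph_iso (G \<restriction> K) (complete_graph 2) \<longleftrightarrow> card K = 2"
proof -
  have K: "K \<subseteq> verts G" using sg.comps_subset[OF assms(2)] assms(1) by blast
  show "digraph_iso (G \<restriction> K) (complete_graph 1) \<longleftrightarrow> card K = 1"
    unfolding digraph_iso_induce[OF K nomulti_complete_graph] sg.realizes_complete_graph_1
    by (simp add: card_1_singleton_iff)
  have "(\<exists>x y. K = {x, y} \<and> x \<rightarrow> y) \<longleftrightarrow> card K = 2"
  proof
    assume "\<exists>x y. K = {x, y} \<and> x \<rightarrow> y"
    then obtain x y where "K = {x, y}" "x \<rightarrow> y" by blast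
    moreover have "x \<noteq> y" using \<open>x \<rightarrow> y\<close> sg.irrefl by auto
    ultimately show "card K = 2" by simp
  next
    assume "card K = 2"
    then obtain x y where xy: "K = {x, y}" "x \<noteq> y" by (meson card_2_iff)
    have "\<not> sg.sep {x} (K - {x})" using sg.connD[OF sg.comps_conn[OF assms(2)], of "{x}"] xy by blast
    then show "\<exists>x y. K = {x, y} \<and> x \<rightarrow> y" using xy unfolding sg.sep_def by auto
  qed
  then show "digraph_iso (G \<restriction> K) (complete_graph 2) \<longleftrightarrow> card K = 2"
    unfolding digraph_iso_induce[OF K nomulti_complete_graph] sg.realizes_complete_graph_2 .
qed

lemma unique_non_edge_component_iff:
  assumes "S \<subseteq> verts G"
  shows "(\<exists>!C. C \<in> graph_components (G \<restriction> S) \<and> \<not> digraph_iso C (complete_graph 2)) \<longleftrightarrow>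
    (\<exists>!K. K \<in> sg.comps S \<and> card K \<noteq> 2)"
proof -
  have iso: "digraph_iso (G \<restriction> K) (complete_graph 2) \<longleftrightarrow> card K = 2" if "K \<in> sg.comps S" for K
    using comps_iso_complete_graph(2)[OF assms that] .
  have inj: "G \<restriction> K = G \<restriction> L \<Longrightarrow> K = L" for K L by (metis induce_subgraph_verts)
  show ?thesis
    unfolding sccs_induce[OF assms]
  proof
    assume "\<exists>!C. C \<in> induce_subgraph G ` sg.comps S \<and> \<not> digraph_iso C (complete_graph 2)"
    then obtain K where K: "K \<in> sg.comps S" "\<not> digraph_iso (G \<restriction> K) (complete_graph 2)"
      and u: "\<And>L. L \<in> sg.comps S \<Longrightarrow> \<not> digraph_iso (G \<restriction> L) (complete_graph 2) \<Longrightarrow> G \<restriction> L = G \<restriction> K"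
      by blast
    show "\<exists>!K. K \<in> sg.comps S \<and> card K \<noteq> 2"
    proof (rule ex1I[of _ K])
      show "K \<in> sg.comps S \<and> card K \<noteq> 2" using K iso by blast
      show "L = K" if "L \<in> sg.comps S \<and> card L \<noteq> 2" for L using u[of L] iso[of L] that inj by blast
    qed
  next
    assume "\<exists>!K. K \<in> sg.comps S \<and> card K \<noteq> 2"
    then obtain K where K: "K \<in> sg.comps S" "card K \<noteq> 2"
      and u: "\<And>L. L \<in> sg.comps S \<Longrightarrow> card L \<noteq> 2 \<Longrightarrow> L = K" by blast
    show "\<exists>!C. C \<in> induce_subgraph G ` sg.comps S \<and> \<not> digraph_iso C (complete_graph 2)"
    proof (rule ex1I[of _ "G \<restriction> K"])
      show "G \<restriction> K \<in> induce_subgraph G ` sg.comps S \<and> \<not> digraph_iso (G \<restriction> K) (complete_graph 2)"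
        using K iso by blast
      fix C assume "C \<in> induce_subgraph G ` sg.comps S \<and> \<not> digraph_iso C (complete_graph 2)"
      then obtain L where "L \<in> sg.comps S" "C = G \<restriction> L" "\<not> digraph_iso (G \<restriction> L) (complete_graph 2)" by blast
      then show "C = G \<restriction> K" using u[of L] iso[of L] by blast
    qed
  qed
qed

text \<open>All proper subsets of a minimal (1, n - 1)-obstruction have finite \<open>mpol\<close>,
  so for it being a minimal (1, \<infinity>)-obstruction just means value \<infinity>, and being nK2
  just means being a cluster.\<close>

lemma admissible_induce_iff:
  assumes "S \<subseteq> verts G" "sg.p4_free S" "n \<ge> 1"
  shows "((cograph_minimal_polar_obstruction 1 (enat (n - 1)) (G \<restriction> S) \<and>
      \<not> cograph_minimal_polar_obstruction 1 \<infinity> (G \<restriction> S) \<and>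
      \<not> digraph_iso (G \<restriction> S) (copies n (complete_graph 2)))
      \<or> is_bowtie_plus_edges n (G \<restriction> S)) \<longleftrightarrow> sg.admissible n S"
proof -
  have fin: "finite S" using finite_subset[OF assms(1) finite_verts] .
  have iso: "digraph_iso (G \<restriction> S) (copies n (complete_graph 2)) \<longleftrightarrow> sg.matching n S"
    unfolding digraph_iso_induce[OF assms(1) nomulti_copies[OF nomulti_complete_graph]]
    using sg.realizes_matching[OF fin] .
  have "\<not> (sg.mpol S = \<infinity> \<and> (\<forall>T. T \<subset> S \<longrightarrow> sg.mpol T \<noteq> \<infinity>)) \<and> \<not> sg.matching n S \<longleftrightarrow>
      sg.mpol S \<noteq> \<infinity> \<and> \<not> sg.clustered S" if o: "sg.mono_obs (n - 1) S"
  proof -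
    have "\<forall>T. T \<subset> S \<longrightarrow> sg.mpol T \<noteq> \<infinity>"
    proof (intro allI impI notI)
      fix T assume "T \<subset> S" and i: "sg.mpol T = \<infinity>"
      then have "sg.mpol T \<le> enat (n - 1)" using o unfolding sg.mono_obs_def by blast
      then show False using i by simp
    qed
    moreover have "sg.clustered S \<longleftrightarrow> sg.matching n S"
      using sg.mono_obs_clustered_matching[OF o fin assms(2)] assms(3) unfolding sg.matching_def by auto
    ultimately show ?thesis by simp
  qed
  then show ?thesis
    unfolding polar_obs_induce_iff(2,3)[OF assms(1)] bowtie_plus_induce_iff[OF assms(1)] iso sg.admissible_def
    using assms(2) by (cases "sg.mono_obs (n - 1) S") simp_all
qed

end

theorem theorem5:
  fixes G :: "('a, 'b) pre_digraph" and k :: nat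
  assumes "k \<ge> 1"
    and "graph G"
    and "\<forall>C \<in> graph_components G. \<not> digraph_iso C (path_graph 3)"
  shows "(cograph_minimal_polar_obstruction \<infinity> (enat k) G \<and>
          \<not> Digraph_Component.connected G \<and>
          (\<forall>C \<in> graph_components G. \<not> digraph_iso C (complete_graph 1)))
     \<longleftrightarrow>
     (\<exists>k1 k2 :: nat. \<exists>H1 H2 :: ('a, 'b) pre_digraph.
        k1 \<ge> 1 \<and> k2 \<ge> 1 \<and> cograph H1 \<and> cograph H2 \<and>
        is_disjoint_union G H1 H2 \<and>
        k = k1 + k2 - 1 \<and>
        (\<forall>(ki, Hi) \<in> {(k1, H1), (k2, H2)}.
           (cograph_minimal_polar_obstruction 1 (enat (ki - 1)) Hi \<and>
            \<not> cograph_minimal_polar_obstruction 1 \<infinity> Hi \<and>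
            \<not> digraph_iso Hi (copies ki (complete_graph 2)))
           \<or> is_bowtie_plus_edges ki Hi) \<and>
        (\<forall>(ki, Hi, kj) \<in> {(k1, H1, k2), (k2, H2, k1)}.
           is_bowtie_plus_edges ki Hi \<and>
           cograph_minimal_polar_obstruction 1 (enat (kj - 1)) (delete_subgraph G Hi)
           \<longrightarrow> (\<exists>!C. C \<in> graph_components (delete_subgraph G Hi) \<and>
                    \<not> digraph_iso C (complete_graph 2))))"
proof -
  interpret graph G by (rule assms(2))
  let ?V = "verts G"
  have V: "G \<restriction> ?V = G" by (rule induce_verts)
  have comps: "graph_components G = induce_subgraph G ` sg.comps ?V"
    using sccs_induce[of ?V] V by simp
  have fin: "finite S" if "S \<subseteq> ?V" for S using finite_subset[OF that finite_verts] .
  have lhs: "(cograph_minimal_polar_obstruction \<infinity> (enat k) G \<and>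
          \<not> Digraph_Component.connected G \<and>
          (\<forall>C \<in> graph_components G. \<not> digraph_iso C (complete_graph 1))) \<longleftrightarrow>
      (sg.p4_free ?V \<and> sg.polar_obs k ?V \<and> \<not> sg.conn ?V \<and> sg.no_isolated ?V)"
    using polar_obs_induce_iff(1)[of ?V k] comps_iso_complete_graph(1)[of ?V]
    unfolding V connected_iff comps sg.no_isolated_def by auto
  \<comment> \<open>A connected graph on three vertices that is no cluster is a P3, so the
    hypothesis becomes a condition on cardinalities.\<close>
  have noP3: "\<forall>K\<in>sg.comps ?V. card K = 3 \<longrightarrow> sg.clustered K"
  proof (intro ballI impI, rule ccontr)
    fix K assume K: "K \<in> sg.comps ?V" "card K = 3" and "\<not> sg.clustered K"
    then have "sg.realizes (path_graph 3) K"
      using sg.realizes_path_graph_3[OF sg.comps_conn[OF K(1)]] K(2) by blast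
    then have "digraph_iso (G \<restriction> K) (path_graph 3)"
      using digraph_iso_induce[OF sg.comps_subset[OF K(1)] nomulti_path_graph] by blast
    then show False using assms(3) K(1) unfolding comps by blast
  qed
  \<comment> \<open>Deleting one summand leaves exactly the other, so condition (4) can be read on
    vertex sets.\<close>
  have del: "delete_subgraph G (G \<restriction> S) = G \<restriction> T" "delete_subgraph G (G \<restriction> T) = G \<restriction> S"
    if "?V = S \<union> T" "S \<inter> T = {}" for S T
  proof -
    have "?V - S = T" "?V - T = S" using that by blast+
    then show "delete_subgraph G (G \<restriction> S) = G \<restriction> T" "delete_subgraph G (G \<restriction> T) = G \<restriction> S"
      unfolding delete_subgraph_def by simp_all
  qed
  show ?thesis (is "_ \<longleftrightarrow> (\<exists>k1 k2 H1 H2. _ \<and> _ \<and> _ \<and> _ \<and> _ \<and> _ \<and> ?c3 k1 k2 H1 H2 \<and> ?c4 k1 k2 H1 H2)"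
      is "_ \<longleftrightarrow> ?R")
    unfolding lhs
  proof
    assume l: "sg.p4_free ?V \<and> sg.polar_obs k ?V \<and> \<not> sg.conn ?V \<and> sg.no_isolated ?V"
    then have V': "sg.p4_free ?V" "sg.polar_obs k ?V" "sg.no_isolated ?V" "\<not> sg.conn ?V" by auto
    from sg.polar_obs_splits[OF finite_verts V' noP3]
    obtain k1 k2 S T where k12: "k1 \<ge> 1" "k2 \<ge> 1"
      and ST: "?V = S \<union> T" "S \<inter> T = {}" "sg.sep S T" and k: "k = k1 + k2 - 1"
      and ad: "sg.admissible k1 S" "sg.admissible k2 T"
      and u: "sg.bowtie_plus k1 S \<and> sg.mono_obs (k2 - 1) T \<longrightarrow> (\<exists>!K. K \<in> sg.comps T \<and> card K \<noteq> 2)"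
        "sg.bowtie_plus k2 T \<and> sg.mono_obs (k1 - 1) S \<longrightarrow> (\<exists>!K. K \<in> sg.comps S \<and> card K \<noteq> 2)"
      by (elim exE conjE) (rule that)
    note kk = k12 k
    have sub: "S \<subseteq> ?V" "T \<subseteq> ?V" using ST(1) by auto
    have p4: "sg.p4_free S" "sg.p4_free T" using sg.p4_free_mono[OF V'(1)] sub by auto
    note d = del[OF ST(1,2)]
    show ?R
    proof (rule exI[of _ k1], rule exI[of _ k2], rule exI[of _ "G \<restriction> S"], rule exI[of _ "G \<restriction> T"],
        intro conjI)
      show "k1 \<ge> 1" "k2 \<ge> 1" "k = k1 + k2 - 1" by fact+
      show "cograph (G \<restriction> S)" "cograph (G \<restriction> T)" using p4 cograph_induce_iff sub by blast+
      show "is_disjoint_union G (G \<restriction> S) (G \<restriction> T)" using is_disjoint_union_induce[OF ST] .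
      show "?c3 k1 k2 (G \<restriction> S) (G \<restriction> T)"
        using admissible_induce_iff[OF sub(1) p4(1) kk(1)] admissible_induce_iff[OF sub(2) p4(2) kk(2)] ad
        by blast
      show "?c4 k1 k2 (G \<restriction> S) (G \<restriction> T)"
        using u p4 d bowtie_plus_induce_iff[OF sub(1)] bowtie_plus_induce_iff[OF sub(2)]
          polar_obs_induce_iff(2)[OF sub(1)] polar_obs_induce_iff(2)[OF sub(2)]
          unique_non_edge_component_iff[OF sub(1)] unique_non_edge_component_iff[OF sub(2)] by simp
    qed
  next
    assume ?R
    then obtain k1 k2 H1 H2 where k12: "k1 \<ge> 1" "k2 \<ge> 1"
      and H: "cograph H1" "cograph H2" "is_disjoint_union G H1 H2" and k: "k = k1 + k2 - 1"
      and c3: "?c3 k1 k2 H1 H2" and c4: "?c4 k1 k2 H1 H2"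
      by (elim exE conjE) (rule that)
    note kk = k12 k
    define S T where "S = verts H1" and "T = verts H2"
    note dec = induce_decomposition[OF H, folded S_def T_def]
    have ST: "?V = S \<union> T" "S \<inter> T = {}" "sg.sep S T" and eq: "H1 = G \<restriction> S" "H2 = G \<restriction> T" by (fact dec)+
    have sub: "S \<subseteq> ?V" "T \<subseteq> ?V" using ST(1) by auto
    have p4: "sg.p4_free S" "sg.p4_free T"
      using H(1,2) cograph_induce_iff[OF sub(1)] cograph_induce_iff[OF sub(2)] eq by auto
    note d = del[OF ST(1,2)]
    have ad: "sg.admissible k1 S" "sg.admissible k2 T"
      using c3 admissible_induce_iff[OF sub(1) p4(1) kk(1)] admissible_induce_iff[OF sub(2) p4(2) kk(2)]
      unfolding eq by blast+
    have u: "\<exists>!K. K \<in> sg.comps T \<and> card K \<noteq> 2" if "sg.bowtie_plus k1 S" "sg.mono_obs (k2 - 1) T"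
      using c4 that p4 d bowtie_plus_induce_iff[OF sub(1)] polar_obs_induce_iff(2)[OF sub(2)]
        unique_non_edge_component_iff[OF sub(2)] unfolding eq by simp
    have u': "\<exists>!K. K \<in> sg.comps S \<and> card K \<noteq> 2" if "sg.bowtie_plus k2 T" "sg.mono_obs (k1 - 1) S"
      using c4 that p4 d bowtie_plus_induce_iff[OF sub(2)] polar_obs_induce_iff(2)[OF sub(1)]
        unique_non_edge_component_iff[OF sub(1)] unfolding eq by simp
    \<comment> \<open>Condition (4) is passed in both orientations, since either summand may be the
      one that loses a bowtie centre.\<close>
    note obs = sg.admissible_polar_obs[OF fin[OF sub(1)] fin[OF sub(2)] p4 ST(3,2) kk(1,2) ad u u']
    have "sg.p4_free ?V" using sg.p4_free_Un[OF p4 ST(3)] ST(1) by simp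
    then show "sg.p4_free ?V \<and> sg.polar_obs k ?V \<and> \<not> sg.conn ?V \<and> sg.no_isolated ?V"
      using obs kk(3) ST(1) by simp
  qed
qed

end
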